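(* (1) For every integer $r \geq 3$, $e_{r,r}(s)=e'_{r,r}(s)=s^2+(2r-7)s+\binom{r-2}{2}$ for all sufficiently large $s$. (2) For every integer $r \geq 3$, $e_{r,r+1}(s)=\Theta(s^{3/2})$ and $e'_{r,r+1}(s)=\Theta(s^{3/2})$. (3) For all integers $r \geq 3$ and $t \geq r+2$, $s^{1/(t-r+2)} \ll e_{r,t}(s) \leq e'_{r,t}(s) \ll s^{4/(t-r+2)}$. (4) For every integer $t \geq 5$, $s^{2/(t-3)} \ll e_{3,t}(s) \leq e'_{3,t}(s) \ll s^{4/(t-1)}$. (5) $\tfrac{2}{3}s + o(s) \leq e_{3,5}(s) \leq e'_{3,5}(s) \leq 2s + o(s)$.
   Context: All graphs are finite and simple; $e(H)$ is the number of edges. For $r\ge 3$, an $r$-system is a pair $(H,\mathcal{F})$ where $H$ is a graph and $\mathcal{F}$ is a family (possibly with repeated members) of subsets of $V(H)$ such that: (i) $H$ contains no $K_r$; (ii) every $S\in\mathcal{F}$ is maximally $K_{r-1}$-free, i.e. $H[S]$ contains no $K_{r-1}$ but $H[S\cup\{v\}]$ contains a $K_{r-1}$ for every $v\notin S$; (iii) for any two distinct members $S\neq T$ of $\mathcal{F}$, $H[S\cap T]$ contains a $K_{r-2}$. A maximal $r$-system is an $r$-system such that for every pair $e$ of non-adjacent vertices of $H$, either $H+e$ contains a $K_r$ or $(H+e)[S]$ contains a $K_{r-1}$ for some $S\in\mathcal{F}$. For $t\ge r-2$, an $(r,t)$-system (resp. maximal $(r,t)$-system) is an $r$-system (resp.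 maximal $r$-system) in which $\mathcal{F}$ has no repeated elements and every set in $\mathcal{F}$ has size exactly $t$. For integers $r\ge 3$, $t\ge r$, $s\ge 0$, $e_{r,t}(s)$ (resp. $e'_{r,t}(s)$) is the minimum of $e(H)$ over all $(r,t)$-systems (resp. maximal $(r,t)$-systems) $(H,\mathcal{F})$ with $|\mathcal{F}|=s$. Notation: $f\ll g$ means $f=O(g)$, $f=\Theta(g)$ means $f\ll g\ll f$, asymptotics as $s\to\infty$ with $r,t$ fixed. *)

theory Defs
  imports Complex_Main "HOL-Library.Ramsey" "HOL-Library.Multiset" "HOL-Library.Landau_Symbols"
begin

definition simple_graph :: "'a set \<Rightarrow> 'a set set \<Rightarrow> bool" where
  "simple_graph V E \<longleftrightarrow> finite V \<and> E \<subseteq> [V]\<^bsup>2\<^esup>"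

definition induced_edges :: "'a set set \<Rightarrow> 'a set \<Rightarrow> 'a set set" where
  "induced_edges E S = {e \<in> E. e \<subseteq> S}"

definition contains_K :: "nat \<Rightarrow> 'a set \<Rightarrow> 'a set set \<Rightarrow> bool" where
  "contains_K n V E \<longleftrightarrow> (\<exists>K \<in> [V]\<^bsup>n\<^esup>. clique K E)"

definition induced_contains_K :: "nat \<Rightarrow> 'a set set \<Rightarrow> 'a set \<Rightarrow> bool" where
  "induced_contains_K n E S \<longleftrightarrow> contains_K n S (induced_edges E S)"

definition maximally_K_free :: "nat \<Rightarrow> 'a set \<Rightarrow> 'a set set \<Rightarrow> 'a set \<Rightarrow> bool" where
  "maximally_K_free n V E S \<longleftrightarrow>
     \<not> induced_contains_K n E S \<and> (\<forall>v \<in> V - S. induced_contains_K n E (insert v S))"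

text \<open>The family is a multiset because a general \<open>r\<close>-system may have repeated members.\<close>

definition r_system :: "nat \<Rightarrow> 'a set \<Rightarrow> 'a set set \<Rightarrow> 'a set multiset \<Rightarrow> bool" where
  "r_system r V E F \<longleftrightarrow>
     3 \<le> r \<and> simple_graph V E \<and> (\<forall>S \<in># F. S \<subseteq> V) \<and>
     \<not> contains_K r V E \<and>
     (\<forall>S \<in># F. maximally_K_free (r - 1) V E S) \<and>
     (\<forall>S \<in># F. \<forall>T \<in># F. S \<noteq> T \<longrightarrow> induced_contains_K (r - 2) E (S \<inter> T))"

definition maximal_r_system :: "nat \<Rightarrow> 'a set \<Rightarrow> 'a set set \<Rightarrow> 'a set multiset \<Rightarrow> bool" where
  "maximal_r_system r V E F \<longleftrightarrow>
     r_system r V E F \<and>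
     (\<forall>e \<in> [V]\<^bsup>2\<^esup> - E. contains_K r V (insert e E) \<or>
        (\<exists>S \<in># F. induced_contains_K (r - 1) (insert e E) S))"

definition uniform_family :: "nat \<Rightarrow> 'a set multiset \<Rightarrow> bool" where
  "uniform_family t F \<longleftrightarrow> (\<forall>S. count F S \<le> 1) \<and> (\<forall>S \<in># F. card S = t)"

definition rt_system :: "nat \<Rightarrow> nat \<Rightarrow> 'a set \<Rightarrow> 'a set set \<Rightarrow> 'a set multiset \<Rightarrow> bool" where
  "rt_system r t V E F \<longleftrightarrow> r - 2 \<le> t \<and> r_system r V E F \<and> uniform_family t F"

definition maximal_rt_system ::
    "nat \<Rightarrow> nat \<Rightarrow> 'a set \<Rightarrow> 'a set set \<Rightarrow> 'a set multiset \<Rightarrow> bool" where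
  "maximal_rt_system r t V E F \<longleftrightarrow> r - 2 \<le> t \<and> maximal_r_system r V E F \<and> uniform_family t F"

text \<open>Vertices are taken in \<open>nat\<close>, which loses nothing since every finite graph is isomorphic
  to one on natural numbers. The infimum is over a set of natural numbers, so it is attained
  whenever that set is nonempty, which is the case for all \<open>r \<ge> 3\<close>, \<open>t \<ge> r\<close>, \<open>s \<ge> 0\<close>.\<close>

definition e_min :: "nat \<Rightarrow> nat \<Rightarrow> nat \<Rightarrow> nat" where
  "e_min r t s =
     Inf {card E | (V :: nat set) E F. rt_system r t V E F \<and> size F = s}"

definition e_min_maximal :: "nat \<Rightarrow> nat \<Rightarrow> nat \<Rightarrow> nat" where
  "e_min_maximal r t s =
     Inf {card E | (V :: nat set) E F. maximal_rt_system r t V E F \<and> size F = s}"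

end

theory Submission
  imports Defs
begin

text \<open>
  For \<open>r = 3\<close> a system is a family of pairwise intersecting maximal independent sets of size \<open>t\<close> in a
  triangle-free graph. Up to a constant factor (and, when exact constants matter, up to a negligible
  case) all members share a vertex, whose removal together with its neighbours leaves a triangle-free
  graph and maximal independent sets of size \<open>t - 1\<close>. The key fact is that a triangle-free graph on
  \<open>n\<close> vertices has at most \<open>max 64 n\<close> maximal independent triples; it is proved by a discharging
  argument in which a vertex lying in at least four triples is called rich, and a triple with two rich
  vertices has a third vertex lying in no other triple. Double counting
  (a maximal independent set dominates all \<open>n\<close> vertices, so its degrees sum to about \<open>n\<close>) turns this
  into bounds in terms of the number of edges.

  For general \<open>r\<close> a pigeonhole and Ramsey argument finds, when \<open>t \<le> r + 1\<close>, a member that is a join of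
  \<open>K\<^sub>r\<^sub>-\<^sub>3\<close> with an independent set, unless some vertex outside a common clique lies in a constant
  proportion of the members; one such member forces the whole graph to be the join of \<open>K\<^sub>r\<^sub>-\<^sub>3\<close> with a
  graph carrying a system for \<open>r = 3\<close>.

  The upper bounds come from complete bipartite graphs minus a perfect matching, from the incidence
  complement of points and pairs, and from blow-ups of a cycle, all completed to maximal systems by
  adding edges and lifted to larger \<open>r\<close> by coning.
\<close>

subsection \<open>Maximal independent triples in triangle-free graphs\<close>

text \<open>A maximal independent set of bounded size dominates the graph, so its degrees sum to
  about n. Counting pairs (set, vertex) weighted by degree therefore converts a bound on the sets in
  the non-neighbourhood of a vertex into a bound on edges. Each passage to a non-neighbourhood
  shortens the sets by one, and the linear bound for triples is where this recursion starts. The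
  obstacle for r > 3 is that the (r-2)-cliques inside a member may sit anywhere, so a member need
  not be an independent set joined to a clique. Members meeting exactly in a common (r-2)-clique
  have k = t - (r-2) further vertices. Two of them with the same adjacency pattern and no edge
  between equally labelled vertices force the join; the argument uses that k labels cannot form two
  classes of size at least two, that is k \<le> 3. This covers t = r and t = r+1; for larger t and r
  > 3 only the number of k-subsets of the vertex set is counted. For r = 3 members are independent
  and no join has to be found. In the constructions completion may add edges; except for cycles,
  where a trivial edge count suffices, the members and triangle-freeness keep their number
  small.\<close>

locale triangle_free =
  fixes adj :: "'a \<Rightarrow> 'a \<Rightarrow> bool"
  assumes sym: "adj x y \<Longrightarrow> adj y x"
    and tri: "adj x y \<Longrightarrow> adj y z \<Longrightarrow> \<not> adj x z"
begin

lemma irrefl: "\<not> adj x x"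
  using tri by blast

lemma adj_commute: "adj x y = adj y x"
  using sym by blast

definition mis :: "'a set \<Rightarrow> nat \<Rightarrow> 'a set set" where
  "mis V k = {P. P \<subseteq> V \<and> finite P \<and> card P = k \<and> (\<forall>x\<in>P. \<forall>y\<in>P. \<not> adj x y) \<and>
     (\<forall>x\<in>V - P. \<exists>y\<in>P. adj x y)}"

definition nbrs :: "'a set \<Rightarrow> 'a \<Rightarrow> 'a set" where
  "nbrs V x = {y \<in> V. adj x y}"

definition deg :: "'a set \<Rightarrow> 'a \<Rightarrow> nat" where
  "deg V x = card (nbrs V x)"

definition degsum :: "'a set \<Rightarrow> nat" where
  "degsum V = (\<Sum>x\<in>V. deg V x)"

lemma finite_mis: "finite V \<Longrightarrow> finite (mis V k)"
  by (rule finite_subset[of _ "Pow V"]) (auto simp: mis_def)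

lemma mis_subset: "V' \<subseteq> V \<Longrightarrow> P \<in> mis V k \<Longrightarrow> P \<subseteq> V' \<Longrightarrow> P \<in> mis V' k"
  by (auto simp: mis_def)

text \<open>A maximal independent set is determined by its trace outside an independent set.\<close>

lemma card_mis_large_independent:
  assumes V: "finite V" and I: "\<And>x y. x \<in> V - Z \<Longrightarrow> y \<in> V - Z \<Longrightarrow> \<not> adj x y"
    and Z: "finite Z" "card Z \<le> m"
  shows "card (mis V k) \<le> 2 ^ m"
proof -
  have eq: "P = (P \<inter> Z) \<union> {x \<in> V - Z. \<not> (\<exists>y\<in>P \<inter> Z. adj x y)}" if "P \<in> mis V k" for P
    using that I unfolding mis_def by blast
  have "inj_on (\<lambda>P. P \<inter> Z) (mis V k)"
    by (rule inj_onI) (metis eq)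
  then have "card (mis V k) \<le> card (Pow Z)"
    by (rule card_inj_on_le) (use Z in auto)
  also have "\<dots> \<le> 2 ^ m"
    using Z by (simp add: card_Pow power_increasing)
  finally show ?thesis .
qed

end

text \<open>The bound 64 excludes graphs with an independent set that misses at most six vertices.\<close>

locale many_triples = triangle_free +
  fixes V :: "'a set"
  assumes finV: "finite V" and many: "64 < card (mis V 3)"
begin

definition T :: "'a \<Rightarrow> 'a \<Rightarrow> 'a \<Rightarrow> bool" where
  "T u v w \<longleftrightarrow> {u, v, w} \<in> mis V 3"

definition mult :: "'a \<Rightarrow> nat" where
  "mult u = card {t \<in> mis V 3. u \<in> t}"

text \<open>Two completions of a pair to a triple are adjacent, so the neighbourhoods of such a pair cover all but
  four vertices.\<close>

definition twin :: "'a \<Rightarrow> 'a \<Rightarrow> bool" where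
  "twin u a \<longleftrightarrow> (\<exists>v v'. v \<noteq> v' \<and> T u a v \<and> T u a v')"

lemma T_perm: "T u v w \<Longrightarrow> T v u w" "T u v w \<Longrightarrow> T u w v"
  unfolding T_def by (simp_all add: insert_commute)

lemma T_perms: "T u v w \<Longrightarrow> T v w u" "T u v w \<Longrightarrow> T w u v" "T u v w \<Longrightarrow> T w v u"
  unfolding T_def by (simp_all add: insert_commute)

lemma T_distinct: "T u v w \<Longrightarrow> u \<noteq> v \<and> u \<noteq> w \<and> v \<noteq> w"
proof -
  assume "T u v w"
  then have "card {u, v, w} = 3" by (simp add: T_def mis_def)
  then show ?thesis by (auto simp: card_insert_if split: if_splits)
qed

lemma T_in: "T u v w \<Longrightarrow> u \<in> V \<and> v \<in> V \<and> w \<in> V"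
  by (simp add: T_def mis_def)

lemma T_nadj: "T u v w \<Longrightarrow> \<not> adj u v \<and> \<not> adj u w \<and> \<not> adj v w \<and> \<not> adj v u \<and> \<not> adj w u \<and> \<not> adj w v"
  by (auto simp: T_def mis_def)

lemma T_dom: "T u v w \<Longrightarrow> x \<in> V \<Longrightarrow> x \<noteq> u \<Longrightarrow> x \<noteq> v \<Longrightarrow> x \<noteq> w \<Longrightarrow> adj x u \<or> adj x v \<or> adj x w"
  by (auto simp: T_def mis_def)

lemma mis3E:
  assumes "t \<in> mis V 3" "u \<in> t"
  obtains v w where "t = {u, v, w}" "T u v w"
proof -
  have "card t = 3" "finite t" using assms by (auto simp: mis_def)
  then have "card (t - {u}) = 2" using assms by simp
  then obtain v w where "t - {u} = {v, w}" by (auto simp: card_2_iff)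
  then have "t = {u, v, w}" using assms by auto
  then show ?thesis using that assms by (auto simp: T_def)
qed

text \<open>The neighbourhood of a vertex is independent, so a vertex adjacent to all but six others
  would leave at most 2^6 maximal independent triples. The exceptions may repeat.\<close>

lemma not_covered:
  assumes "\<And>x. x \<in> V \<Longrightarrow> x \<notin> {a, b, c, d, e, f} \<Longrightarrow> adj x u"
  shows False
proof -
  have "card (mis V 3) \<le> 2 ^ 6"
  proof (rule card_mis_large_independent[where Z = "{a, b, c, d, e, f}"])
    show "\<not> adj x y" if "x \<in> V - {a, b, c, d, e, f}" "y \<in> V - {a, b, c, d, e, f}" for x y
      using that assms[of x] assms[of y] tri sym by (meson DiffE)
  qed (auto simp: finV card_insert_if)
  then show False using many by simp
qed

text \<open>Two 2-element subsets of {u, v, w} intersect, so two vertices of this kind have a common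
  neighbour and cannot be adjacent: again all but six vertices form an independent set.\<close>

lemma not_pairwise_covered:
  assumes "\<And>x. x \<in> V \<Longrightarrow> x \<notin> {a, b, c, d, e, f} \<Longrightarrow>
     (adj x u \<and> adj x v) \<or> (adj x u \<and> adj x w) \<or> (adj x v \<and> adj x w)"
  shows False
proof -
  have "card (mis V 3) \<le> 2 ^ 6"
  proof (rule card_mis_large_independent[where Z = "{a, b, c, d, e, f}"])
    fix x y assume "x \<in> V - {a, b, c, d, e, f}" "y \<in> V - {a, b, c, d, e, f}"
    then have c: "(adj x u \<and> adj x v) \<or> (adj x u \<and> adj x w) \<or> (adj x v \<and> adj x w)"
      "(adj y u \<and> adj y v) \<or> (adj y u \<and> adj y w) \<or> (adj y v \<and> adj y w)"
      using assms by blast+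
    show "\<not> adj x y"
    proof
      assume "adj x y"
      then have "\<not> (adj x z \<and> adj y z)" for z using tri by blast
      then show False using c by metis
    qed
  qed (auto simp: finV card_insert_if)
  then show False using many by simp
qed

section \<open>Twin pairs and the triples through them\<close>

lemma completions_adj:
  assumes "T u a v" "T u a v'" "v \<noteq> v'" shows "adj v v'"
  using T_dom[OF assms(2), of v] T_nadj[OF assms(1)] T_in[OF assms(1)] T_distinct[OF assms(1)] assms(3)
  by blast

lemma completions_le2:
  assumes "T u a v" "T u a v'" "T u a v''" "v \<noteq> v'" "v \<noteq> v''" shows "v' = v''"
  using completions_adj[OF assms(1,2)] completions_adj[OF assms(1,3)] completions_adj[OF assms(2,3)]
    assms(4,5) tri sym by blast

lemma twin_dom:
  assumes "T u a v" "T u a v'" "v \<noteq> v'" "x \<in> V" "x \<notin> {u, a, v, v'}"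
  shows "adj x u \<or> adj x a"
  using T_dom[OF assms(1), of x] T_dom[OF assms(2), of x] completions_adj[OF assms(1-3)] assms(4,5) tri
  by blast

lemma twinI: "T u a v \<Longrightarrow> T u a v' \<Longrightarrow> v \<noteq> v' \<Longrightarrow> twin u a"
  unfolding twin_def by blast

lemma twin_sym: "twin u a \<Longrightarrow> twin a u"
  unfolding twin_def using T_perm by blast

text \<open>If \<open>c\<close> and \<open>d\<close> avoid \<open>a\<close>, \<open>v\<close>,
  \<open>v'\<close> then, being non-neighbours of \<open>u\<close>, both are adjacent to
  \<open>a\<close>. A further vertex not adjacent to \<open>u\<close> is adjacent to
  \<open>a\<close>, hence to neither \<open>c\<close> nor \<open>d\<close>, and {u, c, d} fails to
  dominate it. So \<open>u\<close> would be adjacent to all but six vertices.\<close>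

lemma twin_no_disjoint:
  assumes a: "T u a v" "T u a v'" "v \<noteq> v'" and cd: "T u c d"
  shows "c \<in> {a, v, v'} \<or> d \<in> {a, v, v'}"
proof (rule ccontr)
  assume "\<not> ?thesis"
  then have n: "c \<notin> {a, v, v'}" "d \<notin> {a, v, v'}" by auto
  have c: "adj c a" using twin_dom[OF a, of c] T_in[OF cd] T_nadj[OF cd] T_distinct[OF cd] n by auto
  have d: "adj d a" using twin_dom[OF a, of d] T_in[OF cd] T_nadj[OF cd] T_distinct[OF cd] n by auto
  show False
  proof (rule not_covered[of u a v v' c d u])
    fix x assume x: "x \<in> V" "x \<notin> {u, a, v, v', c, d}"
    show "adj x u"
      using twin_dom[OF a x(1)] T_dom[OF cd x(1)] x(2) c d tri by blast
  qed
qed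

text \<open>Otherwise (u, v) and (u, v') would be twin pairs as well. A further vertex not adjacent
  to \<open>u\<close> would then be adjacent to both \<open>v\<close> and \<open>v'\<close>, which
  are themselves adjacent.\<close>

lemma twin_one_side:
  assumes a: "T u a v" "T u a v'" "v \<noteq> v'" and z: "T u v z" "z \<noteq> a" and z': "T u v' z'" "z' \<noteq> a"
  shows False
proof (rule not_covered[of u a v v' z z' u])
  fix x assume x: "x \<in> V" "x \<notin> {u, a, v, v', z, z'}"
  have "adj x u \<or> adj x v"
    by (rule twin_dom[OF T_perm(2)[OF a(1)] z(1)]) (use x z in auto)
  moreover have "adj x u \<or> adj x v'"
    by (rule twin_dom[OF T_perm(2)[OF a(2)] z'(1)]) (use x z' in auto)
  ultimately show "adj x u" using completions_adj[OF a] tri by blast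
qed

lemma twin_triples:
  assumes a: "T u a v" "T u a v'" "v \<noteq> v'" and t: "T u c d"
  shows "{c, d} = {a, v} \<or> {c, d} = {a, v'} \<or> (\<exists>z. z \<noteq> a \<and> T u v z \<and> {c, d} = {v, z}) \<or>
    (\<exists>z. z \<noteq> a \<and> T u v' z \<and> {c, d} = {v', z})"
proof -
  define Q where "Q e \<longleftrightarrow> e = {a, v} \<or> e = {a, v'} \<or> (\<exists>z. z \<noteq> a \<and> T u v z \<and> e = {v, z}) \<or>
    (\<exists>z. z \<noteq> a \<and> T u v' z \<and> e = {v', z})" for e
  have *: "Q {c, d}" if t: "T u c d" and c: "c \<in> {a, v, v'}" for c d
  proof (cases "c = a \<or> d = a")
    case True
    then have "T u a d \<and> c = a \<or> T u a c \<and> d = a" using t T_perm(2) by blast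
    then have "{c, d} = {a, v} \<or> {c, d} = {a, v'}"
      using completions_le2[OF a(1,2)] a(3) by (metis insert_commute)
    then show ?thesis unfolding Q_def by blast
  next
    case False
    then have "c = v \<or> c = v'" using c by auto
    then show ?thesis using t False unfolding Q_def by blast
  qed
  have "c \<in> {a, v, v'} \<or> d \<in> {a, v, v'}" by (rule twin_no_disjoint[OF a t])
  then have "Q {c, d}"
  proof
    assume "d \<in> {a, v, v'}"
    from *[OF T_perm(2)[OF t] this] show ?thesis by (simp add: insert_commute)
  qed (rule *[OF t])
  then show ?thesis unfolding Q_def .
qed

text \<open>By \<open>twin_one_side\<close> one of \<open>v\<close>, \<open>v'\<close> is completed
  with \<open>u\<close> by \<open>a\<close> only, and the other has at most one further completion
  \<open>z\<close>. So at most the pairs {a, v}, {a, v'}, {v, z} complete \<open>u\<close>.\<close>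

lemma twin_mult_le3:
  assumes "twin u a" shows "mult u \<le> 3"
proof -
  obtain v v' where a: "T u a v" "T u a v'" "v \<noteq> v'" using assms by (auto simp: twin_def)
  have *: "mult u \<le> 3"
    if a: "T u a v" "T u a v'" "v \<noteq> v'" and none: "\<And>z. z \<noteq> a \<Longrightarrow> \<not> T u v' z" for v v'
  proof -
    obtain z where z: "\<And>y. y \<noteq> a \<Longrightarrow> T u v y \<Longrightarrow> y = z"
      using completions_le2[OF T_perm(2)[OF a(1)]] by metis
    have "{t \<in> mis V 3. u \<in> t} \<subseteq> {{u, a, v}, {u, a, v'}, {u, v, z}}"
    proof
      fix t assume "t \<in> {t \<in> mis V 3. u \<in> t}"
      then obtain c d where cd: "t = {u, c, d}" "T u c d" using mis3E by blast
      then show "t \<in> {{u, a, v}, {u, a, v'}, {u, v, z}}"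
        using twin_triples[OF a cd(2)] none z by (metis insertCI)
    qed
    then have "mult u \<le> card {{u, a, v}, {u, a, v'}, {u, v, z}}"
      unfolding mult_def by (rule card_mono[rotated]) simp
    also have "\<dots> \<le> 3" by (simp add: card_insert_if)
    finally show ?thesis .
  qed
  show ?thesis
    using *[OF a] *[OF a(2,1)] a(3) twin_one_side[OF a] by metis
qed

text \<open>Normal form of the extremal case: the pairs that complete \<open>u\<close> are the edges
  of a path \<open>v'\<close>, \<open>a\<close>, \<open>v\<close>, \<open>z\<close>, and
  \<open>u\<close> is twin with both inner vertices.\<close>

lemma twin_mult3E:
  assumes "twin u a" "mult u = 3"
  obtains v v' z where "T u a v" "T u a v'" "v \<noteq> v'" "T u v z" "z \<noteq> a"
    "\<forall>c d. T u c d \<longrightarrow> {c, d} = {a, v} \<or> {c, d} = {a, v'} \<or> {c, d} = {v, z}"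
proof -
  note found = that
  obtain v v' where a: "T u a v" "T u a v'" "v \<noteq> v'" using assms by (auto simp: twin_def)
  have "\<exists>t. t \<in> mis V 3 \<and> u \<in> t \<and> t \<noteq> {u, a, v} \<and> t \<noteq> {u, a, v'}"
  proof (rule ccontr)
    assume "\<not> ?thesis"
    then have "{t \<in> mis V 3. u \<in> t} \<subseteq> {{u, a, v}, {u, a, v'}}" by auto
    then have "mult u \<le> card {{u, a, v}, {u, a, v'}}"
      unfolding mult_def by (rule card_mono[rotated]) simp
    also have "\<dots> \<le> 2" by (simp add: card_insert_if)
    finally show False using assms by simp
  qed
  then obtain t where t: "t \<in> mis V 3" "u \<in> t" "t \<noteq> {u, a, v}" "t \<noteq> {u, a, v'}" by blast
  obtain c d where cd: "t = {u, c, d}" "T u c d" using mis3E[OF t(1,2)] by blast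
  have main: thesis if a: "T u a v" "T u a v'" "v \<noteq> v'" and z: "T u v z" "z \<noteq> a" for v v' z
  proof (rule found[OF a z], intro allI impI)
    fix c d assume t: "T u c d"
    show "{c, d} = {a, v} \<or> {c, d} = {a, v'} \<or> {c, d} = {v, z}"
      using twin_triples[OF a t] twin_one_side[OF a z] completions_le2[OF T_perm(2)[OF a(1)] z(1)] z(2)
      by metis
  qed
  have "{c, d} \<noteq> {a, v}" "{c, d} \<noteq> {a, v'}" using t(3,4) cd(1) by auto
  then have "(\<exists>z. z \<noteq> a \<and> T u v z) \<or> (\<exists>z. z \<noteq> a \<and> T u v' z)"
    using twin_triples[OF a cd(2)] by blast
  then show thesis
    using main[OF a] main[OF a(2,1) a(3)[symmetric]] by blast
qed

text \<open>All three pairs inside {u, v, a} are twin here. A vertex off the list is adjacent to an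
  end of each pair, hence to two of the three vertices.\<close>

lemma no_twin_triangle:
  assumes uva: "T u v a" and z: "T u v z" "z \<noteq> a" and v': "T u a v'" "v' \<noteq> v" and y: "T v a y" "y \<noteq> u"
  shows False
proof (rule not_pairwise_covered[of u v a z v' y u v a])
  fix x assume x: "x \<in> V" "x \<notin> {u, v, a, z, v', y}"
  have "adj x u \<or> adj x v" by (rule twin_dom[OF uva z(1)]) (use x z in auto)
  moreover have "adj x u \<or> adj x a" by (rule twin_dom[OF T_perm(2)[OF uva] v'(1)]) (use x v' in auto)
  moreover have "adj x v \<or> adj x a" by (rule twin_dom[OF T_perms(1)[OF uva] y(1)]) (use x y in auto)
  ultimately show "adj x u \<and> adj x v \<or> adj x u \<and> adj x a \<or> adj x v \<and> adj x a" by blast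
qed

section \<open>Vertices of high multiplicity\<close>

text \<open>Vertices of the three pairs are not adjacent to \<open>u\<close>, so each is adjacent to
  a vertex of each other pair. If \<open>v\<close> were adjacent to both \<open>a\<close> and
  \<open>b\<close>, then \<open>c\<close> and \<open>d\<close>, each adjacent to one of these, could
  not be adjacent to \<open>v\<close>, which {u, c, d} would then not dominate. So \<open>v\<close>,
  and likewise \<open>w\<close>, has exactly one neighbour in {a, b}; since \<open>a\<close> and
  \<open>b\<close> are dominated too, the edges form a perfect matching.\<close>

lemma cross_matching:
  assumes T: "T u v w" "T u a b" "T u c d"
    and d: "{v, w} \<inter> {a, b} = {}" "{v, w} \<inter> {c, d} = {}" "{a, b} \<inter> {c, d} = {}"
  shows "(adj v b \<and> adj w a \<and> \<not> adj v a \<and> \<not> adj w b) \<or> (adj v a \<and> adj w b \<and> \<not> adj v b \<and> \<not> adj w a)"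
proof -
  have dom: "adj x p \<or> adj x q" if "T u p q" "T u x y" "x \<notin> {p, q}" for p q x y
    using T_dom[OF that(1), of x] T_in[OF that(2)] T_nadj[OF that(2)] T_distinct[OF that(2)] that(3) by auto
  note T' = T[THEN T_perm(2)]
  have 1: "adj v a \<or> adj v b" using dom[OF T(2) T(1)] d by auto
  have 2: "adj w a \<or> adj w b" using dom[OF T(2) T'(1)] d by auto
  have 3: "adj v c \<or> adj v d" using dom[OF T(3) T(1)] d by auto
  have 4: "adj w c \<or> adj w d" using dom[OF T(3) T'(1)] d by auto
  have 5: "adj a v \<or> adj a w" using dom[OF T(1) T(2)] d by auto
  have 6: "adj b v \<or> adj b w" using dom[OF T(1) T'(2)] d by auto
  have 7: "adj a c \<or> adj a d" using dom[OF T(3) T(2)] d by auto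
  have 8: "adj b c \<or> adj b d" using dom[OF T(3) T'(2)] d by auto
  have 9: "adj c v \<or> adj c w" using dom[OF T(1) T(3)] d by auto
  have 10: "adj d v \<or> adj d w" using dom[OF T(1) T'(3)] d by auto
  have 11: "adj c a \<or> adj c b" using dom[OF T(2) T(3)] d by auto
  have 12: "adj d a \<or> adj d b" using dom[OF T(2) T'(3)] d by auto
  note tri3 = tri[of v a c] tri[of v a d] tri[of v b c] tri[of v b d]
    tri[of w a c] tri[of w a d] tri[of w b c] tri[of w b d]
  note comm = adj_commute[of a v] adj_commute[of a w] adj_commute[of b v] adj_commute[of b w]
    adj_commute[of c v] adj_commute[of c w] adj_commute[of d v] adj_commute[of d w]
    adj_commute[of c a] adj_commute[of c b] adj_commute[of d a] adj_commute[of d b]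
  show ?thesis
    using 1 2 3 4 5 6 7 8 9 10 11 12 tri3 unfolding comm by argo
qed

lemma link_disjoint:
  assumes u: "\<And>a. \<not> twin u a" and T: "T u v w" "T u a b" and ne: "{v, w} \<noteq> {a, b}"
  shows "{v, w} \<inter> {a, b} = {}"
proof -
  have same: "y = z" if "T u x y" "T u x z" for x y z using u twinI that by blast
  have ex: "\<exists>y. {p, q} = {x, y} \<and> T u x y" if "T u p q" "x \<in> {p, q}" for x p q
    using that T_perm(2)[OF that(1)] by blast
  show ?thesis
  proof (rule ccontr)
    assume "\<not> ?thesis"
    then obtain x where x: "x \<in> {v, w}" "x \<in> {a, b}" by blast
    obtain y z where "{v, w} = {x, y}" "T u x y" "{a, b} = {x, z}" "T u x z"
      using ex[OF T(1) x(1)] ex[OF T(2) x(2)] by blast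
    then show False using same ne by blast
  qed
qed

text \<open>If \<open>u\<close> lies in three triples meeting only in \<open>u\<close>, the remaining pairs span a complete bipartite graph
  minus a perfect matching; the pair \<open>(a, b)\<close> is ordered so that \<open>a\<close> is on the side of \<open>v\<close> and \<open>b\<close> on that of \<open>w\<close>.\<close>

definition lab :: "'a \<Rightarrow> 'a \<Rightarrow> 'a \<Rightarrow> 'a \<Rightarrow> 'a \<Rightarrow> bool" where
  "lab u v w a b \<longleftrightarrow> T u a b \<and> adj v b \<and> adj w a \<and> \<not> adj v a \<and> \<not> adj w b"

lemma labelled_pairs:
  assumes u: "\<And>a. \<not> twin u a" and T: "T u v w" and m: "3 \<le> mult u"
  obtains S where "finite S" "card S = mult u - 1" "inj_on fst S" "inj_on snd S"
    "\<And>a b. (a, b) \<in> S \<Longrightarrow> lab u v w a b"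
proof -
  define X where "X = {t \<in> mis V 3. u \<in> t} - {{u, v, w}}"
  have fin: "finite X" unfolding X_def using finite_mis[OF finV] by auto
  have cX: "card X = mult u - 1"
    unfolding X_def mult_def using T finite_mis[OF finV] by (simp add: T_def)
  have "\<forall>t\<in>X. \<exists>p. t = {u, fst p, snd p} \<and> lab u v w (fst p) (snd p)"
  proof
    fix t assume t: "t \<in> X"
    \<comment> \<open>\<open>cross_matching\<close> needs a third triple besides \<open>t\<close>
      and {u, v, w}; this is where \<open>3 \<le> mult u\<close> enters.\<close>
    have "card (X - {t}) \<ge> 1" using cX m t fin by simp
    then obtain t' where t': "t' \<in> X" "t' \<noteq> t"
      by (metis One_nat_def card.empty equals0I Diff_iff insertCI not_one_le_zero)
    obtain a b where ab: "t = {u, a, b}" "T u a b" using t mis3E unfolding X_def by blast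
    obtain c d where cd: "t' = {u, c, d}" "T u c d" using t' mis3E unfolding X_def by blast
    have "t \<noteq> {u, v, w}" "t' \<noteq> {u, v, w}" using t t' unfolding X_def by blast+
    then have "{v, w} \<noteq> {a, b}" "{v, w} \<noteq> {c, d}" "{a, b} \<noteq> {c, d}"
      using t'(2) ab(1) cd(1) by metis+
    note ne = this
    have "(adj v b \<and> adj w a \<and> \<not> adj v a \<and> \<not> adj w b) \<or> (adj v a \<and> adj w b \<and> \<not> adj v b \<and> \<not> adj w a)"
      by (rule cross_matching[OF T ab(2) cd(2) link_disjoint[OF u T ab(2) ne(1)]
            link_disjoint[OF u T cd(2) ne(2)] link_disjoint[OF u ab(2) cd(2) ne(3)]])
    then have "lab u v w a b \<or> lab u v w b a"
      unfolding lab_def using ab T_perm(2) by blast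
    then show "\<exists>p. t = {u, fst p, snd p} \<and> lab u v w (fst p) (snd p)"
    proof
      assume "lab u v w a b" then show ?thesis using ab(1) by (intro exI[of _ "(a, b)"]) simp
    next
      assume "lab u v w b a" then show ?thesis using ab(1) by (intro exI[of _ "(b, a)"]) auto
    qed
  qed
  from bchoice[OF this] obtain f where
    "\<forall>t\<in>X. t = {u, fst (f t), snd (f t)} \<and> lab u v w (fst (f t)) (snd (f t))" by blast
  then have f: "\<And>t. t \<in> X \<Longrightarrow> t = {u, fst (f t), snd (f t)}"
    "\<And>t. t \<in> X \<Longrightarrow> lab u v w (fst (f t)) (snd (f t))" by blast+
  have inj: "f t \<noteq> f t'" if "t \<in> X" "t' \<in> X" "t \<noteq> t'" for t t'
    using f(1)[OF that(1)] f(1)[OF that(2)] that(3) by metis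
  have disj: "{fst (f t), snd (f t)} \<inter> {fst (f t'), snd (f t')} = {}" if t: "t \<in> X" "t' \<in> X" "t \<noteq> t'" for t t'
  proof (rule link_disjoint[OF u])
    show "T u (fst (f t)) (snd (f t))" "T u (fst (f t')) (snd (f t'))" using f(2) t by (auto simp: lab_def)
    show "{fst (f t), snd (f t)} \<noteq> {fst (f t'), snd (f t')}" using f(1)[OF t(1)] f(1)[OF t(2)] t(3) by metis
  qed
  show thesis
  proof (rule that[of "f ` X"])
    show "inj_on fst (f ` X)"
    proof (rule inj_onI)
      fix p q assume "p \<in> f ` X" "q \<in> f ` X" "fst p = fst q"
      then show "p = q" using disj by blast
    qed
    show "inj_on snd (f ` X)"
    proof (rule inj_onI)
      fix p q assume "p \<in> f ` X" "q \<in> f ` X" "snd p = snd q"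
      then show "p = q" using disj by blast
    qed
    show "lab u v w a b" if "(a, b) \<in> f ` X" for a b
    proof -
      from that obtain t where "t \<in> X" "f t = (a, b)" by auto
      then show ?thesis using f(2)[of t] by simp
    qed
    show "card (f ` X) = mult u - 1" using card_image[of f X] inj cX by (metis inj_onI)
  qed (use fin in auto)
qed

lemma pick_snd:
  assumes "finite S" "2 \<le> card S" "inj_on snd S"
  obtains a b where "(a, b) \<in> S" "b \<noteq> y"
proof -
  have "\<not> S \<subseteq> {p \<in> S. snd p = y}"
  proof
    assume "S \<subseteq> {p \<in> S. snd p = y}"
    then have "snd ` S \<subseteq> {y}" by auto
    then have "card S \<le> card {y}" using assms card_inj_on_le by blast
    then show False using assms by simp
  qed
  then obtain p where "p \<in> S" "snd p \<noteq> y" by blast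
  then show ?thesis using that[of "fst p" "snd p"] by simp
qed

lemma pick_fst_snd:
  assumes "finite S" "3 \<le> card S" "inj_on fst S" "inj_on snd S"
  obtains c d where "(c, d) \<in> S" "c \<noteq> a" "d \<noteq> y"
proof -
  have "card {p \<in> S. fst p = a} \<le> card {a}"
    by (rule card_inj_on_le[where f = fst]) (use assms in \<open>auto intro: inj_on_subset\<close>)
  moreover have "card {p \<in> S. snd p = y} \<le> card {y}"
    by (rule card_inj_on_le[where f = snd]) (use assms in \<open>auto intro: inj_on_subset\<close>)
  ultimately have "card ({p \<in> S. fst p = a} \<union> {p \<in> S. snd p = y}) \<le> 2"
    using card_Un_le[of "{p \<in> S. fst p = a}" "{p \<in> S. snd p = y}"] by simp
  moreover have "finite ({p \<in> S. fst p = a} \<union> {p \<in> S. snd p = y})" using assms by auto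
  ultimately have "\<not> S \<subseteq> {p \<in> S. fst p = a} \<union> {p \<in> S. snd p = y}"
    using assms(2) card_mono[of "{p \<in> S. fst p = a} \<union> {p \<in> S. snd p = y}" S] by linarith
  then obtain p where "p \<in> S" "fst p \<noteq> a" "snd p \<noteq> y" by blast
  then show ?thesis using that[of "fst p" "snd p"] by simp
qed

lemma mult_eq1:
  assumes "T u v w" "\<And>x y. T w x y \<Longrightarrow> {x, y} = {u, v}"
  shows "mult w = 1"
proof -
  have "{t \<in> mis V 3. w \<in> t} = {{w, u, v}}"
  proof
    show "{t \<in> mis V 3. w \<in> t} \<subseteq> {{w, u, v}}"
    proof
      fix t assume "t \<in> {t \<in> mis V 3. w \<in> t}"
      then obtain x y where "t = {w, x, y}" "T w x y" using mis3E by blast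
      then show "t \<in> {{w, u, v}}" using assms(2)[of x y] by simp
    qed
    show "{{w, u, v}} \<subseteq> {t \<in> mis V 3. w \<in> t}" using T_perms(2)[OF assms(1)] by (simp add: T_def)
  qed
  then show ?thesis by (simp add: mult_def)
qed

text \<open>Suppose {w, x, y} is a second triple through \<open>w\<close>. Domination in both
  directions makes {u, v} and {x, y} cover each other, so either one of \<open>x\<close>,
  \<open>y\<close> is adjacent to both \<open>u\<close> and \<open>v\<close>, or the edges form a
  matching. Labelled pairs at \<open>u\<close> and \<open>v\<close> refute both cases.\<close>

lemma two_rich:
  assumes T: "T u v w" and u: "\<And>a. \<not> twin u a" "3 \<le> mult u" and v: "\<And>a. \<not> twin v a" "4 \<le> mult v"
  shows "mult w = 1"
proof (rule mult_eq1[OF T])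
  obtain Su where Su: "finite Su" "2 \<le> card Su" "inj_on fst Su" "inj_on snd Su"
    "\<And>a b. (a, b) \<in> Su \<Longrightarrow> lab u v w a b"
    by (rule labelled_pairs[OF u(1) T u(2)]) (use u in auto)
  obtain Sv where Sv: "finite Sv" "3 \<le> card Sv" "inj_on fst Sv" "inj_on snd Sv"
    "\<And>a b. (a, b) \<in> Sv \<Longrightarrow> lab v u w a b"
  proof (rule labelled_pairs[OF v(1) T_perm(1)[OF T]])
    show "3 \<le> mult v" using v by simp
  qed (use v in auto)
  fix x y assume xy: "T w x y"
  show "{x, y} = {u, v}"
  proof (rule ccontr)
    assume ne: "{x, y} \<noteq> {u, v}"
    have nu: "b = c" if "T u w b" "T u w c" for b c using u twinI that by blast
    have nv: "b = c" if "T v w b" "T v w c" for b c using v twinI that by blast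
    have "x \<noteq> u" "y \<noteq> u"
      using nu[OF T_perm(2)[OF T]] T_perm(1)[OF xy] T_perms(2)[OF xy] ne by auto
    moreover have "x \<noteq> v" "y \<noteq> v"
      using nv[OF T_perms(1)[OF T]] T_perm(1)[OF xy] T_perms(2)[OF xy] ne by auto
    ultimately have nuv: "x \<noteq> u" "y \<noteq> u" "x \<noteq> v" "y \<noteq> v" by auto
    \<comment> \<open>If \<open>y\<close> is adjacent to \<open>u\<close>, so are both
      \<open>x\<close> and \<open>y\<close>; a label \<open>d\<close> adjacent to \<open>u\<close>
      but not to \<open>w\<close> is then dominated by none of \<open>w\<close>, \<open>x\<close>,
      \<open>y\<close>. The case of \<open>v\<close> is symmetric.\<close>
    have one: False if xy: "T w x y" and "adj x u" "adj x v" for x y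
    proof -
      have y: "adj y u \<or> adj y v"
        using T_dom[OF T, of y] T_nadj[OF xy] T_in[OF xy] T_distinct[OF xy] T_nadj[OF T] that by blast
      then show False
      proof
        assume yu: "adj y u"
        obtain c d where cd: "(c, d) \<in> Sv" "d \<noteq> y" using pick_snd[OF Sv(1) _ Sv(4)] Sv(2) by auto
        then have l: "T v c d" "adj u d" "\<not> adj w d" using Sv(5) by (auto simp: lab_def)
        have "d \<noteq> x" "d \<noteq> w" using l T_nadj[OF l(1)] T_nadj[OF T] that sym by blast+
        then have "adj d w \<or> adj d x \<or> adj d y" using T_dom[OF xy, of d] cd(2) T_in[OF l(1)] by blast
        then show False using l(2,3) that(2) yu tri sym by blast
      next
        assume yv: "adj y v"
        obtain c d where cd: "(c, d) \<in> Su" "d \<noteq> y" using pick_snd[OF Su(1,2,4)] by auto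
        then have l: "T u c d" "adj v d" "\<not> adj w d" using Su(5) by (auto simp: lab_def)
        have "d \<noteq> x" "d \<noteq> w" using l T_nadj[OF l(1)] T_nadj[OF T] that sym by blast+
        then have "adj d w \<or> adj d x \<or> adj d y" using T_dom[OF xy, of d] cd(2) T_in[OF l(1)] by blast
        then show False using l(2,3) that(3) yv tri sym by blast
      qed
    qed
    \<comment> \<open>Domination by {u, a, b}, {w, x, y} and {v, c, d} makes \<open>x\<close>,
      \<open>a\<close>, \<open>d\<close> pairwise adjacent.\<close>
    have two: False if xy: "T w x y" and x: "adj x v" "\<not> adj x u" and y: "adj y u" and nuv: "x \<noteq> u" for x y
    proof -
      obtain a b where ab: "(a, b) \<in> Su" "b \<noteq> x" using pick_snd[OF Su(1,2,4)] by auto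
      then have l: "T u a b" "adj v b" "adj w a" "\<not> adj v a" using Su(5) by (auto simp: lab_def)
      have "x \<noteq> a" using l(3) T_nadj[OF xy] by blast
      then have xa: "adj x a" using T_dom[OF l(1), of x] T_in[OF xy] ab(2) nuv x l(2) tri sym by blast
      \<comment> \<open>Avoiding \<open>a\<close> and \<open>y\<close> at once takes three labelled
        pairs at \<open>v\<close>, hence the bound 4 on \<open>mult v\<close>.\<close>
      obtain c d where cd: "(c, d) \<in> Sv" "c \<noteq> a" "d \<noteq> y" using pick_fst_snd[OF Sv(1-4)] by blast
      then have k: "T v c d" "adj u d" "adj w c" "\<not> adj u c" "\<not> adj w d" using Sv(5) by (auto simp: lab_def)
      have "d \<noteq> w" "d \<noteq> x" using k(2) T_nadj[OF T] x(2) sym by blast+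
      then have dx: "adj d x" using T_dom[OF xy, of d] T_in[OF k(1)] cd(3) k(2,5) y tri sym by blast
      have "a \<noteq> v" "a \<noteq> d" using l(1,2) k(2) T_nadj[OF l(1)] by blast+
      then have "adj a d" using T_dom[OF k(1), of a] T_in[OF l(1)] cd(2) l(3,4) k(3) tri sym by blast
      then show False using xa dx tri sym by blast
    qed
    have "adj x u \<or> adj x v" "adj y u \<or> adj y v"
      using T_dom[OF T, of x] T_dom[OF T, of y] T_nadj[OF xy] T_in[OF xy] T_distinct[OF xy] nuv by blast+
    moreover have "adj u x \<or> adj u y" "adj v x \<or> adj v y"
      using T_dom[OF xy, of u] T_dom[OF xy, of v] T_nadj[OF T] T_in[OF T] T_distinct[OF T] nuv by blast+
    ultimately show False
      using one[OF xy] one[OF T_perm(2)[OF xy]] two[OF xy] two[OF T_perm(2)[OF xy]] nuv sym by blast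
  qed
qed

lemma mult_ge2: "T q p a \<Longrightarrow> T q p z \<Longrightarrow> a \<noteq> z \<Longrightarrow> 2 \<le> mult p"
proof -
  assume a: "T q p a" "T q p z" "a \<noteq> z"
  then have "{{q, p, a}, {q, p, z}} \<subseteq> {t \<in> mis V 3. p \<in> t}" by (auto simp: T_def)
  then have "card {{q, p, a}, {q, p, z}} \<le> mult p"
    unfolding mult_def by (rule card_mono[rotated]) (simp add: finite_mis finV)
  moreover have "{q, p, a} \<noteq> {q, p, z}" using a T_distinct by (metis insertE insertI1 insert_commute singletonD)
  ultimately show ?thesis by simp
qed

text \<open>Without twins at \<open>q\<close> this is \<open>two_rich\<close>. Otherwise the triples
  through \<open>q\<close> form the path of \<open>twin_mult3E\<close>. A rich vertex has no twin,
  so \<open>z\<close> is an end of the path, \<open>p\<close> its inner neighbour and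
  \<open>a\<close> the other inner vertex. If \<open>p\<close> also lay in three triples, then
  either \<open>z\<close> would be twin with \<open>p\<close>, or \<open>p\<close>,
  \<open>q\<close>, \<open>a\<close> would contradict \<open>no_twin_triangle\<close>.\<close>

lemma mult3_rich:
  assumes q: "mult q = 3" and z: "4 \<le> mult z" and T: "T q p z"
  shows "mult p = 1 \<or> (mult p = 2 \<and> (\<exists>a. a \<noteq> z \<and> T q p a \<and> mult a \<le> 3))"
proof (cases "\<exists>a. twin q a")
  case False
  have "\<And>a. \<not> twin z a" using z twin_mult_le3 by fastforce
  then have "mult p = 1"
    using False q z two_rich[OF T_perm(2)[OF T]] by auto
  then show ?thesis ..
next
  case True
  have nz: "\<not> twin z a" "\<not> twin a z" for a
    using z twin_mult_le3[of z] twin_sym[of a z] by fastforce+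
  obtain a0 where a0: "twin q a0" using True by blast
  obtain v v' y where *: "T q a0 v" "T q a0 v'" "v \<noteq> v'" "T q v y" "y \<noteq> a0"
    "\<forall>c d. T q c d \<longrightarrow> {c, d} = {a0, v} \<or> {c, d} = {a0, v'} \<or> {c, d} = {v, y}"
    by (rule twin_mult3E[OF a0 q])
  have t1: "twin q a0" using *(1-3) twinI by blast
  have t2: "twin q v" using T_perm(2)[OF *(1)] *(4,5) twinI by blast
  have nz': "z \<noteq> a0" "z \<noteq> v" using t1 t2 nz by auto
  have "\<exists>a. a \<noteq> z \<and> T q p a \<and> twin q a"
  proof (cases "p = a0")
    case True
    then show ?thesis using *(1) t2 nz' by (intro exI[of _ v]) auto
  next
    case False
    have "{p, z} = {a0, v} \<or> {p, z} = {a0, v'} \<or> {p, z} = {v, y}" using *(6) T by blast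
    then have "p = v" using False nz' by (metis doubleton_eq_iff)
    then show ?thesis using T_perm(2)[OF *(1)] t1 nz' by (intro exI[of _ a0]) auto
  qed
  then obtain a where a: "a \<noteq> z" "T q p a" "twin q a" by blast
  have m: "mult p \<le> 3" "mult a \<le> 3" "2 \<le> mult p"
    using twin_mult_le3 twin_sym twinI[OF a(2) T a(1)] a(3) mult_ge2[OF a(2) T a(1)] by auto
  have "mult p \<noteq> 3"
  proof
    assume p3: "mult p = 3"
    have pq: "twin p q" using twinI[OF a(2) T a(1)] twin_sym by blast
    obtain v v' y where *: "T p q v" "T p q v'" "v \<noteq> v'" "T p v y" "y \<noteq> q"
      by (rule twin_mult3E[OF pq p3])
    have "v = a \<or> v = z"
      using completions_le2[OF a(2) T T_perm(1)[OF *(1)]] a(1) by blast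
    then show False
    proof
      assume v: "v = z"
      then have "twin z p" using twinI[of z p q y] T_perms(2)[OF *(1)] T_perm(1)[OF *(4)] *(5) by auto
      then show False using nz by blast
    next
      assume v: "v = a"
      obtain w where "T q a w" "w \<noteq> p" using a(3) unfolding twin_def by metis
      then show False using no_twin_triangle[OF a(2) T _ _ _ *(4)[unfolded v]] a(1) *(5) by auto
    qed
  qed
  then show ?thesis using m a by (auto simp: numeral_2_eq_2 numeral_3_eq_3)
qed

text \<open>Discharging rule: every triple hands out at least 6 units and no vertex receives more than 6.\<close>

definition wt :: "'a set \<Rightarrow> 'a \<Rightarrow> nat" where
  "wt t p = (if 4 \<le> mult p then 0 else if mult p = 3 then 2 else if mult p = 2 then
     (if \<exists>z\<in>t. 4 \<le> mult z then if \<exists>q\<in>t. mult q = 3 then 4 else 3 else 2) else 6)"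

text \<open>Without a vertex in four triples each vertex counts at least 2. With one such vertex the
  other two must supply 6: if one of them is rich too, the third has multiplicity 1 and gets 6; if
  one has multiplicity 3, the third gives 6 or 4 by \<open>mult3_rich\<close>; two of multiplicity 2
  give 3 each.\<close>

lemma wt_lower:
  assumes "t \<in> mis V 3" shows "6 \<le> (\<Sum>p\<in>t. wt t p)"
proof -
  have sum: "(\<Sum>p\<in>t. wt t p) = wt t u + wt t v + wt t w" if "t = {u, v, w}" "T u v w" for u v w
    using T_distinct[OF that(2)] that(1) by simp
  have rich: "6 \<le> (\<Sum>p\<in>t. wt t p)" if t: "t = {u, v, w}" and T: "T u v w" and u: "4 \<le> mult u" for u v w
  proof -
    have nt: "\<not> twin z a" if "4 \<le> mult z" for z a using that twin_mult_le3[of z a] by linarith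
    have v: "mult w = 1" if "4 \<le> mult v"
      using two_rich[OF T nt[OF u] _ nt[OF that] that] u by simp
    have w: "mult v = 1" if "4 \<le> mult w"
      using two_rich[OF T_perm(2)[OF T] nt[OF u] _ nt[OF that] that] u by simp
    have v3: "mult w = 1 \<or> mult w = 2" if "mult v = 3"
      using mult3_rich[OF that u T_perms(1)[OF T]] by blast
    have w3: "mult v = 1 \<or> mult v = 2" if "mult w = 3"
      using mult3_rich[OF that u T_perms(3)[OF T]] by blast
    show ?thesis unfolding sum[OF t T]
      using v w v3 w3 u unfolding wt_def t by auto
  qed
  obtain u where "u \<in> t" using assms by (fastforce simp: mis_def)
  then obtain v w where t: "t = {u, v, w}" "T u v w" using mis3E assms by blast
  show ?thesis
  proof (cases "4 \<le> mult u \<or> 4 \<le> mult v \<or> 4 \<le> mult w")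
    case True
    then show ?thesis
      using rich[OF t] rich[OF _ T_perm(1)[OF t(2)]] rich[OF _ T_perms(2)[OF t(2)]] t(1)
      by (auto simp: insert_commute)
  next
    case False
    then show ?thesis unfolding sum[OF t] unfolding wt_def t by auto
  qed
qed

text \<open>Only multiplicity 2 is delicate, since shares 4 and 3 would exceed 6. A share of 4
  occurs next to a rich vertex and one of multiplicity 3; \<open>mult3_rich\<close> then says that
  the other triple through \<open>p\<close> has no rich vertex, so its share is 2.\<close>

lemma wt_upper: "(\<Sum>t\<in>{t \<in> mis V 3. p \<in> t}. wt t p) \<le> 6"
proof -
  have fin: "finite {t \<in> mis V 3. p \<in> t}" using finite_mis[OF finV] by auto
  consider "4 \<le> mult p" | "mult p = 3" | "mult p = 2" | "mult p \<le> 1" by linarith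
  then show ?thesis
  proof cases
    case 1
    then show ?thesis by (simp add: wt_def)
  next
    case 2
    then show ?thesis by (simp add: wt_def) (simp add: mult_def)
  next
    case 4
    then have "(\<Sum>t\<in>{t \<in> mis V 3. p \<in> t}. wt t p) = (\<Sum>t\<in>{t \<in> mis V 3. p \<in> t}. 6)"
      by (intro sum.cong) (auto simp: wt_def)
    also have "\<dots> \<le> 6" using 4 by (simp add: mult_def)
    finally show ?thesis .
  next
    case 3
    then obtain t1 t2 where t: "{t \<in> mis V 3. p \<in> t} = {t1, t2}" "t1 \<noteq> t2"
      unfolding mult_def by (auto simp: card_2_iff)
    have two: "wt t' p = 2"
      if h: "{t \<in> mis V 3. p \<in> t} = {t, t'}" "t \<noteq> t'" "z \<in> t" "4 \<le> mult z" "q \<in> t" "mult q = 3" for t t' z q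
    proof -
      have tt: "t \<in> mis V 3" "p \<in> t" using h(1) by blast+
      have "p \<noteq> q" "p \<noteq> z" "q \<noteq> z" using h(4,6) 3 by auto
      moreover have "card t = 3" "finite t" using tt by (auto simp: mis_def)
      ultimately have eq: "t = {q, p, z}"
        using h(3,5) tt by (intro card_seteq[symmetric]) auto
      then have "T q p z" using tt by (simp add: T_def)
      from mult3_rich[OF h(6,4) this] 3 obtain a where a: "a \<noteq> z" "T q p a" "mult a \<le> 3" by auto
      have "{q, p, a} \<in> {t, t'}" using a(2) unfolding h(1)[symmetric] by (simp add: T_def)
      moreover have "{q, p, a} \<noteq> t" using eq a T_distinct[OF a(2)] by auto
      ultimately have "t' = {q, p, a}" by auto
      then show ?thesis using a(3) 3 h(6) by (simp add: wt_def)
    qed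
    have wts: "wt t p = 2 \<or> wt t p = 3 \<or> (wt t p = 4 \<and> (\<exists>z\<in>t. 4 \<le> mult z) \<and> (\<exists>q\<in>t. mult q = 3))" for t
      using 3 by (simp add: wt_def)
    have "(\<Sum>t\<in>{t \<in> mis V 3. p \<in> t}. wt t p) = wt t1 p + wt t2 p" using t by simp
    also have "\<dots> \<le> 6"
    proof -
      have t': "{t \<in> mis V 3. p \<in> t} = {t2, t1}" using t(1) by (simp add: insert_commute)
      have "wt t2 p = 2" if "wt t1 p = 4" using two[OF t] wts[of t1] that by auto
      moreover have "wt t1 p = 2" if "wt t2 p = 4" using two[OF t' t(2)[symmetric]] wts[of t2] that by auto
      ultimately show ?thesis using wts[of t1] wts[of t2] by auto
    qed
    finally show ?thesis .
  qed
qed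

lemma card_triples_le: "card (mis V 3) \<le> card V"
proof -
  have "6 * card (mis V 3) \<le> (\<Sum>t\<in>mis V 3. \<Sum>p\<in>t. wt t p)"
    using sum_bounded_below[of "mis V 3" 6 "\<lambda>t. \<Sum>p\<in>t. wt t p"] wt_lower by (simp add: mult.commute)
  also have "\<dots> = (\<Sum>t\<in>mis V 3. \<Sum>p\<in>{p \<in> V. p \<in> t}. wt t p)"
    by (intro sum.cong refl) (auto simp: mis_def)
  also have "\<dots> = (\<Sum>p\<in>V. \<Sum>t\<in>{t \<in> mis V 3. p \<in> t}. wt t p)"
    by (rule sum.swap_restrict) (auto simp: finV finite_mis)
  also have "\<dots> \<le> 6 * card V"
    using sum_bounded_above[of V "\<lambda>p. \<Sum>t\<in>{t \<in> mis V 3. p \<in> t}. wt t p" 6] wt_upper by (simp add: mult.commute)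
  finally show ?thesis by simp
qed

end

theorem (in triangle_free) card_mis_3:
  assumes "finite V" shows "card (mis V 3) \<le> max 64 (card V)"
proof (cases "64 < card (mis V 3)")
  case True
  interpret many_triples adj V by unfold_locales (use assms True in auto)
  show ?thesis using card_triples_le by simp
qed simp

subsection \<open>Maximal independent sets and edge counts\<close>

context triangle_free begin

definition away :: "'a set \<Rightarrow> 'a \<Rightarrow> 'a set" where
  "away V v = V - insert v (nbrs V v)"

lemma away_subset: "away V v \<subseteq> V"
  by (auto simp: away_def)

lemma mis_link:
  assumes "P \<in> mis V (Suc k)" "v \<in> P" shows "P - {v} \<in> mis (away V v) k"
proof -
  have P: "P \<subseteq> V" "finite P" "card P = Suc k" "\<forall>x\<in>P. \<forall>y\<in>P. \<not> adj x y" "\<forall>x\<in>V - P. \<exists>y\<in>P. adj x y"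
    using assms by (auto simp: mis_def)
  have "\<exists>y\<in>P - {v}. adj x y" if "x \<in> away V v - (P - {v})" for x
  proof -
    have "x \<in> V - P" "\<not> adj v x" using that by (auto simp: away_def nbrs_def)
    then show ?thesis using P(5) sym by blast
  qed
  then show ?thesis using P assms(2) by (auto simp: mis_def away_def nbrs_def)
qed

lemma card_mis_containing:
  assumes "finite V" shows "card {P \<in> mis V (Suc k). v \<in> P} \<le> card (mis (away V v) k)"
proof (rule card_inj_on_le[where f = "\<lambda>P. P - {v}"])
  show "inj_on (\<lambda>P. P - {v}) {P \<in> mis V (Suc k). v \<in> P}" by (rule inj_onI) blast
  show "finite (mis (away V v) k)" using assms by (intro finite_mis) (simp add: away_def)
qed (use mis_link in blast)

lemma card_away:
  assumes "finite V" "v \<in> V" shows "card (away V v) + deg V v + 1 = card V"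
proof -
  have "card (insert v (nbrs V v)) = Suc (deg V v)"
    using assms irrefl by (simp add: nbrs_def deg_def)
  moreover have "insert v (nbrs V v) \<subseteq> V" using assms by (auto simp: nbrs_def)
  ultimately show ?thesis
    using assms card_mono[of V "insert v (nbrs V v)"]
    by (simp add: away_def card_Diff_subset finite_subset)
qed

lemma card_le_deg_sum:
  assumes V: "finite V" and P: "P \<in> mis V k" shows "card V \<le> k + (\<Sum>v\<in>P. deg V v)"
proof -
  have "V \<subseteq> P \<union> (\<Union>v\<in>P. nbrs V v)" using P by (auto simp: mis_def nbrs_def) (metis DiffI sym)
  moreover have "finite P" "card P = k" using P by (auto simp: mis_def)
  moreover have "finite (\<Union>v\<in>P. nbrs V v)" using V \<open>finite P\<close> by (auto simp: nbrs_def)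
  ultimately have "card V \<le> card (P \<union> (\<Union>v\<in>P. nbrs V v))" by (intro card_mono) auto
  also have "\<dots> \<le> card P + card (\<Union>v\<in>P. nbrs V v)" by (rule card_Un_le)
  also have "\<dots> \<le> k + (\<Sum>v\<in>P. deg V v)"
    using card_UN_le[OF \<open>finite P\<close>, of "nbrs V"] \<open>card P = k\<close> by (simp add: deg_def)
  finally show ?thesis .
qed

lemma sum_mis_swap:
  fixes f :: "'a \<Rightarrow> 'b::comm_semiring_1"
  assumes "finite V"
  shows "(\<Sum>P\<in>mis V k. \<Sum>v\<in>P. f v) = (\<Sum>v\<in>V. f v * of_nat (card {P \<in> mis V k. v \<in> P}))"
proof -
  have "(\<Sum>P\<in>mis V k. \<Sum>v\<in>P. f v) = (\<Sum>P\<in>mis V k. \<Sum>v\<in>{v \<in> V. v \<in> P}. f v)"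
    by (intro sum.cong refl) (auto simp: mis_def)
  also have "\<dots> = (\<Sum>v\<in>V. \<Sum>P\<in>{P \<in> mis V k. v \<in> P}. f v)"
    by (rule sum.swap_restrict) (auto simp: assms finite_mis)
  finally show ?thesis by (simp add: mult.commute)
qed

lemma deg_mono: "finite V \<Longrightarrow> V' \<subseteq> V \<Longrightarrow> deg V' v \<le> deg V v"
  unfolding deg_def nbrs_def by (intro card_mono) auto

lemma degsum_mono: "finite V \<Longrightarrow> V' \<subseteq> V \<Longrightarrow> degsum V' \<le> degsum V"
  unfolding degsum_def
  by (rule order_trans[OF sum_mono[OF deg_mono] sum_mono2]) auto

lemma card_mis_1:
  assumes "finite V" shows "card (mis V 1) \<le> 2"
proof (rule ccontr)
  assume "\<not> ?thesis"
  then have "3 \<le> card (mis V 1)" by simp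
  then obtain S where S: "S \<subseteq> mis V 1" "card S = 3" using obtain_subset_with_card_n by metis
  then obtain A B C where ABC: "S = {A, B, C}" "A \<noteq> B" "A \<noteq> C" "B \<noteq> C" by (auto simp: card_3_iff)
  have ex: "\<exists>a. A = {a}" if "A \<in> mis V 1" for A using that by (auto simp: mis_def card_1_singleton_iff)
  obtain a b c where abc: "A = {a}" "B = {b}" "C = {c}" using ex S ABC by (metis insert_subset)
  have "adj x y" if "{x} \<in> mis V 1" "{y} \<in> mis V 1" "x \<noteq> y" for x y using that by (auto simp: mis_def)
  then have "adj a b" "adj a c" "adj b c" using S ABC abc by auto
  then show False using tri by blast
qed

section \<open>Triples against the degree sum\<close>

text \<open>Two passages to a non-neighbourhood leave singletons, and three maximal independent
  singletons would form a triangle.\<close>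

lemma codegree_le2:
  assumes V: "finite V" and ne: "u \<noteq> y" shows "card {t \<in> mis V 3. u \<in> t \<and> y \<in> t} \<le> 2"
proof -
  have "card {t \<in> mis V 3. u \<in> t \<and> y \<in> t} \<le> card {P \<in> mis (away V u) 2. y \<in> P}"
  proof (rule card_inj_on_le[where f = "\<lambda>P. P - {u}"])
    show "inj_on (\<lambda>P. P - {u}) {t \<in> mis V 3. u \<in> t \<and> y \<in> t}" by (rule inj_onI) blast
    show "finite {P \<in> mis (away V u) 2. y \<in> P}" using finite_mis[of "away V u" 2] V by (simp add: away_def)
    show "(\<lambda>P. P - {u}) ` {t \<in> mis V 3. u \<in> t \<and> y \<in> t} \<subseteq> {P \<in> mis (away V u) 2. y \<in> P}"
      using mis_link[of _ V 2 u] ne by (auto simp: eval_nat_numeral)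
  qed
  also have "\<dots> \<le> card (mis (away (away V u) y) 1)"
    using card_mis_containing[of "away V u" 1 y] V by (auto simp: away_def eval_nat_numeral)
  also have "\<dots> \<le> 2" using V by (intro card_mis_1) (auto simp: away_def)
  finally show ?thesis .
qed

text \<open>A triple through \<open>u\<close> contains \<open>w\<close> or, dominating
  \<open>w\<close>, a neighbour of \<open>w\<close>; each of these vertices shares at most two
  triples with \<open>u\<close>. That \<open>u\<close> and \<open>w\<close> lie in a common triple
  ensures that \<open>u\<close> is not itself such a neighbour.\<close>

lemma mult_le_deg:
  assumes V: "finite V" and t: "t \<in> mis V 3" "u \<in> t" "w \<in> t" "u \<noteq> w"
  shows "card {t \<in> mis V 3. u \<in> t} \<le> 2 * deg V w + 2"
proof -
  let ?C = "\<lambda>y. {t \<in> mis V 3. u \<in> t \<and> y \<in> t}"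
  have uw: "\<not> adj w u" using t by (auto simp: mis_def)
  have w: "w \<in> V" using t by (auto simp: mis_def)
  have fin: "finite (nbrs V w)" using V by (simp add: nbrs_def)
  have sub: "{t \<in> mis V 3. u \<in> t} \<subseteq> ?C w \<union> (\<Union>y\<in>nbrs V w. ?C y)"
  proof
    fix t assume t: "t \<in> {t \<in> mis V 3. u \<in> t}"
    show "t \<in> ?C w \<union> (\<Union>y\<in>nbrs V w. ?C y)"
    proof (cases "w \<in> t")
      case False
      then obtain y where "y \<in> t" "adj w y" "y \<in> V" using t w unfolding mis_def by blast
      then show ?thesis using t by (auto simp: nbrs_def)
    qed (use t in auto)
  qed
  have "card {t \<in> mis V 3. u \<in> t} \<le> card (?C w \<union> (\<Union>y\<in>nbrs V w. ?C y))"
    by (rule card_mono[OF _ sub]) (use fin finite_mis[OF V] in auto)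
  also have "\<dots> \<le> card (?C w) + card (\<Union>y\<in>nbrs V w. ?C y)" by (rule card_Un_le)
  also have "card (\<Union>y\<in>nbrs V w. ?C y) \<le> (\<Sum>y\<in>nbrs V w. card (?C y))" by (rule card_UN_le[OF fin])
  also have "\<dots> \<le> (\<Sum>y\<in>nbrs V w. 2)"
    using uw by (intro sum_mono codegree_le2[OF V]) (auto simp: nbrs_def)
  also have "card (?C w) \<le> 2" by (rule codegree_le2[OF V t(4)])
  finally show ?thesis by (simp add: deg_def)
qed

lemma triples_heavy:
  assumes V: "finite V" and t: "t \<in> mis V 3"
  shows "\<exists>u\<in>t. card V \<le> 3 * deg V u + 3"
proof (rule ccontr)
  assume "\<not> ?thesis"
  then have "(\<Sum>u\<in>t. 3 * deg V u + 4) \<le> (\<Sum>u\<in>t. card V)" by (intro sum_mono) force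
  moreover have "card t = 3" using t by (simp add: mis_def)
  ultimately have "3 * (\<Sum>u\<in>t. deg V u) + 12 \<le> 3 * card V"
    by (simp add: sum.distrib sum_distrib_left)
  then show False using card_le_deg_sum[OF V t] by simp
qed

text \<open>Arithmetic for \<open>card_mis_3_degsum\<close>, with \<open>h\<close> heavy vertices,
  \<open>w\<close> companions and degree sum \<open>E\<close>. If \<open>h\<close> exceeds s/8, then
  h * s \<le> 4 * E alone gives s^2 \<le> 32 * E, and 1024 is 32^2. Otherwise \<open>w\<close>
  carries the covering bound, so s^2 \<le> 32 * h * E; one more factor \<open>s\<close> removes
  \<open>h\<close>.\<close>

lemma arith_cubic:
  fixes s h w E :: nat
  assumes s: "128 < s" and hs: "h * s \<le> 3 * E + 3 * h" and cov: "s \<le> 2 * h + 2 * w"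
    and w: "w * s \<le> 4 * h * (E + w)"
  shows "s ^ 3 \<le> 1024 * E\<^sup>2"
proof -
  have "h * 129 \<le> h * s" using s by (intro mult_le_mono2) simp
  then have hs: "h * s \<le> 4 * E" using hs by linarith
  have quart: ?thesis if "s * s \<le> 32 * E"
  proof -
    have "s ^ 3 \<le> (s * s) * (s * s)" using s by (simp add: power3_eq_cube)
    also have "\<dots> \<le> (32 * E) * (32 * E)" using that by (rule mult_le_mono) (rule that)
    finally show ?thesis by (simp add: power2_eq_square)
  qed
  show ?thesis
  proof (cases "s < 8 * h")
    case True
    then have "s * s \<le> 8 * (h * s)" by simp
    then show ?thesis using hs quart by linarith
  next
    case False
    then have "8 * h * w \<le> s * w" by (intro mult_le_mono1) simp
    then have "8 * (h * w) \<le> w * s" by (simp add: mult.commute mult.left_commute)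
    moreover have "w * s \<le> 4 * (h * E) + 4 * (h * w)" using w by (simp add: algebra_simps)
    ultimately have "w * s \<le> 8 * (h * E)" by linarith
    moreover have "s * s \<le> 4 * w * s" using False cov by (intro mult_le_mono1) simp
    ultimately have "s * s \<le> 32 * (h * E)" by linarith
    then have "s * s * s \<le> 32 * (h * E) * s" by (intro mult_le_mono1)
    also have "\<dots> = 32 * E * (h * s)" by simp
    also have "\<dots> \<le> 32 * E * (4 * E)" using hs by (intro mult_le_mono2)
    finally show ?thesis by (simp add: power3_eq_cube power2_eq_square)
  qed
qed

text \<open>Every triple has a vertex of degree about n/3, and the number \<open>h\<close> of such
  vertices satisfies h * n << E. At least half of the triples have a heavy vertex \<open>g t\<close>
  that lies in at least s/(2h) triples. The companions of \<open>g t\<close> then have degree of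
  order s/h by \<open>mult_le_deg\<close>, and there are many of them because the linear bound for
  triples applies to the subgraph they induce with the heavy vertices.\<close>

theorem card_mis_3_degsum:
  assumes V: "finite V"
  shows "card (mis V 3) ^ 3 \<le> 1024 * (degsum V)\<^sup>2 + 128 ^ 3"
proof (cases "card (mis V 3) \<le> 128")
  case True
  then have "card (mis V 3) ^ 3 \<le> 128 ^ 3" by (rule power_mono) simp
  then show ?thesis by linarith
next
  case False
  define s where "s = card (mis V 3)"
  define m where "m u = card {t \<in> mis V 3. u \<in> t}" for u
  define D where "D = {u \<in> V. card V \<le> 3 * deg V u + 3}"
  define h where "h = card D"
  have s: "128 < s" using False by (simp add: s_def)
  have finF: "finite (mis V 3)" by (rule finite_mis[OF V])
  have finD: "finite D" "D \<subseteq> V" using V by (auto simp: D_def)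
  have "\<forall>t\<in>mis V 3. \<exists>u. u \<in> t \<and> u \<in> D"
    using triples_heavy[OF V] unfolding D_def mis_def by blast
  from bchoice[OF this] obtain g where g: "\<And>t. t \<in> mis V 3 \<Longrightarrow> g t \<in> t \<and> g t \<in> D" by blast
  define F1 where "F1 = {t \<in> mis V 3. s \<le> 2 * h * m (g t)}"
  define F2 where "F2 = {t \<in> mis V 3. \<not> s \<le> 2 * h * m (g t)}"
  have s12: "s = card F1 + card F2"
    unfolding s_def F1_def F2_def using finF
    by (subst card_Un_disjoint[symmetric]) (auto intro!: arg_cong[of _ _ card])
  have "2 * card F2 \<le> s"
  proof -
    let ?D = "{u \<in> D. \<not> s \<le> 2 * h * m u}"
    have "F2 \<subseteq> (\<Union>u\<in>?D. {t \<in> mis V 3. u \<in> t})" using g unfolding F2_def by blast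
    then have "card F2 \<le> card (\<Union>u\<in>?D. {t \<in> mis V 3. u \<in> t})"
      using finD finF by (intro card_mono) auto
    also have "\<dots> \<le> (\<Sum>u\<in>?D. m u)" unfolding m_def using finD by (intro card_UN_le) auto
    finally have "2 * h * card F2 \<le> (\<Sum>u\<in>?D. 2 * h * m u)"
      by (simp add: sum_distrib_left[symmetric])
    also have "\<dots> \<le> (\<Sum>u\<in>?D. s)" by (intro sum_mono) auto
    also have "\<dots> \<le> h * s" unfolding h_def using finD by (simp add: card_mono)
    finally have "h * (2 * card F2) \<le> h * s" by (simp add: mult.assoc mult.left_commute)
    moreover have "h > 0"
    proof -
      obtain t where "t \<in> mis V 3" using s unfolding s_def by fastforce
      then show ?thesis using g finD unfolding h_def by (auto simp: card_gt_0_iff)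
    qed
    ultimately show ?thesis by simp
  qed
  then have F1: "s \<le> 2 * card F1" using s12 by simp
  define W where "W = (\<Union>t\<in>F1. t - {g t})"
  have W: "W \<subseteq> V" "finite W" unfolding W_def F1_def using V finite_subset[OF _ V] by (auto simp: mis_def)
  \<comment> \<open>Restricting to D \<union> W keeps the sets of \<open>F1\<close> maximal, so the
    linear bound sees only vertices whose degrees are under control.\<close>
  have "F1 \<subseteq> mis (D \<union> W) 3"
  proof
    fix t assume t: "t \<in> F1"
    then have "t \<subseteq> D \<union> W" using g unfolding W_def F1_def by blast
    then show "t \<in> mis (D \<union> W) 3" using mis_subset[of "D \<union> W" V t 3] t W finD by (auto simp: F1_def)
  qed
  then have "card F1 \<le> card (mis (D \<union> W) 3)" using finD W by (intro card_mono finite_mis) auto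
  also have "\<dots> \<le> max 64 (card (D \<union> W))" using finD W by (intro card_mis_3) auto
  finally have "card F1 \<le> h + card W" using F1 s card_Un_le[of D W] by (simp add: h_def)
  then have cov: "s \<le> 2 * h + 2 * card W" using F1 by simp
  have "s \<le> 4 * h * (deg V w + 1)" if "w \<in> W" for w
  proof -
    obtain t where t: "t \<in> F1" "w \<in> t" "w \<noteq> g t" using \<open>w \<in> W\<close> by (auto simp: W_def)
    then have "m (g t) \<le> 2 * deg V w + 2"
      unfolding m_def using g by (intro mult_le_deg[OF V, of t]) (auto simp: F1_def)
    then have "2 * h * m (g t) \<le> 2 * h * (2 * deg V w + 2)" by (rule mult_le_mono2)
    moreover have "s \<le> 2 * h * m (g t)" using t by (simp add: F1_def)
    ultimately show ?thesis by (simp add: algebra_simps)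
  qed
  then have "card W * s \<le> (\<Sum>w\<in>W. 4 * h * (deg V w + 1))"
    using sum_bounded_below[of W s "\<lambda>w. 4 * h * (deg V w + 1)"] by simp
  also have "\<dots> = 4 * h * ((\<Sum>w\<in>W. deg V w) + card W)"
    by (simp add: sum_distrib_left[symmetric] sum.distrib distrib_left)
  also have "\<dots> \<le> 4 * h * (degsum V + card W)"
    using W V unfolding degsum_def by (intro mult_le_mono2 add_le_mono1 sum_mono2) auto
  finally have wE: "card W * s \<le> 4 * h * (degsum V + card W)" .
  have "h * card V \<le> (\<Sum>u\<in>D. 3 * deg V u + 3)"
    using sum_bounded_below[of D "card V" "\<lambda>u. 3 * deg V u + 3"] by (simp add: D_def h_def)
  also have "\<dots> = 3 * (\<Sum>u\<in>D. deg V u) + 3 * h"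
    by (simp add: sum.distrib sum_distrib_left[symmetric] h_def)
  also have "\<dots> \<le> 3 * degsum V + 3 * h"
    using finD V unfolding degsum_def by (intro add_le_mono1 mult_le_mono2 sum_mono2) auto
  finally have "h * card V \<le> 3 * degsum V + 3 * h" .
  moreover have "s \<le> card V" using card_mis_3[OF V] s by (simp add: s_def)
  ultimately have "h * s \<le> 3 * degsum V + 3 * h" by (meson mult_le_mono2 order_trans)
  from arith_cubic[OF s this cov wE] show ?thesis by (simp add: s_def)
qed

section \<open>Independent sets of size four and more\<close>

text \<open>At most N - d sets contain a vertex of degree d, by the linear bound in its
  non-neighbourhood; the 64 in N absorbs the maximum there. With weight d / (N - d) the total is
  therefore at most the degree sum. Degrees in a 4-set sum to at least N - 68, so by convexity its
  weight is close to 4 * (1/4) / (3/4) = 4/3; the error 16/9 * 68 is rounded up to 121.\<close>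

theorem card_mis_4:
  assumes V: "finite V"
  shows "4 / 3 * real (card (mis V 4)) \<le> real (degsum V) + 121 * real (card (mis V 4)) / (real (card V) + 64)"
proof -
  define N where "N = real (card V) + 64"
  define c where "c v = card {P \<in> mis V 4. v \<in> P}" for v
  define g where "g v = real (deg V v) / (N - real (deg V v))" for v
  have N: "N > 0" by (simp add: N_def)
  have degV: "real (deg V v) + 64 \<le> N" for v
    using V by (simp add: deg_def nbrs_def N_def card_mono)
  have cv: "real (c v) \<le> N - real (deg V v)" if "v \<in> V" for v
  proof -
    have "c v \<le> card (mis (away V v) 3)"
      unfolding c_def using card_mis_containing[OF V, of 3 v] by (simp add: eval_nat_numeral)
    also have "\<dots> \<le> max 64 (card (away V v))" using V by (intro card_mis_3) (simp add: away_def)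
    finally show ?thesis using card_away[OF V that] degV[of v] unfolding N_def by linarith
  qed
  \<comment> \<open>tangent line of \<open>x / (1 - x)\<close> at \<open>x = 1 / 4\<close>, the average relative degree in a maximal independent 4-set\<close>
  have tangent: "g v \<ge> 16 / 9 * (real (deg V v) / N) - 1 / 9" for v
  proof -
    define x where "x = real (deg V v) / N"
    have x: "x < 1" unfolding x_def using N degV[of v] by (simp add: divide_simps)
    have "g v = x / (1 - x)" unfolding g_def x_def using N degV[of v] by (simp add: field_simps)
    moreover have "x / (1 - x) - (16 / 9 * x - 1 / 9) = (4 * x - 1)\<^sup>2 / (9 * (1 - x))"
      using x by (simp add: field_simps power2_eq_square)
    moreover have "(4 * x - 1)\<^sup>2 / (9 * (1 - x)) \<ge> 0" using x by simp
    ultimately show ?thesis unfolding x_def[symmetric] by linarith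
  qed
  have low: "4 / 3 - 121 / N \<le> (\<Sum>v\<in>P. g v)" if P: "P \<in> mis V 4" for P
  proof -
    have "card P = 4" using P by (simp add: mis_def)
    have "real (card V) \<le> 4 + (\<Sum>v\<in>P. real (deg V v))"
      using card_le_deg_sum[OF V P] by (metis of_nat_add of_nat_le_iff of_nat_numeral of_nat_sum)
    then have "N - 68 \<le> (\<Sum>v\<in>P. real (deg V v))" by (simp add: N_def)
    then have "(N - 68) / N \<le> (\<Sum>v\<in>P. real (deg V v)) / N" using N by (simp add: divide_right_mono)
    moreover have "(N - 68) / N = 1 - 68 / N" using N by (simp add: field_simps)
    ultimately have "16 / 9 * (1 - 68 / N) - 4 / 9 \<le> 16 / 9 * ((\<Sum>v\<in>P. real (deg V v)) / N) - 4 / 9"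
      by (intro diff_mono mult_left_mono) auto
    also have "\<dots> = (\<Sum>v\<in>P. 16 / 9 * (real (deg V v) / N) - 1 / 9)"
      using \<open>card P = 4\<close> by (simp add: sum_subtractf sum_distrib_left sum_divide_distrib)
    also have "\<dots> \<le> (\<Sum>v\<in>P. g v)" by (intro sum_mono tangent)
    finally show ?thesis using N by (simp add: field_simps)
  qed
  have "real (card (mis V 4)) * (4 / 3 - 121 / N) \<le> (\<Sum>P\<in>mis V 4. \<Sum>v\<in>P. g v)"
    using sum_bounded_below[of "mis V 4" "4 / 3 - 121 / N"] low by auto
  also have "\<dots> = (\<Sum>v\<in>V. g v * real (c v))" unfolding c_def by (rule sum_mis_swap[OF V])
  also have "\<dots> \<le> (\<Sum>v\<in>V. real (deg V v))"
  proof (rule sum_mono)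
    fix v assume "v \<in> V"
    have "g v * real (c v) \<le> g v * (N - real (deg V v))"
      using degV[of v] by (intro mult_left_mono cv \<open>v \<in> V\<close>) (simp add: g_def)
    also have "\<dots> = real (deg V v)" using degV[of v] by (simp add: g_def)
    finally show "g v * real (c v) \<le> real (deg V v)" .
  qed
  finally show ?thesis by (simp add: degsum_def N_def algebra_simps)
qed

lemma mis_degsum_branch:
  assumes V: "finite V" and M: "\<And>v. v \<in> V \<Longrightarrow> card (mis (away V v) k) \<le> M"
  shows "card (mis V (Suc k)) * (card V - Suc k) \<le> degsum V * M"
proof -
  have "card (mis V (Suc k)) * (card V - Suc k) \<le> (\<Sum>P\<in>mis V (Suc k). \<Sum>v\<in>P. deg V v)"
    using sum_bounded_below[of "mis V (Suc k)" "card V - Suc k" "\<lambda>P. \<Sum>v\<in>P. deg V v"]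
      card_le_deg_sum[OF V] by fastforce
  also have "\<dots> = (\<Sum>v\<in>V. deg V v * card {P \<in> mis V (Suc k). v \<in> P})"
    using sum_mis_swap[OF V, of "deg V" "Suc k"] by simp
  also have "\<dots> \<le> (\<Sum>v\<in>V. deg V v * M)"
    by (intro sum_mono mult_le_mono2 order_trans[OF card_mis_containing[OF V] M])
  finally show ?thesis by (simp add: degsum_def sum_distrib_right)
qed

lemma mis_card_branch:
  assumes V: "finite V" and M: "\<And>v. v \<in> V \<Longrightarrow> card (mis (away V v) k) \<le> M"
  shows "card (mis V (Suc k)) \<le> card V * M"
proof -
  have "mis V (Suc k) \<subseteq> (\<Union>v\<in>V. {P \<in> mis V (Suc k). v \<in> P})"
  proof
    fix P assume P: "P \<in> mis V (Suc k)"
    then have "P \<noteq> {}" by (auto simp: mis_def)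
    then show "P \<in> (\<Union>v\<in>V. {P \<in> mis V (Suc k). v \<in> P})" using P by (auto simp: mis_def)
  qed
  then have "card (mis V (Suc k)) \<le> card (\<Union>v\<in>V. {P \<in> mis V (Suc k). v \<in> P})"
    using V finite_mis[OF V] by (intro card_mono) auto
  also have "\<dots> \<le> (\<Sum>v\<in>V. card {P \<in> mis V (Suc k). v \<in> P})" by (rule card_UN_le[OF V])
  also have "\<dots> \<le> (\<Sum>v\<in>V. M)"
    by (intro sum_mono order_trans[OF card_mis_containing[OF V] M])
  finally show ?thesis by simp
qed

lemma card_mis_le_pow: "finite V \<Longrightarrow> card (mis V k) \<le> 2 ^ card V"
  by (metis (no_types, lifting) Pow_iff card_Pow card_mono finite_Pow_iff mis_def mem_Collect_eq subsetI)

end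

text \<open>Let M be the largest number of k-sets in the non-neighbourhood of a vertex and E the
  degree sum. Counting weighted by degree gives s * n << E * M, plain counting gives s \<le> n * M;
  the product cancels n and leaves s^2 << E * M^2. Each step thus adds one to the exponent of E in
  the bound for s^2. The case k = 4 uses the linear bound for triples, and graphs with few vertices
  go into the constant.\<close>

theorem card_mis_general:
  assumes "4 \<le> k"
  shows "\<exists>C. \<forall>(adj :: 'a \<Rightarrow> 'a \<Rightarrow> bool) V. triangle_free adj \<longrightarrow> finite V \<longrightarrow>
    (card (triangle_free.mis adj V k))\<^sup>2 \<le> C * (triangle_free.degsum adj V + 1) ^ (k - 2)"
  using assms
proof (induction k rule: nat_induct_at_least)
  case base
  have "(card (triangle_free.mis adj V 4))\<^sup>2 \<le> (4 + (2 ^ 128)) * (triangle_free.degsum adj V + 1) ^ 2"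
    if "triangle_free adj" "finite V" for adj :: "'a \<Rightarrow> 'a \<Rightarrow> bool" and V
  proof -
    interpret triangle_free adj by fact
    show ?thesis
    proof (cases "card V < 64")
      case True
      have "card (mis V 4) \<le> 2 ^ card V" using that(2) by (rule card_mis_le_pow)
      also have "\<dots> \<le> 2 ^ 64" using True by (intro power_increasing) auto
      finally have "(card (mis V 4))\<^sup>2 \<le> (2 ^ 64)\<^sup>2" by (rule power_mono) simp
      also have "\<dots> = 2 ^ 128 * 1" by simp
      also have "\<dots> \<le> (4 + 2 ^ 128) * (degsum V + 1) ^ 2" by (intro mult_le_mono) auto
      finally show ?thesis .
    next
      case False
      have "card (mis (away V v) 3) \<le> card V" for v
        using card_mis_3[of "away V v"] card_mono[OF that(2) away_subset[of V v]] that(2) False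
          finite_subset[OF away_subset that(2)] by fastforce
      then have "card (mis V 4) * (card V - 4) \<le> degsum V * card V"
        using mis_degsum_branch[OF that(2), of 3 "card V"] by (simp add: eval_nat_numeral)
      moreover have "card V \<le> 2 * (card V - 4)" using False by simp
      ultimately have "card (mis V 4) * card V \<le> 2 * degsum V * card V"
        by (smt (verit) mult.assoc mult.left_commute mult_le_mono2 order_trans)
      then have "card (mis V 4) \<le> 2 * degsum V" using False by auto
      then have "(card (mis V 4))\<^sup>2 \<le> (2 * degsum V)\<^sup>2" by (rule power_mono) simp
      also have "\<dots> \<le> 4 * (degsum V + 1)\<^sup>2" by (simp add: power2_eq_square)
      also have "\<dots> \<le> (4 + 2 ^ 128) * (degsum V + 1)\<^sup>2" by (intro mult_le_mono1) simp
      finally show ?thesis .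
    qed
  qed
  then show ?case by (metis (no_types, lifting) add_diff_cancel_left' numeral_Bit0)
next
  case (Suc k)
  then obtain C where C: "\<And>(adj :: 'a \<Rightarrow> 'a \<Rightarrow> bool) V. triangle_free adj \<Longrightarrow> finite V \<Longrightarrow>
    (card (triangle_free.mis adj V k))\<^sup>2 \<le> C * (triangle_free.degsum adj V + 1) ^ (k - 2)" by blast
  have "(card (triangle_free.mis adj V (Suc k)))\<^sup>2 \<le>
      (2 * C + 2 ^ (4 * Suc k)) * (triangle_free.degsum adj V + 1) ^ (Suc k - 2)"
    if "triangle_free adj" "finite V" for adj :: "'a \<Rightarrow> 'a \<Rightarrow> bool" and V
  proof -
    interpret triangle_free adj by fact
    show ?thesis
    proof (cases "card V < 2 * Suc k")
      case True
      have "card (mis V (Suc k)) \<le> 2 ^ card V" using that(2) by (rule card_mis_le_pow)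
      also have "\<dots> \<le> 2 ^ (2 * Suc k)" using True by (intro power_increasing) auto
      finally have "(card (mis V (Suc k)))\<^sup>2 \<le> (2 ^ (2 * Suc k))\<^sup>2" by (rule power_mono) simp
      also have "\<dots> = 2 ^ (4 * Suc k) * 1" by (simp add: power_mult[symmetric] del: power_Suc)
      also have "\<dots> \<le> (2 * C + 2 ^ (4 * Suc k)) * (degsum V + 1) ^ (Suc k - 2)"
        by (intro mult_le_mono) auto
      finally show ?thesis .
    next
      case False
      define M where "M = Max ((\<lambda>v. card (mis (away V v) k)) ` V)"
      have ne: "V \<noteq> {}" using False by auto
      have M: "card (mis (away V v) k) \<le> M" if "v \<in> V" for v
        unfolding M_def using that \<open>finite V\<close> by (intro Max_ge) auto
      have "M \<in> (\<lambda>v. card (mis (away V v) k)) ` V" unfolding M_def using that(2) ne by (intro Max_in) auto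
      then obtain v where v: "v \<in> V" "M = card (mis (away V v) k)" by auto
      have "M\<^sup>2 \<le> C * (degsum (away V v) + 1) ^ (k - 2)"
        unfolding v(2) using C[OF that(1) finite_subset[OF away_subset that(2)]] .
      also have "\<dots> \<le> C * (degsum V + 1) ^ (k - 2)"
        by (intro mult_le_mono2 power_mono add_le_mono1 degsum_mono[OF that(2) away_subset]) simp
      finally have M2: "M\<^sup>2 \<le> C * (degsum V + 1) ^ (k - 2)" .
      let ?s = "card (mis V (Suc k))"
      have "?s * card V \<le> ?s * (2 * (card V - Suc k))" using False by (intro mult_le_mono2) simp
      also have "\<dots> \<le> 2 * (degsum V * M)" using mis_degsum_branch[OF that(2) M] by simp
      finally have "?s * card V \<le> 2 * (degsum V * M)" .
      from mult_le_mono[OF this mis_card_branch[OF that(2) M]]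
      have "?s * card V * ?s \<le> 2 * (degsum V * M) * (card V * M)" by simp
      then have "card V * ?s\<^sup>2 \<le> card V * (2 * degsum V * M\<^sup>2)"
        unfolding power2_eq_square by (simp only: ac_simps)
      then have "?s\<^sup>2 \<le> 2 * degsum V * M\<^sup>2" using False by auto
      also have "\<dots> \<le> 2 * degsum V * (C * (degsum V + 1) ^ (k - 2))" using M2 by (rule mult_le_mono2)
      also have "\<dots> \<le> 2 * C * (degsum V + 1) ^ Suc (k - 2)" by (simp add: algebra_simps)
      also have "Suc (k - 2) = Suc k - 2" using Suc by simp
      also have "2 * C * (degsum V + 1) ^ (Suc k - 2) \<le> (2 * C + 2 ^ (4 * Suc k)) * (degsum V + 1) ^ (Suc k - 2)"
        by (intro mult_le_mono1) simp
      finally show ?thesis .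
    qed
  qed
  then show ?case by blast
qed

subsection \<open>Systems\<close>

lemma pigeonhole_fiber:
  assumes X: "finite X" "X \<noteq> {}" and m: "card (f ` X) \<le> m"
  shows "\<exists>a\<in>f ` X. card X \<le> m * card {x \<in> X. f x = a}"
proof (rule ccontr)
  assume "\<not> ?thesis"
  then have lt: "m * card {x \<in> X. f x = a} < card X" if "a \<in> f ` X" for a using that by (metis not_le)
  have "m * card X = (\<Sum>a\<in>f ` X. m * card {x \<in> X. f x = a})"
    using sum.image_gen[OF X(1), of "\<lambda>_. 1::nat" f] by (simp add: sum_distrib_left[symmetric])
  also have "\<dots> < (\<Sum>a\<in>f ` X. card X)"
    by (rule sum_strict_mono) (use X lt in auto)
  also have "\<dots> \<le> m * card X" using m by simp
  finally show False by simp
qed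

text \<open>If a disjoint family cannot be extended, its union meets every set of
  \<open>P\<close>.\<close>

lemma disjoint_or_cover:
  assumes P: "\<And>p. p \<in> P \<Longrightarrow> finite p \<and> card p = k" and k: "0 < k"
  shows "(\<exists>D\<subseteq>P. finite D \<and> card D = M \<and> pairwise disjnt D) \<or>
    (\<exists>U. finite U \<and> card U \<le> M * k \<and> (\<forall>p\<in>P. p \<inter> U \<noteq> {}))"
proof (induction M)
  case 0
  then show ?case by (intro disjI1 exI[of _ "{}"]) auto
next
  case (Suc M)
  then show ?case
  proof
    assume "\<exists>D\<subseteq>P. finite D \<and> card D = M \<and> pairwise disjnt D"
    then obtain D where D: "D \<subseteq> P" "finite D" "card D = M" "pairwise disjnt D" by blast
    let ?U = "\<Union>D"
    have "finite ?U" using D P by auto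
    have "card ?U \<le> (\<Sum>p\<in>D. card p)" by (rule card_Union_le_sum_card)
    also have "\<dots> = M * k" using D P by (simp add: subset_iff)
    finally have U: "card ?U \<le> Suc M * k" by simp
    show ?thesis
    proof (cases "\<exists>p\<in>P. p \<notin> D \<and> p \<inter> ?U = {}")
      case True
      then obtain p where p: "p \<in> P" "p \<notin> D" "p \<inter> ?U = {}" by blast
      have "pairwise disjnt (insert p D)"
        using D(4) p(3) by (auto simp: pairwise_insert disjnt_def)
      then show ?thesis using D p by (intro disjI1 exI[of _ "insert p D"]) auto
    next
      case False
      have "p \<inter> ?U \<noteq> {}" if "p \<in> P" for p
      proof (cases "p \<in> D")
        case True
        then have "p \<subseteq> ?U" "p \<noteq> {}" using P[OF that] k by auto
        then show ?thesis by blast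
      qed (use False that in blast)
      then show ?thesis using U \<open>finite ?U\<close> by (intro disjI2 exI[of _ ?U]) blast
    qed
  next
    assume "\<exists>U. finite U \<and> card U \<le> M * k \<and> (\<forall>p\<in>P. p \<inter> U \<noteq> {})"
    then obtain U where "finite U" "card U \<le> M * k" "\<forall>p\<in>P. p \<inter> U \<noteq> {}" by blast
    then show ?thesis by (intro disjI2 exI[of _ U]) auto
  qed
qed

text \<open>Ramsey's theorem is applied once for each relation, always inside the set independent
  for the previous ones. Later \<open>c i\<close> says that the vertices labelled \<open>i\<close>
  in two members are adjacent: the first alternative yields a forbidden clique, the second a pair of
  members without edges between equal labels.\<close>

lemma ramsey_labels:
  "\<exists>R. \<forall>(G :: 'b set) (c :: nat \<Rightarrow> 'b \<Rightarrow> 'b \<Rightarrow> bool). finite G \<longrightarrow> R \<le> card G \<longrightarrow>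
     (\<forall>i x y. c i x y \<longrightarrow> c i y x) \<longrightarrow>
     (\<exists>i<k. \<exists>X\<subseteq>G. card X = q \<and> (\<forall>x\<in>X. \<forall>y\<in>X. x \<noteq> y \<longrightarrow> c i x y)) \<or>
     (\<exists>x\<in>G. \<exists>y\<in>G. x \<noteq> y \<and> (\<forall>i<k. \<not> c i x y))"
proof (induction k)
  case 0
  have "\<exists>x\<in>G. \<exists>y\<in>G. x \<noteq> y" if "finite G" "2 \<le> card G" for G :: "'b set"
    using card_le_Suc0_iff_eq[OF that(1)] that(2) by auto
  then show ?case by (intro exI[of _ 2] allI impI disjI2) simp
next
  case (Suc k)
  then obtain R where R: "\<forall>(G :: 'b set) (c :: nat \<Rightarrow> 'b \<Rightarrow> 'b \<Rightarrow> bool). finite G \<longrightarrow> R \<le> card G \<longrightarrow>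
     (\<forall>i x y. c i x y \<longrightarrow> c i y x) \<longrightarrow>
     (\<exists>i<k. \<exists>X\<subseteq>G. card X = q \<and> (\<forall>x\<in>X. \<forall>y\<in>X. x \<noteq> y \<longrightarrow> c i x y)) \<or>
     (\<exists>x\<in>G. \<exists>y\<in>G. x \<noteq> y \<and> (\<forall>i<k. \<not> c i x y))" ..
  obtain N where "1 \<le> N \<and> (\<forall>(V::'b set) E. finite V \<and> N \<le> card V \<longrightarrow>
    (\<exists>X \<subseteq> V. card X = q \<and> clique X E \<or> card X = R \<and> indep X E))"
    using ramsey2[where 'a = 'b, of q R] ..
  then have N: "\<forall>(V::'b set) E. finite V \<and> N \<le> card V \<longrightarrow>
    (\<exists>X \<subseteq> V. card X = q \<and> clique X E \<or> card X = R \<and> indep X E)" ..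
  have N: "finite V \<Longrightarrow> N \<le> card V \<Longrightarrow>
    (\<exists>X \<subseteq> V. card X = q \<and> clique X E \<or> card X = R \<and> indep X E)" for V :: "'b set" and E
    using N[rule_format, of V E] by blast
  show ?case
  proof (intro exI[of _ N] allI impI)
    fix G :: "'b set" and c :: "nat \<Rightarrow> 'b \<Rightarrow> 'b \<Rightarrow> bool"
    assume G: "finite G" "N \<le> card G" and c: "\<forall>i x y. c i x y \<longrightarrow> c i y x"
    define E where "E = {{x, y} | x y. c k x y}"
    have E: "{x, y} \<in> E \<longleftrightarrow> c k x y" for x y
      unfolding E_def using c by (auto simp: doubleton_eq_iff)
    obtain X where X: "X \<subseteq> G" "card X = q \<and> clique X E \<or> card X = R \<and> indep X E" using N[OF G] by blast
    show "(\<exists>i<Suc k. \<exists>X\<subseteq>G. card X = q \<and> (\<forall>x\<in>X. \<forall>y\<in>X. x \<noteq> y \<longrightarrow> c i x y)) \<or>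
     (\<exists>x\<in>G. \<exists>y\<in>G. x \<noteq> y \<and> (\<forall>i<Suc k. \<not> c i x y))"
    proof (cases "card X = q \<and> clique X E")
      case True
      then show ?thesis using X(1) by (intro disjI1 exI[of _ k]) (auto simp: clique_def E)
    next
      case False
      then have X': "R \<le> card X" "indep X E" using X by auto
      from R[rule_format, OF finite_subset[OF X(1) G(1)] X'(1)] c
      have "(\<exists>i<k. \<exists>Y\<subseteq>X. card Y = q \<and> (\<forall>x\<in>Y. \<forall>y\<in>Y. x \<noteq> y \<longrightarrow> c i x y)) \<or>
        (\<exists>x\<in>X. \<exists>y\<in>X. x \<noteq> y \<and> (\<forall>i<k. \<not> c i x y))" by simp
      then show ?thesis
      proof
        assume "\<exists>i<k. \<exists>Y\<subseteq>X. card Y = q \<and> (\<forall>x\<in>Y. \<forall>y\<in>Y. x \<noteq> y \<longrightarrow> c i x y)"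
        then obtain i Y where "i < k" "Y \<subseteq> X" "card Y = q" "\<forall>x\<in>Y. \<forall>y\<in>Y. x \<noteq> y \<longrightarrow> c i x y" by blast
        then show ?thesis using X(1) by (intro disjI1 exI[of _ i] conjI exI[of _ Y]) auto
      next
        assume "\<exists>x\<in>X. \<exists>y\<in>X. x \<noteq> y \<and> (\<forall>i<k. \<not> c i x y)"
        then obtain x y where xy: "x \<in> X" "y \<in> X" "x \<noteq> y" "\<forall>i<k. \<not> c i x y" by blast
        then have "\<not> c k x y" using X'(2) by (auto simp: indep_def E)
        then have "\<forall>i<Suc k. \<not> c i x y" using xy(4) by (auto simp: less_Suc_eq)
        then show ?thesis using xy(1-3) X(1) by blast
      qed
    qed
  qed
qed

lemma sum_nbrs_eq:
  assumes V: "finite V" and E: "E \<subseteq> [V]\<^bsup>2\<^esup>"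
  shows "(\<Sum>x\<in>V. card {y \<in> V. {x, y} \<in> E}) = 2 * card E"
proof -
  have finE: "finite E" using E finite_imp_finite_nsets[OF V] finite_subset by blast
  have "(\<Sum>x\<in>V. card {y \<in> V. {x, y} \<in> E}) = (\<Sum>x\<in>V. \<Sum>e\<in>{e \<in> E. x \<in> e}. 1)"
  proof (rule sum.cong[OF refl])
    fix x assume "x \<in> V"
    have "bij_betw (\<lambda>y. {x, y}) {y \<in> V. {x, y} \<in> E} {e \<in> E. x \<in> e}"
    proof (rule bij_betw_imageI)
      show "inj_on (\<lambda>y. {x, y}) {y \<in> V. {x, y} \<in> E}" by (rule inj_onI) (auto simp: doubleton_eq_iff)
      show "(\<lambda>y. {x, y}) ` {y \<in> V. {x, y} \<in> E} = {e \<in> E. x \<in> e}"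
      proof
        show "{e \<in> E. x \<in> e} \<subseteq> (\<lambda>y. {x, y}) ` {y \<in> V. {x, y} \<in> E}"
        proof
          fix e assume e: "e \<in> {e \<in> E. x \<in> e}"
          then obtain a b where ab: "e = {a, b}" "a \<in> V" "b \<in> V" using E by (blast elim: nsets2_E)
          then show "e \<in> (\<lambda>y. {x, y}) ` {y \<in> V. {x, y} \<in> E}" using e by (auto simp: insert_commute)
        qed
      qed auto
    qed
    then show "card {y \<in> V. {x, y} \<in> E} = (\<Sum>e\<in>{e \<in> E. x \<in> e}. 1)" by (simp add: bij_betw_same_card)
  qed
  also have "\<dots> = (\<Sum>e\<in>E. \<Sum>x\<in>{x \<in> V. x \<in> e}. 1)" by (rule sum.swap_restrict[OF V finE])
  also have "\<dots> = (\<Sum>e\<in>E. 2)"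
  proof (rule sum.cong[OF refl])
    fix e assume "e \<in> E"
    then have "e \<subseteq> V" "card e = 2" using E by (auto simp: nsets_def)
    then have "{x \<in> V. x \<in> e} = e" by auto
    then show "(\<Sum>x\<in>{x \<in> V. x \<in> e}. 1) = (2::nat)" using \<open>card e = 2\<close> by simp
  qed
  finally show ?thesis by simp
qed

section \<open>Uniform systems as set families\<close>

lemma clique_insertI: "clique K E \<Longrightarrow> (\<And>c. c \<in> K \<Longrightarrow> {v, c} \<in> E) \<Longrightarrow> clique (insert v K) E"
  by (auto simp: clique_def insert_commute)

lemma induced_contains_K_iff:
  "induced_contains_K n E S \<longleftrightarrow> (\<exists>K\<subseteq>S. finite K \<and> card K = n \<and> clique K E)"
  by (auto simp: induced_contains_K_def contains_K_def induced_edges_def nsets_def clique_def)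

lemma contains_K_iff: "contains_K n V E \<longleftrightarrow> (\<exists>K\<subseteq>V. finite K \<and> card K = n \<and> clique K E)"
  by (auto simp: contains_K_def nsets_def)

text \<open>A set can replace the multiset because uniform families have no repetitions. Maximality
  takes the form in which it is used: the K_(r-1) created by adding \<open>v\<close> to
  \<open>S\<close> contains \<open>v\<close>, so \<open>v\<close> is joined to an (r-2)-clique
  inside \<open>S\<close>.\<close>

locale set_system =
  fixes r t :: nat and V :: "'a set" and E :: "'a set set" and F :: "'a set set"
  assumes r3: "3 \<le> r" and finV: "finite V" and EV: "E \<subseteq> [V]\<^bsup>2\<^esup>"
    and FV: "\<And>S. S \<in> F \<Longrightarrow> S \<subseteq> V" and Ft: "\<And>S. S \<in> F \<Longrightarrow> card S = t"
    and no_Kr: "\<And>K. K \<subseteq> V \<Longrightarrow> clique K E \<Longrightarrow> card K \<noteq> r"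
    and free: "\<And>S K. S \<in> F \<Longrightarrow> K \<subseteq> S \<Longrightarrow> clique K E \<Longrightarrow> card K \<noteq> r - 1"
    and dom: "\<And>S v. S \<in> F \<Longrightarrow> v \<in> V - S \<Longrightarrow>
      \<exists>C\<subseteq>S. clique C E \<and> card C = r - 2 \<and> (\<forall>c\<in>C. {v, c} \<in> E)"
    and inter: "\<And>S S'. S \<in> F \<Longrightarrow> S' \<in> F \<Longrightarrow> S \<noteq> S' \<Longrightarrow> \<exists>C\<subseteq>S \<inter> S'. clique C E \<and> card C = r - 2"

lemma uniform_mset_set:
  assumes "\<forall>S. count F S \<le> 1" shows "F = mset_set (set_mset F)"
proof (rule multiset_eqI)
  fix S show "count F S = count (mset_set (set_mset F)) S"
  proof (cases "S \<in># F")
    case True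
    then have "count F S > 0" by simp
    then have "count F S = 1" using assms by (metis One_nat_def Suc_leI le_antisym)
    then show ?thesis using True by simp
  qed (simp add: not_in_iff)
qed

lemma rt_system_set_system:
  assumes "rt_system r t V E F"
  shows "set_system r t V E (set_mset F)" "size F = card (set_mset F)"
proof -
  have rs: "r_system r V E F" and u: "\<forall>S. count F S \<le> 1" "\<forall>S\<in>#F. card S = t"
    using assms by (auto simp: rt_system_def uniform_family_def)
  have r: "3 \<le> r" "finite V" "E \<subseteq> [V]\<^bsup>2\<^esup>" "\<forall>S\<in>#F. S \<subseteq> V" "\<not> contains_K r V E"
    "\<forall>S\<in>#F. maximally_K_free (r - 1) V E S"
    "\<forall>S\<in>#F. \<forall>T\<in>#F. S \<noteq> T \<longrightarrow> induced_contains_K (r - 2) E (S \<inter> T)"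
    using rs by (auto simp: r_system_def simple_graph_def)
  have fin: "finite S" if "S \<subseteq> V" for S using finite_subset[OF that r(2)] .
  show "set_system r t V E (set_mset F)"
  proof
    show "card K \<noteq> r" if "K \<subseteq> V" "clique K E" for K
      using r(5) that fin by (auto simp: contains_K_iff)
    show "card K \<noteq> r - 1" if "S \<in># F" "K \<subseteq> S" "clique K E" for S K
      using r(4,6) that fin by (metis induced_contains_K_iff maximally_K_free_def order_trans)
    show "\<exists>C\<subseteq>S. clique C E \<and> card C = r - 2 \<and> (\<forall>c\<in>C. {v, c} \<in> E)" if S: "S \<in># F" and v: "v \<in> V - S" for S v
    proof -
      obtain K where K: "K \<subseteq> insert v S" "finite K" "card K = r - 1" "clique K E"
        using bspec[OF r(6) S] v unfolding maximally_K_free_def induced_contains_K_iff by blast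
      have "v \<in> K"
      proof (rule ccontr)
        assume "v \<notin> K"
        then have "K \<subseteq> S" using K by auto
        then show False
          using bspec[OF r(6) S] K unfolding maximally_K_free_def induced_contains_K_iff by blast
      qed
      then show ?thesis using K
        by (intro exI[of _ "K - {v}"]) (auto simp: clique_def)
    qed
    show "\<exists>C\<subseteq>S \<inter> S'. clique C E \<and> card C = r - 2" if "S \<in># F" "S' \<in># F" "S \<noteq> S'" for S S'
      using r(7)[rule_format, OF that] unfolding induced_contains_K_iff by blast
  qed (use r u in auto)
  have "F = mset_set (set_mset F)" by (rule uniform_mset_set[OF u(1)])
  then show "size F = card (set_mset F)" by (metis size_mset_set)
qed

context set_system begin

lemma fin: "S \<subseteq> V \<Longrightarrow> finite S"
  using finV finite_subset by blast

lemma finF: "finite F"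
  by (rule finite_subset[of _ "Pow V"]) (use FV finV in auto)

lemma finE: "finite E"
  using EV finite_imp_finite_nsets[OF finV] finite_subset by blast

lemma edge_irrefl: "{x, x} \<notin> E"
  using EV doubleton_in_nsets_2[of x x V] by blast

lemma edge_in: "{x, y} \<in> E \<Longrightarrow> x \<in> V \<and> y \<in> V \<and> x \<noteq> y"
  using EV doubleton_in_nsets_2[of x y V] by blast

text \<open>If the clique joined to \<open>v\<close> lay in S \<inter> S', then together with
  \<open>v\<close> it would be a K_(r-1) inside \<open>S'\<close>.\<close>

lemma dom_avoid:
  assumes S: "S \<in> F" "S' \<in> F" and v: "v \<in> S' - S"
  shows "\<exists>C\<subseteq>S. clique C E \<and> card C = r - 2 \<and> (\<forall>c\<in>C. {v, c} \<in> E) \<and> C \<inter> (S - S') \<noteq> {}"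
proof -
  have "v \<in> V - S" using v FV[OF S(2)] by auto
  from dom[OF S(1) this] obtain C where C: "C \<subseteq> S" "clique C E" "card C = r - 2" "\<forall>c\<in>C. {v, c} \<in> E" by blast
  have "C \<inter> (S - S') \<noteq> {}"
  proof
    assume "C \<inter> (S - S') = {}"
    then have "insert v C \<subseteq> S'" using C v by auto
    moreover have "clique (insert v C) E" using C by (intro clique_insertI) auto
    moreover have "card (insert v C) = r - 1"
      using C v r3 fin[of C] FV[OF S(1)] by (subst card_insert_disjoint) auto
    ultimately show False using free[OF S(2)] by blast
  qed
  then show ?thesis using C by blast
qed

lemma adj_avoid:
  assumes "S \<in> F" "S' \<in> F" "v \<in> S' - S" shows "\<exists>c\<in>S - S'. {v, c} \<in> E"
  using dom_avoid[OF assms] by blast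

text \<open>Every member shares an (r-2)-clique with a fixed member \<open>S0\<close>, which has
  only 2^t subsets. For \<open>S0\<close> itself the clique comes from a second member, hence
  \<open>2 \<le> card F\<close>.\<close>

lemma common_clique:
  assumes "2 \<le> card F"
  obtains A where "clique A E" "card A = r - 2" "A \<subseteq> V" "card F \<le> 2 ^ t * card {S \<in> F. A \<subseteq> S}"
proof -
  have ne: "F \<noteq> {}" using assms by auto
  then obtain S0 where S0: "S0 \<in> F" by blast
  have "\<exists>C. C \<subseteq> S0 \<and> C \<subseteq> S \<and> clique C E \<and> card C = r - 2" if "S \<in> F" for S
  proof (cases "S = S0")
    case True
    have "\<not> F \<subseteq> {S0}" using assms card_mono[of "{S0}" F] by auto
    then obtain S' where "S' \<in> F" "S' \<noteq> S0" by blast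
    then show ?thesis using inter[OF S0, of S'] True by blast
  qed (use inter[OF S0 that] in blast)
  then have "\<forall>S\<in>F. \<exists>C. C \<subseteq> S0 \<and> C \<subseteq> S \<and> clique C E \<and> card C = r - 2" by blast
  from bchoice[OF this] obtain f where
    f: "\<forall>S\<in>F. f S \<subseteq> S0 \<and> f S \<subseteq> S \<and> clique (f S) E \<and> card (f S) = r - 2" by blast
  have "card (f ` F) \<le> card (Pow S0)"
    using f fin[OF FV[OF S0]] by (intro card_mono) auto
  also have "\<dots> = 2 ^ t" using fin[OF FV[OF S0]] Ft[OF S0] by (simp add: card_Pow)
  finally obtain A where A: "A \<in> f ` F" "card F \<le> 2 ^ t * card {S \<in> F. f S = A}"
    using pigeonhole_fiber[OF finF ne] by blast
  have "card {S \<in> F. f S = A} \<le> card {S \<in> F. A \<subseteq> S}" using f finF by (intro card_mono) auto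
  then have "card F \<le> 2 ^ t * card {S \<in> F. A \<subseteq> S}" using A(2) by (meson mult_le_mono2 order_trans)
  moreover have "clique A E" "card A = r - 2" "A \<subseteq> V" using A(1) f FV by blast+
  ultimately show thesis using that by blast
qed

lemma card_V_le:
  assumes "F \<noteq> {}" shows "card V \<le> 2 * card E + t"
proof -
  obtain S where S: "S \<in> F" using assms by blast
  have "V \<subseteq> S \<union> \<Union>E"
  proof
    fix v assume v: "v \<in> V"
    show "v \<in> S \<union> \<Union>E"
    proof (cases "v \<in> S")
      case False
      then obtain C where C: "card C = r - 2" "\<forall>c\<in>C. {v, c} \<in> E" using dom[OF S] v by blast
      then have "C \<noteq> {}" using r3 by auto
      then show ?thesis using C(2) by blast
    qed auto
  qed
  moreover have fins: "finite S" "finite (\<Union>E)"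
    using FV[OF S] fin EV finE by (auto simp: nsets_def)
  ultimately have "card V \<le> card (S \<union> \<Union>E)" by (intro card_mono) auto
  also have "\<dots> \<le> card S + card (\<Union>E)" by (rule card_Un_le)
  also have "card (\<Union>E) \<le> (\<Sum>e\<in>E. card e)" by (rule card_Union_le_sum_card)
  also have "\<dots> = 2 * card E" using EV by (subst sum.cong[of E E card "\<lambda>_. 2"]) (auto simp: nsets_def)
  finally show ?thesis using Ft[OF S] by simp
qed

text \<open>The crude count: a member containing \<open>A\<close> is given by its other t - (r-2)
  vertices, and domination bounds the number of vertices by the edges.\<close>

lemma card_F_le_edges:
  assumes "2 \<le> card F" and rt: "r - 2 \<le> t"
  shows "card F \<le> 2 ^ t * (2 * card E + t) ^ (t - (r - 2))"
proof -
  obtain A where A: "clique A E" "card A = r - 2" "A \<subseteq> V" "card F \<le> 2 ^ t * card {S \<in> F. A \<subseteq> S}"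
    using common_clique[OF assms(1)] by blast
  let ?k = "t - (r - 2)"
  have "card {S \<in> F. A \<subseteq> S} \<le> card (nsets V ?k)"
  proof (rule card_inj_on_le[where f = "\<lambda>S. S - A"])
    show "inj_on (\<lambda>S. S - A) {S \<in> F. A \<subseteq> S}" by (rule inj_onI) blast
    show "(\<lambda>S. S - A) ` {S \<in> F. A \<subseteq> S} \<subseteq> [V]\<^bsup>?k\<^esup>"
      using FV Ft A fin by (auto simp: nsets_def card_Diff_subset)
    show "finite ([V]\<^bsup>?k\<^esup>)" using finV by (rule finite_imp_finite_nsets)
  qed
  also have "\<dots> = card V choose ?k" by simp
  also have "\<dots> \<le> card V ^ ?k"
    by (cases "?k \<le> card V") (simp_all add: binomial_le_pow binomial_eq_0)
  also have "\<dots> \<le> (2 * card E + t) ^ ?k"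
  proof (rule power_mono)
    show "card V \<le> 2 * card E + t" using assms(1) by (intro card_V_le) auto
  qed simp
  finally show ?thesis using A(4) by (meson mult_le_mono2 order_trans)
qed

lemma clique_card_less:
  assumes "K \<subseteq> V" "clique K E" shows "card K < r"
proof (rule ccontr)
  assume "\<not> ?thesis"
  then obtain K' where "K' \<subseteq> K" "card K' = r" using obtain_subset_with_card_n[of r K] by auto
  then show False using no_Kr[of K'] assms smaller_clique[of K E K'] by auto
qed

text \<open>The vertices that extend \<open>U\<close> to members are pairwise adjacent by
  \<open>adj_avoid\<close>, so they form a clique.\<close>

lemma codim1:
  assumes U: "card U + 1 = t" "finite U" shows "card {S \<in> F. U \<subseteq> S} < r"
proof -
  let ?G = "{S \<in> F. U \<subseteq> S}"
  have "\<exists>w. S - U = {w}" if "S \<in> ?G" for S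
  proof -
    have "card (S - U) = 1" using that U Ft[of S] by (simp add: card_Diff_subset)
    then show ?thesis by (simp add: card_1_singleton_iff)
  qed
  then have "\<forall>S\<in>?G. \<exists>w. S - U = {w}" by blast
  from bchoice[OF this] obtain w where w: "\<forall>S\<in>?G. S - U = {w S}" by blast
  have eq: "S = insert (w S) U" if "S \<in> ?G" for S using bspec[OF w that] that by auto
  have inj: "inj_on w ?G" by (rule inj_onI) (metis eq)
  have "clique (w ` ?G) E"
    unfolding clique_def
  proof (intro ballI impI)
    fix x y assume "x \<in> w ` ?G" "y \<in> w ` ?G" "x \<noteq> y"
    then obtain S S' where S: "S \<in> ?G" "S' \<in> ?G" "x = w S" "y = w S'" by blast
    have eqs: "S = insert x U" "S' = insert y U" using eq S by metis+
    have "x \<notin> U" "y \<notin> U" using w S by blast+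
    then have d: "S - S' = {x}" "S' - S = {y}" unfolding eqs using \<open>x \<noteq> y\<close> by auto
    then show "{x, y} \<in> E" using adj_avoid[of S' S x] S by auto
  qed
  moreover have "w ` ?G \<subseteq> V" using w FV by blast
  ultimately have "card (w ` ?G) < r" by (intro clique_card_less)
  then show ?thesis using inj by (simp add: card_image)
qed

text \<open>A vertex outside \<open>U\<close> lies in at most r of the m pairs S - U, by
  \<open>codim1\<close>, so the pairs occupy at least 2m/r vertices. Every pair contains a given
  such vertex \<open>v\<close> or, by \<open>adj_avoid\<close>, one of its neighbours outside
  \<open>U\<close>; hence m \<le> r * (d v + 1). Summing over all these vertices gives m^2 << e +
  m.\<close>

lemma codim2_quadratic:
  assumes U: "card U + 2 = t" "finite U"
  shows "(card {S \<in> F. U \<subseteq> S})\<^sup>2 \<le> r\<^sup>2 * (card E + card {S \<in> F. U \<subseteq> S})"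
proof -
  define G where "G = {S \<in> F. U \<subseteq> S}"
  define m where "m = card G"
  define W where "W = (\<Union>S\<in>G. S - U)"
  define c where "c v = card {S \<in> G. v \<in> S}" for v
  define d where "d v = card {y \<in> V. {v, y} \<in> E}" for v
  have finG: "finite G" using finF by (simp add: G_def)
  have W: "W \<subseteq> V" "finite W" 
  proof -
    show "W \<subseteq> V" unfolding W_def G_def using FV by blast
    then show "finite W" by (rule fin)
  qed
  have c: "c v \<le> r" if "v \<notin> U" for v
  proof -
    have "{S \<in> G. v \<in> S} = {S \<in> F. insert v U \<subseteq> S}" by (auto simp: G_def)
    then show ?thesis using codim1[of "insert v U"] U that by (simp add: c_def)
  qed
  have pair: "card (S - U) = 2" if "S \<in> G" for S
    using that U Ft[of S] by (auto simp: G_def card_Diff_subset)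
  have cW: "card W \<le> 2 * m"
  proof -
    have "card W \<le> (\<Sum>S\<in>G. card (S - U))" unfolding W_def using finG by (rule card_UN_le)
    then show ?thesis using pair by (simp add: m_def)
  qed
  have "2 * m = (\<Sum>S\<in>G. card (S - U))" using pair by (simp add: m_def)
  also have "\<dots> = (\<Sum>S\<in>G. \<Sum>v\<in>{v \<in> W. v \<in> S}. 1)"
  proof (rule sum.cong[OF refl])
    fix S assume "S \<in> G"
    then have "{v \<in> W. v \<in> S} = S - U" by (auto simp: W_def G_def)
    then show "card (S - U) = (\<Sum>v\<in>{v \<in> W. v \<in> S}. 1)" by simp
  qed
  also have "\<dots> = (\<Sum>v\<in>W. \<Sum>S\<in>{S \<in> G. v \<in> S}. 1)" by (rule sum.swap_restrict[OF finG W(2)])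
  also have "\<dots> = (\<Sum>v\<in>W. c v)" by (simp add: c_def)
  also have "\<dots> \<le> (\<Sum>v\<in>W. r)" by (intro sum_mono c) (auto simp: W_def)
  finally have mW: "2 * m \<le> card W * r" by simp
  have md: "m \<le> r * (d v + 1)" if v: "v \<in> W" for v
  proof -
    let ?N = "{y \<in> V. {v, y} \<in> E}"
    obtain T where T: "T \<in> G" "v \<in> T" using v by (auto simp: W_def)
    have vU: "v \<notin> U" using v by (auto simp: W_def)
    have finN: "finite (?N - U)" using finV by auto
    have "G \<subseteq> {S \<in> G. v \<in> S} \<union> (\<Union>y\<in>?N - U. {S \<in> G. y \<in> S})"
    proof
      fix S assume S: "S \<in> G"
      show "S \<in> {S \<in> G. v \<in> S} \<union> (\<Union>y\<in>?N - U. {S \<in> G. y \<in> S})"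
      proof (cases "v \<in> S")
        case False
        then obtain y where y: "y \<in> S - T" "{v, y} \<in> E" using adj_avoid[of S T v] S T by (auto simp: G_def)
        then have "y \<in> ?N - U" using T edge_in by (auto simp: G_def)
        then show ?thesis using S y by blast
      qed (use S in auto)
    qed
    then have "m \<le> card ({S \<in> G. v \<in> S} \<union> (\<Union>y\<in>?N - U. {S \<in> G. y \<in> S}))"
      unfolding m_def using finG finN by (intro card_mono) auto
    also have "\<dots> \<le> c v + card (\<Union>y\<in>?N - U. {S \<in> G. y \<in> S})" unfolding c_def by (rule card_Un_le)
    also have "card (\<Union>y\<in>?N - U. {S \<in> G. y \<in> S}) \<le> (\<Sum>y\<in>?N - U. c y)"
      unfolding c_def by (rule card_UN_le[OF finN])
    also have "\<dots> \<le> (\<Sum>y\<in>?N - U. r)" by (intro sum_mono c) auto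
    also have "\<dots> \<le> d v * r" unfolding d_def using finV by (simp add: card_mono)
    finally show ?thesis using c[OF vU] by (simp add: algebra_simps)
  qed
  have "card W * m \<le> (\<Sum>v\<in>W. r * (d v + 1))"
    using sum_bounded_below[of W m "\<lambda>v. r * (d v + 1)"] md by simp
  also have "\<dots> = r * ((\<Sum>v\<in>W. d v) + card W)"
    by (simp add: sum_distrib_left[symmetric] sum.distrib distrib_left)
  also have "\<dots> \<le> r * ((\<Sum>v\<in>V. d v) + 2 * m)"
    using W finV cW by (intro mult_le_mono2 add_le_mono sum_mono2) auto
  also have "(\<Sum>v\<in>V. d v) = 2 * card E" unfolding d_def by (rule sum_nbrs_eq[OF finV EV])
  finally have "card W * m \<le> r * (2 * card E + 2 * m)" .
  then have "r * (card W * m) \<le> r * (r * (2 * card E + 2 * m))" by (rule mult_le_mono2)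
  moreover have "2 * m * m \<le> card W * r * m" using mW by (rule mult_le_mono1)
  moreover have "card W * r * m = r * (card W * m)"
    "r * (r * (2 * card E + 2 * m)) = 2 * (r * r * (card E + m))" by (simp_all add: algebra_simps)
  ultimately have "2 * (m * m) \<le> 2 * (r * r * (card E + m))" by linarith
  then show ?thesis by (simp add: m_def G_def power2_eq_square)
qed

end

subsection \<open>Reduction to triangle-free graphs\<close>

context set_system begin

text \<open>Each \<open>s x\<close> is joined to an (r-2)-clique in \<open>S'\<close>; equal
  adjacency types allow its copy to be read inside \<open>S\<close>, which contains no K_(r-1).
  Comparing sizes shows that all \<open>s x\<close> have the same r-3 neighbours \<open>B\<close> in
  \<open>A\<close> and are pairwise non-adjacent, and \<open>B\<close> is the clique of the
  join.\<close>

lemma homogeneous_pair_join: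
  fixes k :: nat
  assumes S: "S \<in> F" "S' \<in> F" and A: "clique A E" "card A = r - 2" "S \<inter> S' = A"
    and s: "bij_betw s {..<k} (S - A)" and u: "bij_betw u {..<k} (S' - A)"
    and k: "k = 2 \<or> k = 3"
    and tyA: "\<And>a i. a \<in> A \<Longrightarrow> i < k \<Longrightarrow> {a, s i} \<in> E \<longleftrightarrow> {a, u i} \<in> E"
    and tyP: "\<And>i j. i < k \<Longrightarrow> j < k \<Longrightarrow> {s i, s j} \<in> E \<longleftrightarrow> {u i, u j} \<in> E"
    and non: "\<And>i. i < k \<Longrightarrow> {s i, u i} \<notin> E"
  shows "\<exists>B\<subseteq>S. card B = r - 3 \<and> clique B E \<and> (\<forall>b\<in>B. \<forall>x\<in>S - B. {b, x} \<in> E) \<and>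
    (\<forall>x\<in>S - B. \<forall>y\<in>S - B. {x, y} \<notin> E)"
proof -
  have finA: "finite A" using fin[OF FV[OF S(1)]] A(3) by auto
  have sS: "s i \<in> S - A" if "i < k" for i using s that by (auto simp: bij_betw_def)
  have sinj: "inj_on s {..<k}" using s by (auto simp: bij_betw_def)
  have Su: "S' - A = u ` {..<k}" using u by (auto simp: bij_betw_def)
  have uinj: "inj_on u {..<k}" using u by (auto simp: bij_betw_def)
  \<comment> \<open>The clique joined to \<open>s x\<close> is split into its part in
    \<open>A\<close> and the set of labels of its other vertices. The latter is nonempty by
    \<open>dom_avoid\<close> and omits \<open>x\<close> because \<open>s x\<close> and
    \<open>u x\<close> are not adjacent.\<close>
  have "\<forall>x\<in>{..<k}. \<exists>CD. fst CD \<subseteq> A \<and> snd CD \<subseteq> {..<k} - {x} \<and> snd CD \<noteq> {} \<and>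
      card (fst CD) + card (snd CD) = r - 2 \<and> (\<forall>a\<in>fst CD. {a, s x} \<in> E) \<and>
      (\<forall>a\<in>fst CD. \<forall>y\<in>snd CD. {a, s y} \<in> E) \<and> (\<forall>y\<in>snd CD. \<forall>z\<in>snd CD. y \<noteq> z \<longrightarrow> {s y, s z} \<in> E)"
  proof
    fix x assume x: "x \<in> {..<k}"
    have "s x \<in> S - S'" using sS[of x] x A(3) by auto
    from dom_avoid[OF S(2,1) this] obtain C where C: "C \<subseteq> S'" "clique C E" "card C = r - 2"
      "\<forall>c\<in>C. {s x, c} \<in> E" "C \<inter> (S' - S) \<noteq> {}" by blast
    define D where "D = {y \<in> {..<k}. u y \<in> C}"
    have CD: "C = (C \<inter> A) \<union> u ` D"
    proof
      show "C \<subseteq> (C \<inter> A) \<union> u ` D"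
      proof
        fix c assume c: "c \<in> C"
        show "c \<in> (C \<inter> A) \<union> u ` D"
        proof (cases "c \<in> A")
          case False
          then have "c \<in> u ` {..<k}" using c C(1) Su by blast
          then show ?thesis using c by (auto simp: D_def)
        qed (use c in auto)
      qed
    qed (auto simp: D_def)
    have uD: "u ` D \<inter> A = {}" using Su by (auto simp: D_def)
    have card: "card (C \<inter> A) + card D = r - 2"
    proof -
      have "finite D" by (rule finite_subset[of _ "{..<k}"]) (auto simp: D_def)
      then have "finite (u ` D)" by simp
      then have "card C = card (C \<inter> A) + card (u ` D)"
        by (subst CD, intro card_Un_disjoint) (use finA uD in auto)
      moreover have "card (u ` D) = card D"
        by (rule card_image) (rule inj_on_subset[OF uinj], auto simp: D_def)
      ultimately show ?thesis using C(3) by simp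
    qed
    have "D \<noteq> {}"
    proof -
      obtain c where "c \<in> C" "c \<in> S'" "c \<notin> S" using C(5) by blast
      then have "c \<in> u ` D" using CD A(3) by blast
      then show ?thesis by blast
    qed
    moreover have "x \<notin> D" using C(4) non[of x] x by (auto simp: D_def)
    moreover have "\<forall>y\<in>D. \<forall>z\<in>D. y \<noteq> z \<longrightarrow> {s y, s z} \<in> E"
    proof (intro ballI impI)
      fix y z assume yz: "y \<in> D" "z \<in> D" "y \<noteq> z"
      then have "u y \<noteq> u z" using inj_onD[OF uinj, of y z] by (auto simp: D_def)
      then have "{u y, u z} \<in> E" using C(2) yz by (auto simp: D_def clique_def)
      then show "{s y, s z} \<in> E" using tyP yz by (auto simp: D_def)
    qed
    moreover have "\<forall>a\<in>C \<inter> A. \<forall>y\<in>D. {a, s y} \<in> E"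
    proof (intro ballI)
      fix a y assume ay: "a \<in> C \<inter> A" "y \<in> D"
      then have "a \<noteq> u y" using uD by blast
      then have "{a, u y} \<in> E" using C(2) ay by (auto simp: D_def clique_def)
      then show "{a, s y} \<in> E" using tyA ay by (auto simp: D_def)
    qed
    moreover have "\<forall>a\<in>C \<inter> A. {a, s x} \<in> E" using C(4) by (auto simp: insert_commute)
    ultimately show "\<exists>CD. fst CD \<subseteq> A \<and> snd CD \<subseteq> {..<k} - {x} \<and> snd CD \<noteq> {} \<and>
      card (fst CD) + card (snd CD) = r - 2 \<and> (\<forall>a\<in>fst CD. {a, s x} \<in> E) \<and>
      (\<forall>a\<in>fst CD. \<forall>y\<in>snd CD. {a, s y} \<in> E) \<and> (\<forall>y\<in>snd CD. \<forall>z\<in>snd CD. y \<noteq> z \<longrightarrow> {s y, s z} \<in> E)"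
      using card by (intro exI[of _ "(C \<inter> A, D)"]) (auto simp: D_def)
  qed
  from bchoice[OF this] obtain CD where CD: "\<forall>x\<in>{..<k}. fst (CD x) \<subseteq> A \<and> snd (CD x) \<subseteq> {..<k} - {x} \<and> snd (CD x) \<noteq> {} \<and>
      card (fst (CD x)) + card (snd (CD x)) = r - 2 \<and> (\<forall>a\<in>fst (CD x). {a, s x} \<in> E) \<and>
      (\<forall>a\<in>fst (CD x). \<forall>y\<in>snd (CD x). {a, s y} \<in> E) \<and>
      (\<forall>y\<in>snd (CD x). \<forall>z\<in>snd (CD x). y \<noteq> z \<longrightarrow> {s y, s z} \<in> E)" ..
  define C where "C x = fst (CD x)" for x
  define D where "D x = snd (CD x)" for x
  have C: "C x \<subseteq> A" and D: "D x \<subseteq> {..<k} - {x}" "D x \<noteq> {}" and card: "card (C x) + card (D x) = r - 2"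
    and Cx: "\<forall>a\<in>C x. {a, s x} \<in> E" and CDx: "\<forall>a\<in>C x. \<forall>y\<in>D x. {a, s y} \<in> E"
    and DD: "\<forall>y\<in>D x. \<forall>z\<in>D x. y \<noteq> z \<longrightarrow> {s y, s z} \<in> E" if "x < k" for x
    using CD that unfolding C_def D_def by auto
  have K: "card C' + card W \<noteq> r - 1" if "C' \<subseteq> A" "W \<subseteq> {..<k}" "\<forall>a\<in>C'. \<forall>y\<in>W. {a, s y} \<in> E"
    "\<forall>y\<in>W. \<forall>z\<in>W. y \<noteq> z \<longrightarrow> {s y, s z} \<in> E" for C' W
  proof -
    have "clique (C' \<union> s ` W) E"
    proof (rule clique_Un)
      show "clique C' E" using A(1) that(1) smaller_clique by blast
      show "clique (s ` W) E" using that(4) by (auto simp: clique_def)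
      show "\<forall>v\<in>C'. \<forall>w\<in>s ` W. v \<noteq> w \<longrightarrow> {v, w} \<in> E" using that(3) by auto
    qed
    moreover have "C' \<union> s ` W \<subseteq> S" using that(1,2) A(3) sS by blast
    ultimately have "card (C' \<union> s ` W) \<noteq> r - 1" using free[OF S(1)] by blast
    moreover have "card (C' \<union> s ` W) = card C' + card (s ` W)"
      using that(1,2) sS finA by (intro card_Un_disjoint) (auto intro: finite_subset)
    moreover have "card (s ` W) = card W" using inj_on_subset[OF sinj that(2)] by (rule card_image)
    ultimately show ?thesis by simp
  qed
  \<comment> \<open>Otherwise \<open>C x\<close>, \<open>s x\<close> and the vertices labelled by
    \<open>D x\<close> would form a K_(r-1) in \<open>S\<close>.\<close>
  have not_all: "\<exists>y\<in>D x. {s x, s y} \<notin> E" if x: "x < k" for x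
  proof (rule ccontr)
    assume "\<not> ?thesis"
    then have h: "\<forall>y\<in>D x. {s x, s y} \<in> E" by blast
    have "finite (D x)" "x \<notin> D x" using D[OF x] finite_subset by auto
    then have "card (insert x (D x)) = Suc (card (D x))" by simp
    then have "card (C x) + card (insert x (D x)) = r - 1" using card[OF x] r3 by simp
    moreover have "card (C x) + card (insert x (D x)) \<noteq> r - 1"
      using C[OF x] D[OF x] x Cx[OF x] CDx[OF x] DD[OF x] h
      by (intro K) (auto simp: insert_commute)
    ultimately show False by simp
  qed
  define N where "N x = {a \<in> A. {a, s x} \<in> E}" for x
  \<comment> \<open>\<open>N x\<close> is not all of \<open>A\<close>, as \<open>A\<close> with
    \<open>s x\<close> would be a K_(r-1). So it has at most r-3 elements, and any r-3 neighbours
    exhaust it.\<close>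
  have N: "C' = N x" if "x < k" "C' \<subseteq> A" "card C' = r - 3" "\<forall>a\<in>C'. {a, s x} \<in> E" for C' x
  proof -
    have "N x \<noteq> A"
    proof
      assume "N x = A"
      then have "card A + card {x} \<noteq> r - 1" using that by (intro K) (auto simp: N_def)
      then show False using A(2) r3 by simp
    qed
    then have "card (N x) < card A" using finA by (intro psubset_card_mono) (auto simp: N_def)
    then have "card (N x) \<le> card C'" using that A(2) by simp
    then show ?thesis using that finA by (intro card_seteq) (auto simp: N_def)
  qed
  have single: "card (D x) = 1" if x: "x < k" for x
    using k
  proof
    assume k: "k = 2"
    have "card (D x) \<le> card ({..<k} - {x})" using D[OF x] by (intro card_mono) auto
    then have "card (D x) \<le> 1" using k x by simp
    moreover have "card (D x) > 0" using D[OF x] finite_subset by (fastforce simp: card_gt_0_iff)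
    ultimately show ?thesis by simp
  next
    assume k: "k = 3"
    show ?thesis
    proof (rule ccontr)
      \<comment> \<open>If \<open>D x\<close> is {b, c}, then \<open>s b\<close> and
        \<open>s c\<close> are adjacent, and \<open>not_all\<close> forces \<open>D b\<close> and
        \<open>D c\<close> to be {x}. Hence \<open>C b\<close> and \<open>C c\<close> both equal
        \<open>N x\<close>, and these r-3 vertices with \<open>s b\<close>, \<open>s c\<close> are a
        K_(r-1).\<close>
      assume ne: "card (D x) \<noteq> 1"
      have "card ({..<k} - {x}) = 2" using k x by simp
      then obtain b c where bc: "{..<k} - {x} = {b, c}" "b \<noteq> c" by (auto simp: card_2_iff)
      have Dx: "D x = {b, c}"
      proof -
        have "D x \<subseteq> {b, c}" "D x \<noteq> {}" using D[OF x] bc by auto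
        moreover from this have "card (D x) > 0" "card (D x) \<le> 2"
          using card_mono[of "{b, c}" "D x"] bc(2) finite_subset[of "D x" "{b, c}"] by (auto simp: card_gt_0_iff)
        ultimately show ?thesis using ne bc(2) by (intro card_subset_eq) auto
      qed
      have lt: "b < k" "c < k" "b \<noteq> x" "c \<noteq> x" and all: "{..<k} = {x, b, c}" using bc x by auto
      have Db: "D b \<subseteq> {x, c}" and Dc: "D c \<subseteq> {x, b}" using D(1)[OF lt(1)] D(1)[OF lt(2)] all by auto
      have bcE: "{s b, s c} \<in> E" using DD[OF x] Dx bc(2) by auto
      have xb: "x \<in> D b"
        using not_all[OF lt(1)] Db bcE by auto
      have cbE: "{s c, s b} \<in> E" using bcE by (simp add: insert_commute)
      have xc: "x \<in> D c"
        using not_all[OF lt(2)] Dc cbE by auto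
      have 1: "{s x, s c} \<in> E" if "c \<in> D b" using DD[OF lt(1), rule_format, OF xb that] lt(4) by simp
      have 2: "{s x, s b} \<in> E" if "b \<in> D c" using DD[OF lt(2), rule_format, OF xc that] lt(3) by simp
      have nb: "{s b, s x} \<notin> E" using not_all[OF lt(1)] Db bcE by auto
      have nc: "{s c, s x} \<notin> E" using not_all[OF lt(2)] Dc cbE by auto
      have "c \<notin> D b" "b \<notin> D c" using 1 2 nb nc by (auto simp: insert_commute)
      then have "D b = {x}" "D c = {x}" using Db Dc xb xc by auto
      then have cards: "card (C b) = r - 3" "card (C c) = r - 3" using card[OF lt(1)] card[OF lt(2)] by auto
      have "C b = N x" using CDx[OF lt(1)] xb C[OF lt(1)] cards(1) by (intro N[OF x]) auto
      moreover have "C c = N x" using CDx[OF lt(2)] xc C[OF lt(2)] cards(2) by (intro N[OF x]) auto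
      ultimately have eq: "C b = C c" by simp
      have "card (C b) + card {b, c} \<noteq> r - 1"
        using C[OF lt(1)] lt Cx[OF lt(1)] Cx[OF lt(2)] eq bcE cbE by (intro K) auto
      then show False using cards bc(2) r3 by simp
    qed
  qed
  have CN: "C x = N x" if "x < k" for x
    using single[OF that] card[OF that] C[OF that] Cx[OF that] that by (intro N) auto
  have step: "N x = N y" if "x < k" "y \<in> D x" for x y
  proof -
    have "y < k" using D(1)[OF that(1)] that(2) by auto
    then have "C x = N y"
      using single[OF that(1)] card[OF that(1)] C[OF that(1)] CDx[OF that(1)] that(2) by (intro N) auto
    then show ?thesis using CN[OF that(1)] by simp
  qed
  \<comment> \<open>Every label shares its \<open>N\<close> with another label. Classes of size at
    least two on at most three labels leave room for one class only.\<close>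
  have NN: "N x = N 0" if "x < k" for x
  proof -
    have ex: "\<exists>y<k. y \<noteq> x \<and> N x = N y" if "x < k" for x using D[OF that] step[OF that] by blast
    show ?thesis using k
    proof
      assume "k = 2"
      then show ?thesis using ex[of 0] that by (auto simp: less_2_cases_iff)
    next
      assume k: "k = 3"
      have "x = 0 \<or> x = 1 \<or> x = 2" using that k by auto
      moreover have "\<exists>y\<in>{1,2}. N 0 = N y" "\<exists>y\<in>{0,2}. N 1 = N y" "\<exists>y\<in>{0,1}. N 2 = N y"
        using ex[of 0] ex[of 1] ex[of 2] k by (auto simp: less_Suc_eq numeral_3_eq_3 numeral_2_eq_2)
      ultimately show ?thesis by (elim disjE bexE insertE) auto
    qed
  qed
  have k0: "0 < k" using k by auto
  define B where "B = N 0"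
  have BA: "B \<subseteq> A" by (auto simp: B_def N_def)
  have cB: "card B = r - 3" using CN[OF k0] card[OF k0] single[OF k0] by (simp add: B_def)
  have Sd: "S - B = (A - B) \<union> s ` {..<k}" using s A(3) BA by (auto simp: bij_betw_def)
  have BP: "{b, s i} \<in> E" if "b \<in> B" "i < k" for b i using NN[OF that(2)] that(1) by (auto simp: B_def N_def)
  have AP: "{a, s i} \<notin> E" if "a \<in> A - B" "i < k" for a i using NN[OF that(2)] that(1) by (auto simp: B_def N_def)
  have PP: "{s i, s j} \<notin> E" if "i < k" "j < k" for i j
  proof
    assume e: "{s i, s j} \<in> E"
    then have "i \<noteq> j" using edge_irrefl[of "s i"] by auto
    have e': "{s j, s i} \<in> E" using e by (simp add: insert_commute)
    have "card B + card {i, j} \<noteq> r - 1"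
      using BA that BP e e' by (intro K) auto
    then show False using cB \<open>i \<noteq> j\<close> r3 by simp
  qed
  have AB: "x = y" if "x \<in> A - B" "y \<in> A - B" for x y
  proof -
    have "card (A - B) = 1" using BA cB A(2) finA r3 by (simp add: card_Diff_subset finite_subset)
    then obtain z where "A - B = {z}" by (rule card_1_singletonE)
    then show ?thesis using that by simp
  qed
  show ?thesis
  proof (intro exI[of _ B] conjI ballI)
    show "B \<subseteq> S" using BA A(3) by auto
    show "clique B E" using A(1) BA smaller_clique by blast
    show "{b, x} \<in> E" if "b \<in> B" "x \<in> S - B" for b x
    proof (cases "x \<in> A")
      case True
      then have "b \<in> A" "b \<noteq> x" using that BA by auto
      then show ?thesis using A(1) True by (simp add: clique_def)
    qed (use that BP Sd in auto)
    show "{x, y} \<notin> E" if "x \<in> S - B" "y \<in> S - B" for x y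
      using that unfolding Sd
    proof (elim UnE imageE)
      assume "x \<in> A - B" "y \<in> A - B"
      then show ?thesis using AB[of x y] edge_irrefl by auto
    qed (use AP PP AP[unfolded insert_commute[of _ "s _"]] in auto)
  qed (rule cB)
qed

end

definition splits :: "'a set set \<Rightarrow> 'a set \<Rightarrow> 'a set \<Rightarrow> bool" where
  "splits E B S \<longleftrightarrow> B \<subseteq> S \<and> clique B E \<and> (\<forall>b\<in>B. \<forall>x\<in>S - B. {b, x} \<in> E) \<and>
    (\<forall>x\<in>S - B. \<forall>y\<in>S - B. {x, y} \<notin> E)"

text \<open>Label the vertices of each member outside \<open>A\<close> and keep the most frequent
  adjacency type. By \<open>ramsey_labels\<close>, either r members have pairwise adjacent vertices
  at one label, which are distinct and so form a K_r, or two members satisfy the hypotheses of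
  \<open>homogeneous_pair_join\<close>.\<close>

theorem sunflower_splits:
  assumes k: "k = 2 \<or> k = 3"
  shows "\<exists>M. \<forall>(V :: 'a set) E F A G. set_system r (r - 2 + k) V E F \<longrightarrow> clique A E \<longrightarrow> card A = r - 2 \<longrightarrow>
    G \<subseteq> F \<longrightarrow> M \<le> card G \<longrightarrow> (\<forall>S\<in>G. A \<subseteq> S) \<longrightarrow> pairwise (\<lambda>S S'. S \<inter> S' = A) G \<longrightarrow>
    (\<exists>S\<in>F. \<exists>B. card B = r - 3 \<and> splits E B S)"
proof -
  obtain R where R: "\<forall>(G :: 'a set set) (c :: nat \<Rightarrow> 'a set \<Rightarrow> 'a set \<Rightarrow> bool). finite G \<longrightarrow> R \<le> card G \<longrightarrow>
     (\<forall>i x y. c i x y \<longrightarrow> c i y x) \<longrightarrow>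
     (\<exists>i<k. \<exists>X\<subseteq>G. card X = r \<and> (\<forall>x\<in>X. \<forall>y\<in>X. x \<noteq> y \<longrightarrow> c i x y)) \<or>
     (\<exists>x\<in>G. \<exists>y\<in>G. x \<noteq> y \<and> (\<forall>i<k. \<not> c i x y))"
    using ramsey_labels[where 'b = "'a set", of k r] ..
  \<comment> \<open>Bounds the number of types: relations between \<open>A\<close> and the labels,
    and among the labels.\<close>
  define \<tau> where "\<tau> = 2 ^ ((r - 2) * k) * 2 ^ (k * k) * (1::nat)"
  have \<tau>: "\<tau> > 0" by (simp add: \<tau>_def)
  show ?thesis
  proof (intro exI[of _ "\<tau> * (R + 1)"] allI impI)
    fix V :: "'a set" and E F A G
    assume sys: "set_system r (r - 2 + k) V E F" and A: "clique A E" "card A = r - 2"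
      and G: "G \<subseteq> F" "\<tau> * (R + 1) \<le> card G" "\<forall>S\<in>G. A \<subseteq> S" "pairwise (\<lambda>S S'. S \<inter> S' = A) G"
    interpret set_system r "r - 2 + k" V E F by (rule sys)
    have finG: "finite G" using finF G(1) finite_subset by blast
    have neG: "G \<noteq> {}" using G(2) \<tau> by auto
    then obtain S0 where "S0 \<in> G" by blast
    then have "A \<subseteq> V" using G(1,3) FV[of S0] by auto
    then have finA: "finite A" by (rule fin)
    have "\<forall>S\<in>G. \<exists>h. bij_betw h {..<k} (S - A)"
    proof
      fix S assume S: "S \<in> G"
      then have "card (S - A) = k" "finite (S - A)"
        using G(1,3) Ft[of S] A(2) finA fin[OF FV[of S]] by (auto simp: card_Diff_subset)
      then show "\<exists>h. bij_betw h {..<k} (S - A)"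
        using ex_bij_betw_nat_finite[of "S - A"] by (simp add: atLeast0LessThan)
    qed
    from bchoice[OF this] obtain lb where lb: "\<forall>S\<in>G. bij_betw (lb S) {..<k} (S - A)" ..
    have lbS: "lb S i \<in> S - A" if "S \<in> G" "i < k" for S i
      using bspec[OF lb that(1)] that(2) by (auto simp: bij_betw_def)
    define ty where "ty S = ({p \<in> A \<times> {..<k}. {fst p, lb S (snd p)} \<in> E},
      {p \<in> {..<k} \<times> {..<k}. {lb S (fst p), lb S (snd p)} \<in> E})" for S
    have "card (ty ` G) \<le> card (Pow (A \<times> {..<k}) \<times> Pow ({..<k} \<times> {..<k}))"
      by (intro card_mono) (auto simp: ty_def finA)
    also have "\<dots> = \<tau>" using finA A(2) by (simp add: card_cartesian_product card_Pow \<tau>_def)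
    finally obtain a where a: "a \<in> ty ` G" "card G \<le> \<tau> * card {S \<in> G. ty S = a}"
      using pigeonhole_fiber[OF finG neG] by blast
    define G' where "G' = {S \<in> G. ty S = a}"
    have "\<tau> * (R + 1) \<le> \<tau> * card G'" using a(2) G(2) by (simp add: G'_def)
    then have "R + 1 \<le> card G'" using \<tau> by (simp only: mult_le_cancel1)
    then have R': "R \<le> card G'" by simp
    have G': "G' \<subseteq> G" "finite G'" using finG by (auto simp: G'_def)
    define c where "c i S S' \<longleftrightarrow> {lb S i, lb S' i} \<in> E" for i S S'
    have csym: "\<forall>i x y. c i x y \<longrightarrow> c i y x" by (simp add: c_def insert_commute)
    have pw: "S \<inter> S' = A" if "S \<in> G" "S' \<in> G" "S \<noteq> S'" for S S' using G(4) that by (auto simp: pairwise_def)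
    from R[rule_format, OF G'(2) R', of c] csym
    have "(\<exists>i<k. \<exists>X\<subseteq>G'. card X = r \<and> (\<forall>x\<in>X. \<forall>y\<in>X. x \<noteq> y \<longrightarrow> c i x y)) \<or>
     (\<exists>x\<in>G'. \<exists>y\<in>G'. x \<noteq> y \<and> (\<forall>i<k. \<not> c i x y))" by simp
    then show "\<exists>S\<in>F. \<exists>B. card B = r - 3 \<and> splits E B S"
    proof
      assume "\<exists>i<k. \<exists>X\<subseteq>G'. card X = r \<and> (\<forall>x\<in>X. \<forall>y\<in>X. x \<noteq> y \<longrightarrow> c i x y)"
      then obtain i X where X: "i < k" "X \<subseteq> G'" "card X = r" "\<forall>x\<in>X. \<forall>y\<in>X. x \<noteq> y \<longrightarrow> c i x y" by blast
      have inj: "inj_on (\<lambda>S. lb S i) X"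
      proof (rule inj_onI, rule ccontr)
        fix S S' assume h: "S \<in> X" "S' \<in> X" "lb S i = lb S' i" "S \<noteq> S'"
        then have "S \<in> G" "S' \<in> G" using X(2) G'(1) by auto
        then show False using pw[of S S'] lbS[of S i] lbS[of S' i] h X(1) by auto
      qed
      have "clique ((\<lambda>S. lb S i) ` X) E" using X(4) by (auto simp: clique_def c_def)
      moreover have "(\<lambda>S. lb S i) ` X \<subseteq> V"
      proof
        fix v assume "v \<in> (\<lambda>S. lb S i) ` X"
        then obtain S where "S \<in> X" "v = lb S i" by blast
        then show "v \<in> V" using lbS[of S i] X(1,2) G'(1) G(1) FV[of S] by blast
      qed
      moreover have "card ((\<lambda>S. lb S i) ` X) = r" using inj X(3) by (simp add: card_image)
      ultimately have False using no_Kr by blast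
      then show ?thesis ..
    next
      assume "\<exists>x\<in>G'. \<exists>y\<in>G'. x \<noteq> y \<and> (\<forall>i<k. \<not> c i x y)"
      then obtain S S' where S: "S \<in> G'" "S' \<in> G'" "S \<noteq> S'" "\<forall>i<k. \<not> c i S S'" by blast
      have SG: "S \<in> G" "S' \<in> G" using S G' by auto
      have ty: "ty S = ty S'" using S by (simp add: G'_def)
      have "\<exists>B\<subseteq>S. card B = r - 3 \<and> clique B E \<and> (\<forall>b\<in>B. \<forall>x\<in>S - B. {b, x} \<in> E) \<and>
        (\<forall>x\<in>S - B. \<forall>y\<in>S - B. {x, y} \<notin> E)"
      proof (rule homogeneous_pair_join[where s = "lb S" and u = "lb S'" and S' = S' and A = A and k = k])
        show "bij_betw (lb S) {..<k} (S - A)" "bij_betw (lb S') {..<k} (S' - A)" using lb SG by auto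
        show "S \<inter> S' = A" using pw SG S(3) by blast
        show "{a, lb S i} \<in> E \<longleftrightarrow> {a, lb S' i} \<in> E" if "a \<in> A" "i < k" for a i
        proof -
          have "(a, i) \<in> fst (ty S) \<longleftrightarrow> (a, i) \<in> fst (ty S')" using ty by simp
          then show ?thesis using that by (simp add: ty_def)
        qed
        show "{lb S i, lb S j} \<in> E \<longleftrightarrow> {lb S' i, lb S' j} \<in> E" if "i < k" "j < k" for i j
        proof -
          have "(i, j) \<in> snd (ty S) \<longleftrightarrow> (i, j) \<in> snd (ty S')" using ty by simp
          then show ?thesis using that by (simp add: ty_def)
        qed
        show "{lb S i, lb S' i} \<notin> E" if "i < k" for i using S(4) that by (simp add: c_def)
      qed (use A SG G(1) k in auto)
      then show ?thesis using SG G(1) unfolding splits_def by blast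
    qed
  qed
qed

section \<open>One split member determines the whole graph\<close>

definition vadj :: "'a set \<Rightarrow> 'a set set \<Rightarrow> 'a \<Rightarrow> 'a \<Rightarrow> bool" where
  "vadj V E x y \<longleftrightarrow> x \<in> V \<and> y \<in> V \<and> {x, y} \<in> E"

context set_system begin

context
  fixes S B assumes SF: "S \<in> F" and cB: "card B = r - 3" and sp: "splits E B S"
begin

lemma B_sub: "B \<subseteq> S" "B \<subseteq> V" "finite B"
  using sp FV[OF SF] fin[of B] by (auto simp: splits_def)

text \<open>A clique has at most one vertex in the independent set S - B, so size r-2 forces it to
  contain all r-3 vertices of \<open>B\<close>. Domination and intersections, which are stated
  through such cliques, thereby pass \<open>B\<close> on to all vertices and all members.\<close>

lemma clique_contains_B:
  assumes C: "C \<subseteq> S" "clique C E" "card C = r - 2" shows "B \<subseteq> C"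
proof -
  have finC: "finite C" using C(1) FV[OF SF] fin by blast
  have "card (C - B) \<le> 1"
  proof (rule ccontr)
    assume "\<not> ?thesis"
    then obtain x y where xy: "x \<in> C - B" "y \<in> C - B" "x \<noteq> y"
      using card_le_Suc0_iff_eq[of "C - B"] finC by auto
    then show False using C sp unfolding clique_def splits_def by blast
  qed
  moreover have "card C = card (C \<inter> B) + card (C - B)"
    using finC by (metis Int_Diff_Un Int_Diff_disjoint card_Un_disjoint finite_Diff finite_Int)
  ultimately have "card B \<le> card (C \<inter> B)" using C(3) cB r3 by linarith
  then have "C \<inter> B = B" using B_sub by (intro card_seteq) auto
  then show ?thesis by blast
qed

lemma B_complete: assumes "x \<in> V - B" "b \<in> B" shows "{b, x} \<in> E"
proof (cases "x \<in> S")
  case True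
  then show ?thesis using sp assms by (auto simp: splits_def)
next
  case False
  then obtain C where "C \<subseteq> S" "clique C E" "card C = r - 2" "\<forall>c\<in>C. {x, c} \<in> E" using dom[OF SF] assms by blast
  then show ?thesis using clique_contains_B[of C] assms by (auto simp: insert_commute)
qed

lemma B_in_F: assumes "T \<in> F" shows "B \<subseteq> T"
proof (cases "T = S")
  case False
  then obtain C where "C \<subseteq> S \<inter> T" "clique C E" "card C = r - 2" using inter[OF SF assms] by blast
  then show ?thesis using clique_contains_B[of C] by blast
qed (use B_sub in auto)

lemma clique_Un_B:
  assumes "K \<subseteq> V - B" "clique K E" shows "clique (B \<union> K) E" "card (B \<union> K) = r - 3 + card K"
proof -
  have "clique B E" using sp by (simp add: splits_def)
  then show "clique (B \<union> K) E" using assms B_complete by (intro clique_Un) blast+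
  have "finite K" using assms(1) fin by blast
  then have "card (B \<union> K) = card B + card K" using B_sub assms by (intro card_Un_disjoint) auto
  then show "card (B \<union> K) = r - 3 + card K" using cB by simp
qed

lemma vadj_triangle_free: "triangle_free (vadj (V - B) E)"
proof
  show "vadj (V - B) E y x" if "vadj (V - B) E x y" for x y using that by (simp add: vadj_def insert_commute)
  show "\<not> vadj (V - B) E x z" if h: "vadj (V - B) E x y" "vadj (V - B) E y z" for x y z
  proof
    assume h': "vadj (V - B) E x z"
    have d: "x \<noteq> y" "y \<noteq> z" "x \<noteq> z" using h h' edge_in by (auto simp: vadj_def)
    have "clique {x, y, z} E" using h h' by (auto simp: vadj_def clique_def insert_commute)
    moreover have "{x, y, z} \<subseteq> V - B" using h h' by (auto simp: vadj_def)
    ultimately have "clique (B \<union> {x, y, z}) E" "card (B \<union> {x, y, z}) = r - 3 + card {x, y, z}"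
      using clique_Un_B by blast+
    moreover have "card {x, y, z} = 3" using d by simp
    ultimately show False using no_Kr[of "B \<union> {x, y, z}"] r3 B_sub \<open>{x, y, z} \<subseteq> V - B\<close> by auto
  qed
qed

interpretation H: triangle_free "vadj (V - B) E" by (rule vadj_triangle_free)

lemma F_mis: assumes "T \<in> F" shows "T - B \<in> H.mis (V - B) (t - (r - 3))"
  unfolding H.mis_def
proof (intro CollectI conjI ballI)
  have BT: "B \<subseteq> T" "T \<subseteq> V" "finite T" using B_in_F[OF assms] FV[OF assms] fin by auto
  show "T - B \<subseteq> V - B" "finite (T - B)" using BT by auto
  show "card (T - B) = t - (r - 3)" using BT B_sub Ft[OF assms] cB by (simp add: card_Diff_subset)
  show "\<not> vadj (V - B) E x y" if xy: "x \<in> T - B" "y \<in> T - B" for x y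
  proof
    assume h: "vadj (V - B) E x y"
    then have "x \<noteq> y" using edge_in by (auto simp: vadj_def)
    have "clique {x, y} E" using h by (auto simp: vadj_def clique_def insert_commute)
    then have "clique (B \<union> {x, y}) E" "card (B \<union> {x, y}) = r - 3 + card {x, y}"
      using clique_Un_B[of "{x, y}"] h by (auto simp: vadj_def)
    then show False using free[OF assms, of "B \<union> {x, y}"] xy BT r3 \<open>x \<noteq> y\<close> by auto
  qed
  show "\<exists>y\<in>T - B. vadj (V - B) E x y" if x: "x \<in> V - B - (T - B)" for x
  proof -
    obtain C where C: "C \<subseteq> T" "clique C E" "card C = r - 2" "\<forall>c\<in>C. {x, c} \<in> E" using dom[OF assms, of x] x by blast
    have "\<not> C \<subseteq> B" using card_mono[OF B_sub(3), of C] C(3) cB r3 by auto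
    then obtain y where "y \<in> C" "y \<notin> B" by blast
    then have "y \<in> T - B" "vadj (V - B) E x y" using C x BT by (auto simp: vadj_def)
    then show ?thesis by blast
  qed
qed

lemma F_inter: assumes "T \<in> F" "T' \<in> F" "T \<noteq> T'" shows "(T - B) \<inter> (T' - B) \<noteq> {}"
proof -
  obtain C where C: "C \<subseteq> T \<inter> T'" "card C = r - 2" using inter[OF assms] by blast
  have "\<not> C \<subseteq> B" using card_mono[OF B_sub(3), of C] C(2) cB r3 by auto
  then show ?thesis using C by blast
qed

lemma F_inj: "inj_on (\<lambda>T. T - B) F"
  by (rule inj_onI) (use B_in_F in blast)

text \<open>The last term is twice the number of edges inside \<open>B\<close>. For r = 3 the
  truncated \<open>r - 4\<close> does no harm, as its factor \<open>r - 3\<close> is 0.\<close>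

lemma edge_count: "2 * card E = H.degsum (V - B) + 2 * (r - 3) * card (V - B) + (r - 3) * (r - 4)"
proof -
  let ?d = "\<lambda>x. card {y \<in> V. {x, y} \<in> E}"
  have V: "V = (V - B) \<union> B" using B_sub by auto
  have dV: "?d x = H.deg (V - B) x + (r - 3)" if "x \<in> V - B" for x
  proof -
    have "{y \<in> V. {x, y} \<in> E} = {y \<in> V - B. {x, y} \<in> E} \<union> B"
      using B_complete[OF that] B_sub by (auto simp: insert_commute)
    moreover have "card ({y \<in> V - B. {x, y} \<in> E} \<union> B) = card {y \<in> V - B. {x, y} \<in> E} + card B"
      using finV B_sub by (intro card_Un_disjoint) auto
    moreover have "H.nbrs (V - B) x = {y \<in> V - B. {x, y} \<in> E}" using that by (auto simp: H.nbrs_def vadj_def)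
    ultimately show ?thesis using cB by (simp add: H.deg_def)
  qed
  have dB: "?d b = card (V - B) + (r - 4)" if "b \<in> B" for b
  proof -
    have "{y \<in> V. {b, y} \<in> E} = (V - B) \<union> (B - {b})"
      using B_complete[OF _ that] B_sub sp that edge_irrefl[of b] by (auto simp: splits_def clique_def)
    moreover have "card ((V - B) \<union> (B - {b})) = card (V - B) + card (B - {b})"
      using finV B_sub by (intro card_Un_disjoint) auto
    ultimately show ?thesis using that cB B_sub by simp
  qed
  have "2 * card E = (\<Sum>x\<in>V. ?d x)" using sum_nbrs_eq[OF finV EV] by simp
  also have "\<dots> = (\<Sum>x\<in>V - B. ?d x) + (\<Sum>x\<in>B. ?d x)"
    by (subst V, rule sum.union_disjoint) (use finV B_sub in auto)
  also have "(\<Sum>x\<in>V - B. ?d x) = (\<Sum>x\<in>V - B. H.deg (V - B) x + (r - 3))" by (rule sum.cong) (auto simp: dV)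
  also have "\<dots> = H.degsum (V - B) + card (V - B) * (r - 3)" by (simp add: H.degsum_def sum.distrib)
  also have "(\<Sum>x\<in>B. ?d x) = (r - 3) * (card (V - B) + (r - 4))" using dB cB by simp
  finally show ?thesis by (simp add: algebra_simps)
qed

end

lemma r3_splits: assumes "r = 3" "S \<in> F" shows "splits E {} S"
proof -
  have "{x, y} \<notin> E" if "x \<in> S" "y \<in> S" for x y
  proof
    assume e: "{x, y} \<in> E"
    then have "x \<noteq> y" using edge_in by blast
    moreover have "clique {x, y} E" using e by (auto simp: clique_def insert_commute)
    ultimately show False using free[OF assms(2), of "{x, y}"] that assms(1) by simp
  qed
  then show ?thesis by (auto simp: splits_def)
qed

end

subsection \<open>Lower bounds\<close>

context triangle_free begin

section \<open>Intersecting families of maximal independent sets\<close>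

lemma popular_vertex:
  assumes V: "finite V" and F: "F \<subseteq> mis V (Suc k)" "F \<noteq> {}"
    and int: "\<And>X Y. X \<in> F \<Longrightarrow> Y \<in> F \<Longrightarrow> X \<noteq> Y \<Longrightarrow> X \<inter> Y \<noteq> {}"
  obtains y where "y \<in> V" "card F \<le> Suc k * card {X \<in> F. y \<in> X}"
proof -
  have finF: "finite F" using F finite_mis[OF V] finite_subset by blast
  obtain S where S: "S \<in> F" using F by blast
  then have cS: "card S = Suc k" "finite S" "S \<subseteq> V" using F by (auto simp: mis_def)
  have "\<forall>X\<in>F. \<exists>y. y \<in> S \<and> y \<in> X"
  proof
    fix X assume "X \<in> F"
    show "\<exists>y. y \<in> S \<and> y \<in> X"
    proof (cases "X = S")
      case True
      have "S \<noteq> {}" using cS by auto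
      then show ?thesis using True by blast
    qed (use int[OF S \<open>X \<in> F\<close>] in blast)
  qed
  from bchoice[OF this] obtain f where f: "\<forall>X\<in>F. f X \<in> S \<and> f X \<in> X" ..
  have "card (f ` F) \<le> Suc k" using f cS card_mono[of S "f ` F"] by auto
  from pigeonhole_fiber[OF finF F(2) this] obtain y where y: "y \<in> f ` F" "card F \<le> Suc k * card {X \<in> F. f X = y}" by blast
  have "card {X \<in> F. f X = y} \<le> card {X \<in> F. y \<in> X}" using f finF by (intro card_mono) auto
  then have "Suc k * card {X \<in> F. f X = y} \<le> Suc k * card {X \<in> F. y \<in> X}" by (rule mult_le_mono2)
  then have "card F \<le> Suc k * card {X \<in> F. y \<in> X}" using y(2) by linarith
  moreover have "y \<in> V" using y(1) f cS by blast
  ultimately show thesis using that by blast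
qed

lemma card_containing_le:
  assumes V: "finite V" and F: "F \<subseteq> mis V (Suc k)"
  shows "card {X \<in> F. y \<in> X} \<le> card (mis (away V y) k)"
proof -
  have "card {X \<in> F. y \<in> X} \<le> card {P \<in> mis V (Suc k). y \<in> P}"
    using F finite_mis[OF V] by (intro card_mono) auto
  also have "\<dots> \<le> card (mis (away V y) k)" by (rule card_mis_containing[OF V])
  finally show ?thesis .
qed

text \<open>A vertex \<open>y\<close> of at least a third of the members proves to lie in all of
  them, and the remaining pairs are disjoint. Each of their 2s vertices, not being adjacent to
  \<open>y\<close>, has a neighbour in each of the other s-1 pairs, as in a complete bipartite graph
  minus a perfect matching.\<close>

lemma intersecting_triples:
  assumes V: "finite V" and F: "F \<subseteq> mis V 3" and big: "60 < card F"
    and int: "\<And>X Y. X \<in> F \<Longrightarrow> Y \<in> F \<Longrightarrow> X \<noteq> Y \<Longrightarrow> X \<inter> Y \<noteq> {}"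
  shows "2 * (card F * (card F - 1)) \<le> degsum V" "2 * card F + 1 \<le> card V"
proof -
  have F': "F \<subseteq> mis V (Suc 2)" using F by (simp add: eval_nat_numeral)
  have neF: "F \<noteq> {}" using big by auto
  have finF: "finite F" using F finite_mis[OF V] finite_subset by blast
  obtain y where y: "y \<in> V" "card F \<le> Suc 2 * card {X \<in> F. y \<in> X}" by (rule popular_vertex[OF V F' neF int])
  define Q where "Q = (\<lambda>X. X - {y}) ` {X \<in> F. y \<in> X}"
  have Xq: "finite X \<and> card X = 3 \<and> X \<subseteq> V" if "X \<in> F" for X using that F by (auto simp: mis_def)
  have Q: "finite p \<and> card p = 2" if "p \<in> Q" for p using that Xq by (auto simp: Q_def)
  have Qmis: "insert y p \<in> F" "y \<notin> p" if "p \<in> Q" for p using that by (auto simp: Q_def insert_absorb)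
  have inF: "p \<in> Q" if "insert y p \<in> F" "y \<notin> p" for p
    unfolding Q_def using that by (intro image_eqI[of _ _ "insert y p"]) auto
  have cQ: "card Q = card {X \<in> F. y \<in> X}" unfolding Q_def by (rule card_image) (rule inj_onI, blast)
  have deg2: "card {p \<in> Q. u \<in> p} \<le> 2" if "u \<noteq> y" for u
  proof -
    have "card {p \<in> Q. u \<in> p} \<le> card {t \<in> mis V 3. y \<in> t \<and> u \<in> t}"
    proof (rule card_inj_on_le[where f = "insert y"])
      show "inj_on (insert y) {p \<in> Q. u \<in> p}" by (rule inj_onI) (use Qmis in \<open>metis (no_types, lifting) mem_Collect_eq insert_ident\<close>)
    qed (use Qmis F finite_mis[OF V] in auto)
    also have "\<dots> \<le> 2" using that by (intro codegree_le2[OF V]) auto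
    finally show ?thesis .
  qed
  have finQ: "finite Q" unfolding Q_def using finF by auto
  \<comment> \<open>Otherwise ten vertices, each in at most two pairs, meet all pairs; then there
    are at most 20 pairs and at most 60 members.\<close>
  have "\<exists>D\<subseteq>Q. finite D \<and> card D = 5 \<and> pairwise disjnt D"
  proof (rule ccontr)
    assume "\<not> ?thesis"
    then obtain U where U: "finite U" "card U \<le> 5 * 2" "\<forall>p\<in>Q. p \<inter> U \<noteq> {}"
      using disjoint_or_cover[of Q 2 5] Q by auto
    have "Q \<subseteq> (\<Union>u\<in>U - {y}. {p \<in> Q. u \<in> p})" using U(3) Qmis(2) by blast
    then have "card Q \<le> card (\<Union>u\<in>U - {y}. {p \<in> Q. u \<in> p})" using U(1) finQ by (intro card_mono) auto
    also have "\<dots> \<le> (\<Sum>u\<in>U - {y}. card {p \<in> Q. u \<in> p})" using U(1) by (intro card_UN_le) auto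
    also have "\<dots> \<le> (\<Sum>u\<in>U - {y}. 2)" by (intro sum_mono deg2) auto
    also have "\<dots> \<le> card U * 2" using U(1) by (simp add: card_Diff1_le)
    finally show False using U(2) y(2) cQ big by simp
  qed
  then obtain D where D: "D \<subseteq> Q" "finite D" "card D = 5" "pairwise disjnt D" by blast
  have hit: "card {p \<in> D. p \<inter> X \<noteq> {}} \<le> card X" if "finite X" for X
  proof -
    have "\<forall>p\<in>{p \<in> D. p \<inter> X \<noteq> {}}. \<exists>x. x \<in> p \<and> x \<in> X" by blast
    from bchoice[OF this] obtain g where g: "\<forall>p\<in>{p \<in> D. p \<inter> X \<noteq> {}}. g p \<in> p \<and> g p \<in> X" ..
    show ?thesis
    proof (rule card_inj_on_le[where f = g])
      show "inj_on g {p \<in> D. p \<inter> X \<noteq> {}}"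
      proof (rule inj_onI, rule ccontr)
        fix p q assume h: "p \<in> {p \<in> D. p \<inter> X \<noteq> {}}" "q \<in> {p \<in> D. p \<inter> X \<noteq> {}}" "g p = g q" "p \<noteq> q"
        then have "disjnt p q" using D(4) by (auto simp: pairwise_def)
        moreover have "g p \<in> p" "g p \<in> q" using g h by metis+
        ultimately show False by (auto simp: disjnt_iff)
      qed
    qed (use g that in auto)
  qed
  have miss: "\<exists>p\<in>D. p \<inter> X = {}" if "finite X" "card X \<le> 4" for X
  proof (rule ccontr)
    assume "\<not> ?thesis"
    then have "{p \<in> D. p \<inter> X \<noteq> {}} = D" by auto
    then show False using hit[OF that(1)] that(2) D(3) by simp
  qed
  \<comment> \<open>A member avoiding \<open>y\<close> would need to meet five disjoint pairs with
    three vertices.\<close>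
  have all_y: "y \<in> X" if X: "X \<in> F" for X
  proof (rule ccontr)
    assume nX: "y \<notin> X"
    obtain p where p: "p \<in> D" "p \<inter> X = {}" using miss[of X] Xq[OF X] by auto
    then have "insert y p \<in> F" using Qmis(1) D(1) by blast
    moreover have "insert y p \<noteq> X" using nX by auto
    ultimately show False using int[OF X] p nX by blast
  qed
  then have "{X \<in> F. y \<in> X} = F" by auto
  then have cQF: "card Q = card F" using cQ by simp
  have dom: "\<exists>z\<in>q. adj x z" if "q \<in> Q" "x \<in> V" "x \<notin> q" "x \<noteq> y" "\<not> adj x y" for q x
  proof -
    have "insert y q \<in> mis V 3" using Qmis(1)[OF that(1)] F by blast
    then have "\<forall>x\<in>V - insert y q. \<exists>z\<in>insert y q. adj x z" by (simp add: mis_def)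
    then show ?thesis using that by blast
  qed
  have indep: "\<not> adj x z" if "q \<in> Q" "x \<in> insert y q" "z \<in> insert y q" for q x z
  proof -
    have "insert y q \<in> mis V 3" using Qmis(1)[OF that(1)] F by blast
    then have "\<forall>x\<in>insert y q. \<forall>z\<in>insert y q. \<not> adj x z" unfolding mis_def by blast
    then show ?thesis using that by blast
  qed
  have QV: "q \<subseteq> V" if "q \<in> Q" for q using Xq[OF Qmis(1)[OF that]] by auto
  have far: "adj c a"
    if h: "{a, v} \<in> Q" "{a, v'} \<in> Q" "v \<noteq> v'" "q \<in> Q" "c \<in> q" "c \<notin> {a, v, v'}" for a v v' q c
  proof -
    have c: "c \<in> V" "c \<noteq> y" "\<not> adj c y" using QV[OF h(4)] h(4,5) Qmis(2) indep[OF h(4)] by auto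
    have "v \<in> V" "v \<noteq> y" "\<not> adj v y" "\<not> adj v a" "v \<noteq> a"
      using QV[OF h(1)] Qmis(2)[OF h(1)] indep[OF h(1)] Q[OF h(1)] by auto
    then have "adj v v'" using dom[OF h(2), of v] h(3) by auto
    moreover have "adj c a \<or> adj c v" "adj c a \<or> adj c v'" using dom[OF h(1), of c] dom[OF h(2), of c] c h(6) by auto
    ultimately show ?thesis using tri by blast
  qed
  \<comment> \<open>If two pairs share \<open>a\<close>, then all vertices of pairs other than
    \<open>a\<close>, \<open>v\<close>, \<open>v'\<close> are adjacent to \<open>a\<close>. At least
    two of the five disjoint pairs miss {a, v, v'}; an edge between them closes a triangle with
    \<open>a\<close>.\<close>
  have disj: "p \<inter> q = {}" if pq: "p \<in> Q" "q \<in> Q" "p \<noteq> q" for p q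
  proof (rule ccontr)
    assume "p \<inter> q \<noteq> {}"
    then obtain a where a: "a \<in> p" "a \<in> q" by blast
    have ex: "\<exists>v. p = {a, v}" if h: "a \<in> p" "p \<in> Q" for p
    proof -
      have "card (p - {a}) = 1" using Q[OF h(2)] h(1) by simp
      then obtain v where "p - {a} = {v}" by (rule card_1_singletonE)
      then have "p = {a, v}" using h(1) by blast
      then show ?thesis ..
    qed
    obtain v v' where v: "p = {a, v}" "q = {a, v'}" using ex[OF a(1) pq(1)] ex[OF a(2) pq(2)] by blast
    then have vv: "v \<noteq> v'" using pq(3) by auto
    have c3: "card {a, v, v'} \<le> 3" by (simp add: card_insert_if)
    then obtain q1 where q1: "q1 \<in> D" "q1 \<inter> {a, v, v'} = {}" using miss[of "{a, v, v'}"] by auto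
    obtain c d where cd: "q1 = {c, d}" using Q[of q1] q1 D(1) by (auto simp: card_2_iff)
    have "\<exists>q2\<in>D. q2 \<noteq> q1 \<and> q2 \<inter> {a, v, v'} = {}"
    proof (rule ccontr)
      assume "\<not> ?thesis"
      then have "D - {q1} \<subseteq> {p \<in> D. p \<inter> {a, v, v'} \<noteq> {}}" by auto
      then have "card (D - {q1}) \<le> card {p \<in> D. p \<inter> {a, v, v'} \<noteq> {}}" using D(2) by (intro card_mono) auto
      also have "\<dots> \<le> card {a, v, v'}" by (rule hit) simp
      also have "\<dots> \<le> 3" by (rule c3)
      finally show False using D q1 by simp
    qed
    then obtain q2 where q2: "q2 \<in> D" "q2 \<noteq> q1" "q2 \<inter> {a, v, v'} = {}" by blast
    have qQ: "q1 \<in> Q" "q2 \<in> Q" using q1 q2 D by auto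
    have "disjnt q1 q2" using D(4) q1 q2 by (auto simp: pairwise_def)
    then have "c \<notin> q2" using cd by (auto simp: disjnt_iff)
    have "c \<in> V" "c \<noteq> y" "\<not> adj c y" using QV[OF qQ(1)] Qmis(2)[OF qQ(1)] indep[OF qQ(1)] cd by auto
    then obtain e where e: "e \<in> q2" "adj c e" using dom[OF qQ(2), of c] \<open>c \<notin> q2\<close> by blast
    have "adj c a" using far[of a v v' q1 c] pq v vv qQ cd q1 by auto
    moreover have "adj e a" using far[of a v v' q2 e] pq v vv qQ e q2 by auto
    ultimately show False using e(2) tri by blast
  qed
  have dge: "card F - 1 \<le> deg V x" if x: "x \<in> p" "p \<in> Q" for x p
  proof -
    have xx: "x \<in> V" "x \<noteq> y" "\<not> adj x y" using QV[OF x(2)] Qmis(2)[OF x(2)] indep[OF x(2)] x by auto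
    have "\<forall>q\<in>Q - {p}. \<exists>z. z \<in> q \<and> adj x z"
    proof
      fix q assume q: "q \<in> Q - {p}"
      then have "x \<notin> q" using disj[OF x(2), of q] x by auto
      then show "\<exists>z. z \<in> q \<and> adj x z" using dom[of q x] q xx by blast
    qed
    from bchoice[OF this] obtain g where g: "\<forall>q\<in>Q - {p}. g q \<in> q \<and> adj x (g q)" ..
    have "card (Q - {p}) \<le> card (nbrs V x)"
    proof (rule card_inj_on_le[where f = g])
      show "inj_on g (Q - {p})"
      proof (rule inj_onI, rule ccontr)
        fix q q' assume h: "q \<in> Q - {p}" "q' \<in> Q - {p}" "g q = g q'" "q \<noteq> q'"
        then have "g q \<in> q \<inter> q'" using g by (metis IntI)
        then show False using disj[of q q'] h by auto
      qed
      show "g ` (Q - {p}) \<subseteq> nbrs V x" using g QV unfolding nbrs_def by blast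
    qed (use V in \<open>auto simp: nbrs_def\<close>)
    then show ?thesis using x cQF finQ by (simp add: deg_def)
  qed
  have UQ: "\<Union>Q \<subseteq> V - {y}" using QV Qmis(2) by blast
  have cU: "card (\<Union>Q) = 2 * card F"
  proof -
    have "card (\<Union>Q) = (\<Sum>q\<in>Q. card q)"
      using Q disj by (intro card_Union_disjoint) (auto simp: pairwise_def disjnt_def)
    also have "\<dots> = 2 * card F" using Q cQF by simp
    finally show ?thesis .
  qed
  have "card (\<Union>Q) \<le> card (V - {y})" using UQ V by (intro card_mono) auto
  moreover have "card V > 0" using y(1) V by (auto simp: card_gt_0_iff)
  ultimately show "2 * card F + 1 \<le> card V" using cU y(1) V by simp
  have "card (\<Union>Q) * (card F - 1) \<le> (\<Sum>x\<in>\<Union>Q. deg V x)"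
    using sum_bounded_below[of "\<Union>Q" "card F - 1" "deg V"] dge by auto
  also have "\<dots> \<le> degsum V" unfolding degsum_def using UQ V by (intro sum_mono2) auto
  finally show "2 * (card F * (card F - 1)) \<le> degsum V" using cU by simp
qed

lemma card_mis_le_power: "finite V \<Longrightarrow> card (mis V k) \<le> card V ^ k"
proof -
  assume V: "finite V"
  have "mis V k \<subseteq> [V]\<^bsup>k\<^esup>" by (auto simp: mis_def nsets_def)
  then have "card (mis V k) \<le> card V choose k" using V by (metis card_mono card_nsets finite_imp_finite_nsets)
  also have "\<dots> \<le> card V ^ k" by (cases "k \<le> card V") (simp_all add: binomial_le_pow binomial_eq_0)
  finally show ?thesis .
qed

text \<open>If no vertex is common to all members, choose for each \<open>y\<close> a member
  \<open>f y\<close> avoiding it. Every member meets a fixed \<open>S\<close> in some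
  \<open>x\<close> and then \<open>f x\<close> in some other vertex, so 5 * 5 pairs cover the
  family. Members through a given pair are counted by triples, which makes s of order at most
  E^(2/3) and the case negligible.\<close>

lemma intersecting_5:
  assumes V: "finite V" and F: "F \<subseteq> mis V 5"
    and int: "\<And>X Y. X \<in> F \<Longrightarrow> Y \<in> F \<Longrightarrow> X \<noteq> Y \<Longrightarrow> X \<inter> Y \<noteq> {}"
  shows "(\<exists>y\<in>V. card F \<le> card (mis (away V y) 4)) \<or> card F ^ 3 \<le> 25 ^ 3 * (1024 * (degsum V)\<^sup>2 + 128 ^ 3)"
proof (cases "\<exists>y. \<forall>X\<in>F. y \<in> X")
  case True
  then obtain y where y: "\<forall>X\<in>F. y \<in> X" by blast
  show ?thesis
  proof (cases "F = {}")
    case False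
    then obtain X where "X \<in> F" by blast
    then have "y \<in> X" "X \<subseteq> V" using y F by (auto simp: mis_def)
    then have "y \<in> V" by blast
    moreover have "{X \<in> F. y \<in> X} = F" using y by auto
    moreover have "F \<subseteq> mis V (Suc 4)" using F by (simp add: eval_nat_numeral)
    ultimately show ?thesis using card_containing_le[OF V, of F 4 y] by auto
  qed simp
next
  case False
  then have ex: "\<forall>y. \<exists>X\<in>F. y \<notin> X" by blast
  then obtain f where f: "\<And>y. f y \<in> F \<and> y \<notin> f y" by metis
  have finF: "finite F" using F finite_mis[OF V] finite_subset by blast
  obtain S where S: "S \<in> F" using f by blast
  have c5: "finite X \<and> card X = 5 \<and> X \<noteq> {}" if "X \<in> F" for X using that F by (auto simp: mis_def)
  define B where "B = 1024 * (degsum V)\<^sup>2 + 128 ^ 3"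
  define m where "m x y = card {X \<in> F. x \<in> X \<and> y \<in> X}" for x y
  have m: "m x y ^ 3 \<le> B" if "x \<noteq> y" for x y
  proof -
    have "m x y \<le> card {P \<in> mis (away V x) 4. y \<in> P}"
      unfolding m_def
    proof (rule card_inj_on_le[where f = "\<lambda>P. P - {x}"])
      show "inj_on (\<lambda>P. P - {x}) {X \<in> F. x \<in> X \<and> y \<in> X}" by (rule inj_onI) blast
      show "finite {P \<in> mis (away V x) 4. y \<in> P}" using finite_mis[of "away V x" 4] V by (simp add: away_def)
      show "(\<lambda>P. P - {x}) ` {X \<in> F. x \<in> X \<and> y \<in> X} \<subseteq> {P \<in> mis (away V x) 4. y \<in> P}"
        using mis_link[of _ V 4 x] that F by (auto simp: eval_nat_numeral)
    qed
    also have "\<dots> \<le> card (mis (away (away V x) y) 3)"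
      using card_mis_containing[of "away V x" 3 y] V by (simp add: eval_nat_numeral away_def)
    finally have "m x y ^ 3 \<le> card (mis (away (away V x) y) 3) ^ 3" by (rule power_mono) simp
    also have "\<dots> \<le> 1024 * (degsum (away (away V x) y))\<^sup>2 + 128 ^ 3"
      using V by (intro card_mis_3_degsum) (simp add: away_def)
    also have "\<dots> \<le> B" unfolding B_def
      using degsum_mono[OF V, of "away (away V x) y"] by (simp add: away_def power_mono subset_iff)
    finally show ?thesis .
  qed
  have "F \<subseteq> (\<Union>x\<in>S. \<Union>y\<in>f x. {X \<in> F. x \<in> X \<and> y \<in> X})"
  proof
    fix X assume X: "X \<in> F"
    have hit: "X \<inter> Y \<noteq> {}" if "Y \<in> F" for Y using int[OF X that] c5[OF X] by auto
    obtain x where x: "x \<in> X" "x \<in> S" using hit[OF S] by blast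
    obtain y where "y \<in> X" "y \<in> f x" using hit[of "f x"] f[of x] by blast
    then show "X \<in> (\<Union>x\<in>S. \<Union>y\<in>f x. {X \<in> F. x \<in> X \<and> y \<in> X})" using X x by blast
  qed
  then have "card F \<le> card (\<Union>x\<in>S. \<Union>y\<in>f x. {X \<in> F. x \<in> X \<and> y \<in> X})"
    using finF c5 S f by (intro card_mono) auto
  also have "\<dots> \<le> (\<Sum>x\<in>S. card (\<Union>y\<in>f x. {X \<in> F. x \<in> X \<and> y \<in> X}))"
    using c5[OF S] by (intro card_UN_le) auto
  also have "\<dots> \<le> (\<Sum>x\<in>S. \<Sum>y\<in>f x. m x y)"
    unfolding m_def using c5 f by (intro sum_mono card_UN_le) auto
  finally have le: "card F \<le> (\<Sum>x\<in>S. \<Sum>y\<in>f x. m x y)" .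
  define M where "M = Max ((\<lambda>(x, y). m x y) ` (SIGMA x:S. f x))"
  have finS: "finite (SIGMA x:S. f x)" using c5 S f by (intro finite_SigmaI) auto
  have neS: "(SIGMA x:S. f x) \<noteq> {}" using c5[OF S] c5 f by blast
  have "M \<in> (\<lambda>(x, y). m x y) ` (SIGMA x:S. f x)" unfolding M_def using finS neS by (intro Max_in) auto
  then obtain x y where "y \<in> f x" "M = m x y" by auto
  then have M3: "M ^ 3 \<le> B" using m[of x y] f[of x] by auto
  have mM: "m x y \<le> M" if "x \<in> S" "y \<in> f x" for x y
    unfolding M_def using that finS by (intro Max_ge) auto
  have "(\<Sum>x\<in>S. \<Sum>y\<in>f x. m x y) \<le> (\<Sum>x\<in>S. \<Sum>y\<in>f x. M)" by (intro sum_mono mM)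
  also have "\<dots> = 25 * M" using c5 f S by simp
  finally have "card F ^ 3 \<le> (25 * M) ^ 3" using le by (intro power_mono) auto
  also have "\<dots> = 25 ^ 3 * M ^ 3" by (rule power_mult_distrib)
  also have "\<dots> \<le> 25 ^ 3 * B" using M3 by (rule mult_le_mono2)
  finally show ?thesis unfolding B_def by blast
qed

end

text \<open>Among the sets S - A there are either M disjoint ones, which give a sunflower with
  kernel \<open>A\<close>, or at most M * k vertices that meet all of them, one of which is then
  popular.\<close>

theorem splits_or_popular:
  assumes k: "k = 2 \<or> k = 3"
  shows "\<exists>M. \<forall>(V :: 'a set) E F A. set_system r (r - 2 + k) V E F \<longrightarrow> clique A E \<longrightarrow> card A = r - 2 \<longrightarrow>
    {S \<in> F. A \<subseteq> S} \<noteq> {} \<longrightarrow> (\<exists>S\<in>F. \<exists>B. card B = r - 3 \<and> splits E B S) \<or>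
    (\<exists>u. u \<notin> A \<and> card {S \<in> F. A \<subseteq> S} \<le> M * card {S \<in> F. insert u A \<subseteq> S})"
proof -
  obtain M where M: "\<forall>(V :: 'a set) E F A G. set_system r (r - 2 + k) V E F \<longrightarrow> clique A E \<longrightarrow> card A = r - 2 \<longrightarrow>
    G \<subseteq> F \<longrightarrow> M \<le> card G \<longrightarrow> (\<forall>S\<in>G. A \<subseteq> S) \<longrightarrow> pairwise (\<lambda>S S'. S \<inter> S' = A) G \<longrightarrow>
    (\<exists>S\<in>F. \<exists>B. card B = r - 3 \<and> splits E B S)"
    using sunflower_splits[OF k] ..
  show ?thesis
  proof (intro exI[of _ "M * k"] allI impI)
    fix V :: "'a set" and E F A
    assume sys: "set_system r (r - 2 + k) V E F" and A: "clique A E" "card A = r - 2" and ne: "{S \<in> F. A \<subseteq> S} \<noteq> {}"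
    interpret set_system r "r - 2 + k" V E F by (rule sys)
    define FA where "FA = {S \<in> F. A \<subseteq> S}"
    define P where "P = (\<lambda>S. S - A) ` FA"
    have finFA: "finite FA" using finF by (simp add: FA_def)
    obtain S0 where S0: "S0 \<in> FA" using ne by (auto simp: FA_def)
    then have "A \<subseteq> V" using FV by (auto simp: FA_def)
    then have finA: "finite A" by (rule fin)
    have P: "finite p \<and> card p = k" if "p \<in> P" for p
      using that Ft A(2) finA fin[OF FV] by (auto simp: P_def FA_def card_Diff_subset)
    have k0: "0 < k" using k by auto
    consider D where "D \<subseteq> P" "finite D" "card D = M" "pairwise disjnt D" |
      U where "finite U" "card U \<le> M * k" "\<forall>p\<in>P. p \<inter> U \<noteq> {}"
      using disjoint_or_cover[of P k M, OF P k0] by blast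
    then show "(\<exists>S\<in>F. \<exists>B. card B = r - 3 \<and> splits E B S) \<or>
      (\<exists>u. u \<notin> A \<and> card {S \<in> F. A \<subseteq> S} \<le> M * k * card {S \<in> F. insert u A \<subseteq> S})"
    proof cases
      case 1
      have DA: "p \<inter> A = {}" "p \<union> A \<in> F" if "p \<in> D" for p
        using that 1(1) by (auto simp: P_def FA_def Un_absorb2)
      define G where "G = (\<lambda>p. p \<union> A) ` D"
      have "inj_on (\<lambda>p. p \<union> A) D" by (rule inj_onI) (use DA in blast)
      then have "card G = M" using 1(3) by (simp add: G_def card_image)
      moreover have "G \<subseteq> F" "\<forall>S\<in>G. A \<subseteq> S" using DA by (auto simp: G_def)
      moreover have "pairwise (\<lambda>S S'. S \<inter> S' = A) G"
      proof (rule pairwiseI)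
        fix S S' assume "S \<in> G" "S' \<in> G" "S \<noteq> S'"
        then obtain p q where pq: "p \<in> D" "q \<in> D" "S = p \<union> A" "S' = q \<union> A" "p \<noteq> q" by (auto simp: G_def)
        then have "p \<inter> q = {}" using 1(4) by (auto simp: pairwise_def disjnt_def)
        then show "S \<inter> S' = A" using pq by blast
      qed
      ultimately have "\<exists>S\<in>F. \<exists>B. card B = r - 3 \<and> splits E B S"
        using M[rule_format, OF sys A, of G] by simp
      then show ?thesis ..
    next
      case 2
      have "\<forall>S\<in>FA. \<exists>u. u \<in> S - A \<and> u \<in> U" using 2(3) by (auto simp: P_def)
      from bchoice[OF this] obtain f where f: "\<forall>S\<in>FA. f S \<in> S - A \<and> f S \<in> U" ..
      have "card (f ` FA) \<le> card U" using f 2(1) by (intro card_mono) auto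
      then have "card (f ` FA) \<le> M * k" using 2(2) by simp
      from pigeonhole_fiber[OF finFA _ this] S0 obtain u where
        u: "u \<in> f ` FA" "card FA \<le> M * k * card {S \<in> FA. f S = u}" by blast
      have "card {S \<in> FA. f S = u} \<le> card {S \<in> F. insert u A \<subseteq> S}"
        using f finF by (intro card_mono) (auto simp: FA_def)
      then have "card FA \<le> M * k * card {S \<in> F. insert u A \<subseteq> S}" using u(2) by (meson mult_le_mono2 order_trans)
      moreover have "u \<notin> A" using u(1) f by blast
      ultimately show ?thesis unfolding FA_def by blast
    qed
  qed
qed

context set_system begin

lemma splits_obtains:
  assumes S: "S \<in> F" "card B = r - 3" "splits E B S"
  obtains adj :: "'a \<Rightarrow> 'a \<Rightarrow> bool" and V' F' where "triangle_free adj" "finite V'" "card F' = card F"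
    "F' \<subseteq> triangle_free.mis adj V' (t - (r - 3))"
    "\<forall>X\<in>F'. \<forall>Y\<in>F'. X \<noteq> Y \<longrightarrow> X \<inter> Y \<noteq> {}"
    "2 * card E = triangle_free.degsum adj V' + 2 * (r - 3) * card V' + (r - 3) * (r - 4)"
proof (rule that[of "vadj (V - B) E" "V - B" "(\<lambda>T. T - B) ` F"])
  show "triangle_free (vadj (V - B) E)" by (rule vadj_triangle_free[OF S])
  show "card ((\<lambda>T. T - B) ` F) = card F" by (rule card_image[OF F_inj[OF S]])
  show "(\<lambda>T. T - B) ` F \<subseteq> triangle_free.mis (vadj (V - B) E) (V - B) (t - (r - 3))"
    using F_mis[OF S] by blast
  show "2 * card E = triangle_free.degsum (vadj (V - B) E) (V - B) + 2 * (r - 3) * card (V - B) + (r - 3) * (r - 4)"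
    by (rule edge_count[OF S])
  show "\<forall>X\<in>(\<lambda>T. T - B) ` F. \<forall>Y\<in>(\<lambda>T. T - B) ` F. X \<noteq> Y \<longrightarrow> X \<inter> Y \<noteq> {}"
    using F_inter[OF S] by blast
qed (use finV in auto)

end

section \<open>Edge bounds for the different sizes of members\<close>

text \<open>For large s a popular vertex is impossible: with \<open>A\<close> it makes a set of size
  r-1, contained in fewer than r members by \<open>codim1\<close>. So some member splits, and s(s-1)
  + (r-3)(2s+1) plus the edges inside the clique of size r-3 give the polynomial. The summand 61
  meets the threshold of \<open>intersecting_triples\<close>.\<close>

theorem lower_bound_r_r:
  assumes r: "3 \<le> r"
  shows "\<exists>s0. \<forall>(V :: 'a set) E F. set_system r r V E F \<longrightarrow> s0 \<le> card F \<longrightarrow>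
    (int (card F))\<^sup>2 + (2 * int r - 7) * int (card F) + int ((r - 2) choose 2) \<le> int (card E)"
proof -
  have rr: "r - 2 + 2 = r" using r by simp
  have ex: "\<exists>M. \<forall>(V :: 'a set) E F A. set_system r r V E F \<longrightarrow> clique A E \<longrightarrow> card A = r - 2 \<longrightarrow>
    {S \<in> F. A \<subseteq> S} \<noteq> {} \<longrightarrow> (\<exists>S\<in>F. \<exists>B. card B = r - 3 \<and> splits E B S) \<or>
    (\<exists>u. u \<notin> A \<and> card {S \<in> F. A \<subseteq> S} \<le> M * card {S \<in> F. insert u A \<subseteq> S})"
    using splits_or_popular[of 2 r, where 'a = 'a] unfolding rr by simp
  from ex obtain M where M: "\<forall>(V :: 'a set) E F A. set_system r r V E F \<longrightarrow> clique A E \<longrightarrow> card A = r - 2 \<longrightarrow>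
    {S \<in> F. A \<subseteq> S} \<noteq> {} \<longrightarrow> (\<exists>S\<in>F. \<exists>B. card B = r - 3 \<and> splits E B S) \<or>
    (\<exists>u. u \<notin> A \<and> card {S \<in> F. A \<subseteq> S} \<le> M * card {S \<in> F. insert u A \<subseteq> S})" ..
  show ?thesis
  proof (intro exI[of _ "2 ^ r * (M * r) + 61"] allI impI)
    fix V :: "'a set" and E F assume sys: "set_system r r V E F" and s: "2 ^ r * (M * r) + 61 \<le> card F"
    interpret set_system r r V E F by (rule sys)
    obtain A where A: "clique A E" "card A = r - 2" "A \<subseteq> V" "card F \<le> 2 ^ r * card {S \<in> F. A \<subseteq> S}"
      by (rule common_clique) (use s in auto)
    have "card {S \<in> F. A \<subseteq> S} > 0" using A(4) s by (intro gr0I) auto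
    then have "{S \<in> F. A \<subseteq> S} \<noteq> {}" by (metis card.empty less_irrefl)
    then have "(\<exists>S\<in>F. \<exists>B. card B = r - 3 \<and> splits E B S) \<or>
      (\<exists>u. u \<notin> A \<and> card {S \<in> F. A \<subseteq> S} \<le> M * card {S \<in> F. insert u A \<subseteq> S})"
      using M sys A(1,2) by blast
    moreover have False if "u \<notin> A" "card {S \<in> F. A \<subseteq> S} \<le> M * card {S \<in> F. insert u A \<subseteq> S}" for u
    proof -
      have "card {S \<in> F. insert u A \<subseteq> S} < r"
        using that(1) A fin[OF A(3)] r by (intro codim1) auto
      then have "M * card {S \<in> F. insert u A \<subseteq> S} \<le> M * r" by simp
      then have "card {S \<in> F. A \<subseteq> S} \<le> M * r" using that(2) by linarith
      then have "2 ^ r * card {S \<in> F. A \<subseteq> S} \<le> 2 ^ r * (M * r)" by (rule mult_le_mono2)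
      then show False using A(4) s by linarith
    qed
    ultimately obtain S B where SB: "S \<in> F" "card B = r - 3" "splits E B S" by blast
    obtain adj :: "'a \<Rightarrow> 'a \<Rightarrow> bool" and V' F' where T: "triangle_free adj" "finite V'" "card F' = card F"
      "F' \<subseteq> triangle_free.mis adj V' (r - (r - 3))"
      "\<forall>X\<in>F'. \<forall>Y\<in>F'. X \<noteq> Y \<longrightarrow> X \<inter> Y \<noteq> {}"
      "2 * card E = triangle_free.degsum adj V' + 2 * (r - 3) * card V' + (r - 3) * (r - 4)"
      by (rule splits_obtains[OF SB])
    interpret T: triangle_free adj by (rule T(1))
    have "F' \<subseteq> T.mis V' 3" using T(4) r by simp
    from T.intersecting_triples[OF T(2) this _ T(5)[rule_format]] T(3) s
    have i: "2 * (card F * (card F - 1)) \<le> T.degsum V'" "2 * card F + 1 \<le> card V'" by auto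
    define s where "s = int (card F)"
    define p where "p = int r - 3"
    have p: "p \<ge> 0" "int (r - 3) = p" using r by (auto simp: p_def of_nat_diff)
    have cc: "2 * int ((r - 2) choose 2) = (p + 1) * p"
    proof -
      have "2 * ((r - 2) choose 2) = (r - 2) * (r - 3)"
      proof -
        have "even ((r - 2) * (r - 2 - 1))" by (cases "even (r - 2)") auto
        then show ?thesis unfolding choose_two by (simp add: numeral_3_eq_3)
      qed
      then have "2 * int ((r - 2) choose 2) = int (r - 2) * int (r - 3)" by (metis of_nat_mult of_nat_numeral)
      then show ?thesis using r by (simp add: p_def of_nat_diff)
    qed
    have pp: "int ((r - 3) * (r - 4)) = p * (p - 1)"
      using r by (cases "r = 3") (auto simp: p_def of_nat_diff)
    have "1 \<le> card F" using s by simp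
    then have d: "2 * (s * (s - 1)) \<le> int (T.degsum V')"
    proof -
      have "int (2 * (card F * (card F - 1))) \<le> int (T.degsum V')" using i(1) by (simp only: of_nat_le_iff)
      moreover have "int (card F - 1) = s - 1" using \<open>1 \<le> card F\<close> by (simp add: s_def of_nat_diff)
      ultimately show ?thesis by (simp add: s_def)
    qed
    have v: "2 * s + 1 \<le> int (card V')" using i(2) by (simp add: s_def)
    have "2 * int (card E) = int (T.degsum V') + 2 * p * int (card V') + p * (p - 1)"
      using arg_cong[OF T(6), of int] p(2) pp by (simp only: of_nat_add of_nat_mult of_nat_numeral)
    moreover have "2 * p * (2 * s + 1) \<le> 2 * p * int (card V')" using v p by (intro mult_left_mono) auto
    ultimately have "2 * (s * (s - 1)) + 2 * p * (2 * s + 1) + p * (p - 1) \<le> 2 * int (card E)" using d by linarith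
    moreover have "2 * (s\<^sup>2 + (2 * int r - 7) * s) + (p + 1) * p = 2 * (s * (s - 1)) + 2 * p * (2 * s + 1) + p * (p - 1)"
      by (simp add: p_def power2_eq_square algebra_simps)
    ultimately have "2 * (s\<^sup>2 + (2 * int r - 7) * s) + 2 * int ((r - 2) choose 2) \<le> 2 * int (card E)"
      by (simp only: cc)
    then have "2 * (s\<^sup>2 + (2 * int r - 7) * s + int ((r - 2) choose 2)) \<le> 2 * int (card E)"
      by (simp only: distrib_left)
    then show "(int (card F))\<^sup>2 + (2 * int r - 7) * int (card F) + int ((r - 2) choose 2) \<le> int (card E)"
      unfolding s_def by simp
  qed
qed

text \<open>If a member splits, intersecting 4-sets remain, and a vertex of a quarter of them leaves
  triples for \<open>card_mis_3_degsum\<close>. Otherwise the popular vertex with \<open>A\<close>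
  has codimension two, where \<open>codim2_quadratic\<close> gives s^2 << e, more than is
  needed.\<close>

theorem lower_bound_r_Suc_r:
  assumes r: "3 \<le> r"
  shows "\<exists>C. \<forall>(V :: 'a set) E F. set_system r (r + 1) V E F \<longrightarrow> card F ^ 3 \<le> C * (card E + 1)\<^sup>2"
proof -
  have rr: "r - 2 + 3 = r + 1" using r by simp
  have ex: "\<exists>M. \<forall>(V :: 'a set) E F A. set_system r (r + 1) V E F \<longrightarrow> clique A E \<longrightarrow> card A = r - 2 \<longrightarrow>
    {S \<in> F. A \<subseteq> S} \<noteq> {} \<longrightarrow> (\<exists>S\<in>F. \<exists>B. card B = r - 3 \<and> splits E B S) \<or>
    (\<exists>u. u \<notin> A \<and> card {S \<in> F. A \<subseteq> S} \<le> M * card {S \<in> F. insert u A \<subseteq> S})"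
    using splits_or_popular[of 3 r, where 'a = 'a] unfolding rr by simp
  from ex obtain M where M: "\<forall>(V :: 'a set) E F A. set_system r (r + 1) V E F \<longrightarrow> clique A E \<longrightarrow> card A = r - 2 \<longrightarrow>
    {S \<in> F. A \<subseteq> S} \<noteq> {} \<longrightarrow> (\<exists>S\<in>F. \<exists>B. card B = r - 3 \<and> splits E B S) \<or>
    (\<exists>u. u \<notin> A \<and> card {S \<in> F. A \<subseteq> S} \<le> M * card {S \<in> F. insert u A \<subseteq> S})" ..
  define K where "K = 2 ^ (r + 1) * M"
  define C where "C = 1 + 64 * (4096 + 128 ^ 3) + K ^ 3 * (16 * r ^ 8)"
  have "card F ^ 3 \<le> C * (card E + 1)\<^sup>2" if sys: "set_system r (r + 1) V E F" for V :: "'a set" and E F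
  proof (cases "card F < 2")
    case True
    then have "card F ^ 3 \<le> 1" by (cases "card F") auto
    also have "1 \<le> C * (card E + 1)\<^sup>2" by (simp add: C_def)
    finally show ?thesis .
  next
    case False
    interpret set_system r "r + 1" V E F by (rule sys)
    obtain A where A: "clique A E" "card A = r - 2" "A \<subseteq> V" "card F \<le> 2 ^ (r + 1) * card {S \<in> F. A \<subseteq> S}"
      by (rule common_clique) (use False in auto)
    have "card {S \<in> F. A \<subseteq> S} > 0" using A(4) False by (intro gr0I) auto
    then have "{S \<in> F. A \<subseteq> S} \<noteq> {}" by (metis card.empty less_irrefl)
    then have "(\<exists>S\<in>F. \<exists>B. card B = r - 3 \<and> splits E B S) \<or>
      (\<exists>u. u \<notin> A \<and> card {S \<in> F. A \<subseteq> S} \<le> M * card {S \<in> F. insert u A \<subseteq> S})"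
      using M sys A(1,2) by blast
    then show ?thesis
    proof
      assume "\<exists>S\<in>F. \<exists>B. card B = r - 3 \<and> splits E B S"
      then obtain S B where SB: "S \<in> F" "card B = r - 3" "splits E B S" by blast
      obtain adj :: "'a \<Rightarrow> 'a \<Rightarrow> bool" and V' F' where T: "triangle_free adj" "finite V'" "card F' = card F"
        "F' \<subseteq> triangle_free.mis adj V' (r + 1 - (r - 3))"
        "\<forall>X\<in>F'. \<forall>Y\<in>F'. X \<noteq> Y \<longrightarrow> X \<inter> Y \<noteq> {}"
        "2 * card E = triangle_free.degsum adj V' + 2 * (r - 3) * card V' + (r - 3) * (r - 4)"
        by (rule splits_obtains[OF SB])
      interpret T: triangle_free adj by (rule T(1))
      have "r + 1 - (r - 3) = Suc 3" using r by simp
      then have F4: "F' \<subseteq> T.mis V' (Suc 3)" using T(4) by simp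
      have "F' \<noteq> {}" using T(3) False by auto
      from T.popular_vertex[OF T(2) F4 this T(5)[rule_format]] obtain y where
        y: "card F' \<le> Suc 3 * card {X \<in> F'. y \<in> X}" by blast
      have "card F \<le> 4 * card (T.mis (T.away V' y) 3)"
      proof -
        have "card F \<le> 4 * card {X \<in> F'. y \<in> X}" using y T(3) by simp
        then show ?thesis using T.card_containing_le[OF T(2) F4, of y] by linarith
      qed
      then have "card F ^ 3 \<le> (4 * card (T.mis (T.away V' y) 3)) ^ 3" by (rule power_mono) simp
      also have "\<dots> = 64 * card (T.mis (T.away V' y) 3) ^ 3" by (simp add: power_mult_distrib)
      also have "\<dots> \<le> 64 * (1024 * (T.degsum (T.away V' y))\<^sup>2 + 128 ^ 3)"
        using T(2) by (intro mult_le_mono2 T.card_mis_3_degsum) (simp add: T.away_def)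
      also have "\<dots> \<le> 64 * (1024 * (2 * card E)\<^sup>2 + 128 ^ 3)"
      proof (intro mult_le_mono2 add_le_mono1 power_mono)
        have "T.degsum (T.away V' y) \<le> T.degsum V'" by (rule T.degsum_mono[OF T(2) T.away_subset])
        then show "T.degsum (T.away V' y) \<le> 2 * card E" using T(6) by simp
      qed simp
      also have "\<dots> = 64 * 4096 * (card E)\<^sup>2 + 64 * 128 ^ 3 * 1" by (simp add: power_mult_distrib)
      also have "\<dots> \<le> 64 * 4096 * (card E + 1)\<^sup>2 + 64 * 128 ^ 3 * (card E + 1)\<^sup>2"
        by (intro add_mono mult_le_mono2 power_mono) auto
      also have "\<dots> = (64 * (4096 + 128 ^ 3)) * (card E + 1)\<^sup>2" by (simp add: algebra_simps)
      also have "\<dots> \<le> C * (card E + 1)\<^sup>2" by (intro mult_le_mono1) (simp add: C_def)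
      finally show ?thesis .
    next
      assume "\<exists>u. u \<notin> A \<and> card {S \<in> F. A \<subseteq> S} \<le> M * card {S \<in> F. insert u A \<subseteq> S}"
      then obtain u where u: "u \<notin> A" "card {S \<in> F. A \<subseteq> S} \<le> M * card {S \<in> F. insert u A \<subseteq> S}" by blast
      define m where "m = card {S \<in> F. insert u A \<subseteq> S}"
      have m: "m\<^sup>2 \<le> r\<^sup>2 * (card E + m)"
        unfolding m_def using u(1) A fin[OF A(3)] r by (intro codim2_quadratic) auto
      have m2: "m\<^sup>2 \<le> 4 * r ^ 4 * (card E + 1)"
      proof (cases "m \<le> 2 * r\<^sup>2")
        case True
        then have "m\<^sup>2 \<le> (2 * r\<^sup>2)\<^sup>2" by (rule power_mono) simp
        also have "\<dots> = 4 * r ^ 4 * 1" by (simp add: power_mult_distrib flip: power_mult)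
        also have "\<dots> \<le> 4 * r ^ 4 * (card E + 1)" by (intro mult_le_mono2) simp
        finally show ?thesis .
      next
        case False
        then have "2 * r\<^sup>2 * m \<le> m * m" by (intro mult_le_mono1) simp
        then have "2 * (r\<^sup>2 * m) \<le> m\<^sup>2" by (simp add: power2_eq_square[of m] mult.assoc)
        moreover have "m\<^sup>2 \<le> r\<^sup>2 * card E + r\<^sup>2 * m" using m by (simp only: distrib_left)
        ultimately have "m\<^sup>2 \<le> 2 * (r\<^sup>2 * card E)" by linarith
        then have "m\<^sup>2 \<le> 2 * r\<^sup>2 * card E" by (simp only: mult.assoc)
        also have "\<dots> \<le> 4 * r ^ 4 * (card E + 1)"
        proof (intro mult_le_mono)
          have "r\<^sup>2 \<le> r ^ 4" using r by (intro power_increasing) auto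
          then show "r\<^sup>2 \<le> r ^ 4" .
        qed auto
        finally show ?thesis .
      qed
      have "card F \<le> K * m"
      proof -
        have "2 ^ (r + 1) * card {S \<in> F. A \<subseteq> S} \<le> 2 ^ (r + 1) * (M * m)" using u(2) unfolding m_def by (rule mult_le_mono2)
        then have "card F \<le> 2 ^ (r + 1) * (M * m)" using A(4) by linarith
        then show ?thesis by (simp only: K_def mult.assoc)
      qed
      then have "card F ^ 3 \<le> (K * m) ^ 3" by (rule power_mono) simp
      also have "\<dots> = K ^ 3 * m ^ 3" by (rule power_mult_distrib)
      also have "\<dots> \<le> K ^ 3 * (m\<^sup>2 * m\<^sup>2)"
      proof (rule mult_le_mono2)
        show "m ^ 3 \<le> m\<^sup>2 * m\<^sup>2" by (cases "m = 0") (auto simp: power3_eq_cube power2_eq_square)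
      qed
      also have "\<dots> \<le> K ^ 3 * ((4 * r ^ 4 * (card E + 1)) * (4 * r ^ 4 * (card E + 1)))"
        using m2 by (intro mult_le_mono2 mult_le_mono)
      also have "\<dots> = K ^ 3 * (16 * r ^ 8) * (card E + 1)\<^sup>2"
      proof -
        have "r ^ 8 = r ^ 4 * r ^ 4" by (simp flip: power_add)
        moreover have "(4 * a * e) * (4 * a * e) = 16 * (a * a) * e\<^sup>2" for a e :: nat
          by (simp add: power2_eq_square)
        ultimately show ?thesis by (simp only: mult.assoc)
      qed
      also have "\<dots> \<le> C * (card E + 1)\<^sup>2" by (intro mult_le_mono1) (simp add: C_def)
      finally show ?thesis .
    qed
  qed
  then show ?thesis by blast
qed

text \<open>For r = 3 the clique of the join is empty. A popular vertex leaves sets of size t-1,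
  whence the exponent (t-1) - 2.\<close>

theorem lower_bound_3_t:
  assumes t: "5 \<le> t"
  shows "\<exists>C. \<forall>(V :: 'a set) E F. set_system 3 t V E F \<longrightarrow> (card F)\<^sup>2 \<le> C * (2 * card E + 1) ^ (t - 3)"
proof -
  have t4: "4 \<le> t - 1" using t by simp
  obtain C where C: "\<forall>(adj :: 'a \<Rightarrow> 'a \<Rightarrow> bool) V. triangle_free adj \<longrightarrow> finite V \<longrightarrow>
    (card (triangle_free.mis adj V (t - 1)))\<^sup>2 \<le> C * (triangle_free.degsum adj V + 1) ^ (t - 1 - 2)"
    using card_mis_general[OF t4, where 'a = 'a] ..
  have "(card F)\<^sup>2 \<le> (t\<^sup>2 * C) * (2 * card E + 1) ^ (t - 3)" if sys: "set_system 3 t V E F" for V :: "'a set" and E F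
  proof (cases "F = {}")
    case False
    interpret set_system 3 t V E F by (rule sys)
    obtain S where S: "S \<in> F" using False by blast
    have c0: "card ({} :: 'a set) = 3 - 3" by simp
    obtain adj :: "'a \<Rightarrow> 'a \<Rightarrow> bool" and V' F' where T: "triangle_free adj" "finite V'" "card F' = card F"
      "F' \<subseteq> triangle_free.mis adj V' (t - (3 - 3))"
      "\<forall>X\<in>F'. \<forall>Y\<in>F'. X \<noteq> Y \<longrightarrow> X \<inter> Y \<noteq> {}"
      "2 * card E = triangle_free.degsum adj V' + 2 * (3 - 3) * card V' + (3 - 3) * (3 - 4)"
      by (rule splits_obtains[OF S c0 r3_splits[OF refl S]])
    interpret T: triangle_free adj by (rule T(1))
    have st: "Suc (t - 1) = t" using t by simp
    have F1: "F' \<subseteq> T.mis V' (Suc (t - 1))" using T(4) st by simp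
    have "F' \<noteq> {}" using T(3) False finF by auto
    from T.popular_vertex[OF T(2) F1 this T(5)[rule_format]] obtain y where
      y: "card F' \<le> Suc (t - 1) * card {X \<in> F'. y \<in> X}" by blast
    have "card F \<le> t * card {X \<in> F'. y \<in> X}" using y T(3) st by simp
    also have "\<dots> \<le> t * card (T.mis (T.away V' y) (t - 1))"
      by (intro mult_le_mono2 T.card_containing_le[OF T(2) F1])
    finally have "(card F)\<^sup>2 \<le> (t * card (T.mis (T.away V' y) (t - 1)))\<^sup>2" by (rule power_mono) simp
    also have "\<dots> = t\<^sup>2 * (card (T.mis (T.away V' y) (t - 1)))\<^sup>2" by (rule power_mult_distrib)
    also have "\<dots> \<le> t\<^sup>2 * (C * (T.degsum (T.away V' y) + 1) ^ (t - 1 - 2))"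
      using C[rule_format, OF T(1), of "T.away V' y"] T(2) by (intro mult_le_mono2) (simp add: T.away_def)
    also have "\<dots> \<le> t\<^sup>2 * (C * (2 * card E + 1) ^ (t - 1 - 2))"
    proof (intro mult_le_mono2 power_mono add_le_mono1)
      have "T.degsum (T.away V' y) \<le> T.degsum V'" by (rule T.degsum_mono[OF T(2) T.away_subset])
      then show "T.degsum (T.away V' y) \<le> 2 * card E" using T(6) by simp
    qed simp
    also have "t - 1 - 2 = t - 3" by simp
    finally show ?thesis by (simp only: mult.assoc)
  qed simp
  then show ?thesis by blast
qed

text \<open>If one non-neighbourhood accounts for all members, \<open>card_mis_4\<close> applies
  there; 2/3 is half of 4/3, as the degree sum counts edges twice. The trivial bound s \<le> N^4
  turns the error s/N into s^(3/4). In the other case of \<open>intersecting_5\<close>, s exceeds e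
  only if it is below a constant.\<close>

theorem lower_bound_3_5:
  "\<exists>K. \<forall>(V :: 'a set) E F. set_system 3 5 V E F \<longrightarrow>
    2 / 3 * real (card F) \<le> real (card E) + 61 * real (card F) powr (3 / 4) + K"
proof -
  define K where "K = real (25 ^ 3 * (4096 + 128 ^ 3))"
  have "2 / 3 * real (card F) \<le> real (card E) + 61 * real (card F) powr (3 / 4) + K"
    if sys: "set_system 3 5 V E F" for V :: "'a set" and E F
  proof (cases "F = {}")
    case True
    then show ?thesis by (simp add: K_def)
  next
    case False
    interpret set_system 3 5 V E F by (rule sys)
    obtain S where S: "S \<in> F" using False by blast
    have c0: "card ({} :: 'a set) = 3 - 3" by simp
    obtain adj :: "'a \<Rightarrow> 'a \<Rightarrow> bool" and V' F' where T: "triangle_free adj" "finite V'" "card F' = card F"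
      "F' \<subseteq> triangle_free.mis adj V' (5 - (3 - 3))"
      "\<forall>X\<in>F'. \<forall>Y\<in>F'. X \<noteq> Y \<longrightarrow> X \<inter> Y \<noteq> {}"
      "2 * card E = triangle_free.degsum adj V' + 2 * (3 - 3) * card V' + (3 - 3) * (3 - 4)"
      by (rule splits_obtains[OF S c0 r3_splits[OF refl S]])
    interpret T: triangle_free adj by (rule T(1))
    have F5: "F' \<subseteq> T.mis V' 5" using T(4) by simp
    have E: "2 * card E = T.degsum V'" using T(6) by simp
    have sF: "card F \<ge> 1" using False finF by (simp add: Suc_leI card_gt_0_iff)
    have pos: "0 \<le> 61 * real (card F) powr (3 / 4)" "0 \<le> K" by (auto simp: K_def)
    from T.intersecting_5[OF T(2) F5 T(5)[rule_format]] show ?thesis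
    proof
      assume "\<exists>y\<in>V'. card F' \<le> card (T.mis (T.away V' y) 4)"
      then obtain y where y: "card F \<le> card (T.mis (T.away V' y) 4)" using T(3) by auto
      define W where "W = T.away V' y"
      define s where "s = real (card (T.mis W 4))"
      have W: "finite W" "W \<subseteq> V'" using T(2) by (auto simp: W_def T.away_def)
      define N where "N = real (card W) + 64"
      have N: "N > 0" by (simp add: N_def)
      have c: "4 / 3 * s \<le> real (T.degsum W) + 121 * s / N"
        unfolding s_def N_def by (rule T.card_mis_4[OF W(1)])
      have sy: "real (card F) \<le> s" using y by (simp add: s_def W_def)
      have sN: "s \<le> N ^ 4"
      proof -
        have "card (T.mis W 4) \<le> card W ^ 4" by (rule T.card_mis_le_power[OF W(1)])
        then have "s \<le> real (card W) ^ 4" unfolding s_def by (metis of_nat_le_iff of_nat_power)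
        also have "\<dots> \<le> N ^ 4" by (intro power_mono) (auto simp: N_def)
        finally show ?thesis .
      qed
      have dE: "real (T.degsum W) \<le> 2 * real (card E)"
        using T.degsum_mono[OF T(2) W(2)] E by simp
      define x where "x = real (card F)"
      have x1: "x \<ge> 1" using sF by (simp add: x_def)
      have "x \<le> N ^ 4" using sy sN by (simp add: x_def)
      then have "x powr (1 / 4) \<le> (N ^ 4) powr (1 / 4)" using x1 by (intro powr_mono2) auto
      also have "\<dots> = N" using N by (simp flip: powr_numeral add: powr_powr)
      finally have xN: "x powr (1 / 4) \<le> N" .
      have xx: "x = x powr (1 / 4) * x powr (3 / 4)" using x1 by (simp flip: powr_add)
      have "x / N \<le> x powr (3 / 4)"
      proof -
        have "x \<le> N * x powr (3 / 4)" by (subst xx) (intro mult_right_mono xN, simp)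
        then show ?thesis using N by (simp add: divide_le_eq mult.commute)
      qed
      show ?thesis
      \<comment> \<open>For larger \<open>N\<close> the factor 4/3 - 121/N is positive, so
        \<open>card F\<close> may replace the larger \<open>s\<close>; for smaller \<open>N\<close>
        the bound N^4 is swallowed by \<open>K\<close>.\<close>
      proof (cases "N \<le> 121")
        case True
        have "x \<le> 121 ^ 4" using \<open>x \<le> N ^ 4\<close> power_mono[OF True, of 4] N by simp
        also have "\<dots> \<le> K" by (simp add: K_def)
        finally show ?thesis using pos unfolding x_def[symmetric] using x1 by linarith
      next
        case False
        have "(4 / 3 - 121 / N) * x \<le> (4 / 3 - 121 / N) * s"
          using sy False by (intro mult_left_mono) (auto simp: x_def field_simps)
        also have "\<dots> \<le> 2 * real (card E)" using c dE by (simp add: algebra_simps)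
        finally have "4 / 3 * x \<le> 2 * real (card E) + 121 * (x / N)" by (simp add: algebra_simps)
        then show ?thesis using \<open>x / N \<le> x powr (3 / 4)\<close> pos unfolding x_def[symmetric] by linarith
      qed
    next
      assume "card F' ^ 3 \<le> 25 ^ 3 * (1024 * (T.degsum V')\<^sup>2 + 128 ^ 3)"
      then have h: "card F ^ 3 \<le> 25 ^ 3 * (4096 * (card E)\<^sup>2 + 128 ^ 3)"
        unfolding T(3) E[symmetric] by (simp add: power_mult_distrib)
      show ?thesis
      proof (cases "card F \<le> card E")
        case True
        then have "real (card F) \<le> real (card E)" by simp
        then show ?thesis using pos by linarith
      next
        case False
        then have "(card E)\<^sup>2 \<le> (card F)\<^sup>2" by (intro power_mono) auto
        moreover have "1 \<le> (card F)\<^sup>2" using sF by simp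
        ultimately have "4096 * (card E)\<^sup>2 + 128 ^ 3 \<le> 4096 * (card F)\<^sup>2 + 128 ^ 3 * (card F)\<^sup>2"
          by (intro add_mono) simp_all
        then have "card F ^ 3 \<le> 25 ^ 3 * (4096 * (card F)\<^sup>2 + 128 ^ 3 * (card F)\<^sup>2)"
          using h by (meson mult_le_mono2 order_trans)
        also have "\<dots> = (25 ^ 3 * (4096 + 128 ^ 3)) * (card F)\<^sup>2" by (simp add: algebra_simps)
        finally have "card F * (card F)\<^sup>2 \<le> (25 ^ 3 * (4096 + 128 ^ 3)) * (card F)\<^sup>2"
          by (simp add: power3_eq_cube power2_eq_square mult.assoc)
        then have "card F \<le> 25 ^ 3 * (4096 + 128 ^ 3)" using sF by simp
        then have "real (card F) \<le> K" unfolding K_def by (simp only: of_nat_le_iff)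
        then show ?thesis using pos by linarith
      qed
    qed
  qed
  then show ?thesis by blast
qed

subsection \<open>Maximal systems\<close>

lemma rt_system_add_edge:
  assumes rt: "rt_system r t V E F" and e: "e \<in> [V]\<^bsup>2\<^esup>" and K: "\<not> contains_K r V (insert e E)"
    and S: "\<And>S. S \<in># F \<Longrightarrow> \<not> induced_contains_K (r - 1) (insert e E) S"
  shows "rt_system r t V (insert e E) F"
proof -
  have mono: "induced_contains_K n (insert e E) X" if "induced_contains_K n E X" for n X
    using that unfolding induced_contains_K_iff clique_def by blast
  have r: "r_system r V E F" "r - 2 \<le> t" "uniform_family t F" using rt by (auto simp: rt_system_def)
  have "maximally_K_free (r - 1) V (insert e E) S" if "S \<in># F" for S
    using r(1) S[OF that] that mono unfolding r_system_def maximally_K_free_def by blast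
  moreover have "induced_contains_K (r - 2) (insert e E) (S \<inter> T)" if "S \<in># F" "T \<in># F" "S \<noteq> T" for S T
    using r(1) that by (intro mono) (auto simp: r_system_def)
  ultimately show ?thesis
    using r e K unfolding rt_system_def r_system_def simple_graph_def by simp
qed

text \<open>New edges preserve domination and the cliques in intersections, so an inclusion-maximal
  edge set for the same family gives a maximal system. It may have more edges than the given one, so
  edge counts in the constructions refer to the completed graph.\<close>

lemma maximal_extension:
  assumes "rt_system r t V E F"
  obtains E' where "E \<subseteq> E'" "maximal_rt_system r t V E' F"
proof -
  define X where "X = {E'. E \<subseteq> E' \<and> rt_system r t V E' F}"
  have fV: "finite V" using assms by (simp add: rt_system_def r_system_def simple_graph_def)
  have "X \<subseteq> Pow ([V]\<^bsup>2\<^esup>)" by (auto simp: X_def rt_system_def r_system_def simple_graph_def)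
  then have "finite X" using finite_imp_finite_nsets[OF fV] finite_subset by blast
  moreover have "X \<noteq> {}" using assms by (auto simp: X_def)
  ultimately obtain E' where E': "E' \<in> X" "\<And>E''. E'' \<in> X \<Longrightarrow> E' \<subseteq> E'' \<Longrightarrow> E'' = E'"
    using finite_has_maximal[of X] by metis
  have rt: "rt_system r t V E' F" "E \<subseteq> E'" using E'(1) by (auto simp: X_def)
  have "contains_K r V (insert e E') \<or> (\<exists>S\<in>#F. induced_contains_K (r - 1) (insert e E') S)"
    if e: "e \<in> [V]\<^bsup>2\<^esup> - E'" for e
  proof (rule ccontr)
    assume "\<not> ?thesis"
    then have "rt_system r t V (insert e E') F" using rt(1) e by (intro rt_system_add_edge) auto
    then have "insert e E' \<in> X" using rt(2) by (auto simp: X_def)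
    then have "insert e E' = E'" by (rule E'(2)) auto
    then show False using e by auto
  qed
  then have "maximal_rt_system r t V E' F"
    using rt(1) by (auto simp: maximal_rt_system_def maximal_r_system_def rt_system_def)
  then show thesis using that rt(2) by blast
qed

lemma maximal_rt_imp_rt: "maximal_rt_system r t V E F \<Longrightarrow> rt_system r t V E F"
  by (simp add: maximal_rt_system_def maximal_r_system_def rt_system_def)

section \<open>Coning\<close>

definition cone :: "'a \<Rightarrow> 'a set \<Rightarrow> 'a set set \<Rightarrow> 'a set set" where
  "cone v V E = E \<union> (\<lambda>u. {v, u}) ` V"

text \<open>From a clique of the cone the apex is removed if present, and an arbitrary vertex
  otherwise.\<close>

lemma cone_clique_iff:
  assumes v: "v \<notin> V" and E: "E \<subseteq> [V]\<^bsup>2\<^esup>" and S: "S \<subseteq> V"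
  shows "(\<exists>K\<subseteq>insert v S. finite K \<and> card K = Suc n \<and> clique K (cone v V E)) \<longleftrightarrow>
    (\<exists>K\<subseteq>S. finite K \<and> card K = n \<and> clique K E)" (is "?L \<longleftrightarrow> ?R")
proof
  assume ?R
  then obtain K where K: "K \<subseteq> S" "finite K" "card K = n" "clique K E" by blast
  have "clique (insert v K) (cone v V E)"
    using K S unfolding clique_def cone_def by (auto simp: insert_commute)
  moreover have "v \<notin> K" using K(1) S v by auto
  ultimately show ?L using K by (intro exI[of _ "insert v K"]) auto
next
  assume ?L
  then obtain K where K: "K \<subseteq> insert v S" "finite K" "card K = Suc n" "clique K (cone v V E)" by blast
  have "K \<noteq> {}" using K(3) by auto
  then obtain w where w: "w \<in> K" "v \<in> K \<longrightarrow> w = v" by blast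
  define K' where "K' = K - {w}"
  have K': "K' \<subseteq> S" "finite K'" "card K' = n" using K w by (auto simp: K'_def)
  have "clique K' E" unfolding clique_def
  proof (intro ballI impI)
    fix x y assume xy: "x \<in> K'" "y \<in> K'" "x \<noteq> y"
    then have "{x, y} \<in> cone v V E" using K(4) by (auto simp: clique_def K'_def)
    moreover have "x \<noteq> v" "y \<noteq> v" using xy K'(1) S v by auto
    ultimately show "{x, y} \<in> E" by (auto simp: cone_def doubleton_eq_iff)
  qed
  then show ?R using K' by blast
qed

lemma cone_insert: "insert e (cone v V E) = cone v V (insert e E)"
  by (auto simp: cone_def)

text \<open>The apex is adjacent to every vertex, so non-edges of the cone are non-edges of the
  base, and the clique they complete there grows by the apex.\<close>

lemma maximal_cone:
  assumes m: "maximal_rt_system r t V E F" and v: "v \<notin> V"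
  shows "maximal_rt_system (Suc r) (Suc t) (insert v V) (cone v V E) (image_mset (insert v) F)"
    "card (cone v V E) = card E + card V"
proof -
  have r: "3 \<le> r" "finite V" "E \<subseteq> [V]\<^bsup>2\<^esup>" "\<forall>S\<in>#F. S \<subseteq> V" "\<not> contains_K r V E"
    "\<forall>S\<in>#F. maximally_K_free (r - 1) V E S"
    "\<forall>S\<in>#F. \<forall>T\<in>#F. S \<noteq> T \<longrightarrow> induced_contains_K (r - 2) E (S \<inter> T)"
    "\<forall>e\<in>[V]\<^bsup>2\<^esup> - E. contains_K r V (insert e E) \<or> (\<exists>S\<in>#F. induced_contains_K (r - 1) (insert e E) S)"
    "\<forall>S. count F S \<le> 1" "\<forall>S\<in>#F. card S = t" "r - 2 \<le> t"
    using m by (auto simp: maximal_rt_system_def maximal_r_system_def r_system_def simple_graph_def uniform_family_def)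
  have finE: "finite E" using r(3) finite_imp_finite_nsets[OF r(2)] finite_subset by blast
  have ind: "induced_contains_K (Suc n) (cone v V D) (insert v S) \<longleftrightarrow> induced_contains_K n D S"
    if "D \<subseteq> [V]\<^bsup>2\<^esup>" "S \<subseteq> V" for n D S
    unfolding induced_contains_K_iff by (rule cone_clique_iff[OF v that])
  have con: "contains_K (Suc n) (insert v V) (cone v V D) \<longleftrightarrow> contains_K n V D"
    if "D \<subseteq> [V]\<^bsup>2\<^esup>" for n D
    unfolding contains_K_iff by (rule cone_clique_iff[OF v that]) simp
  have r1: "Suc r - 1 = Suc (r - 1)" "Suc r - 2 = Suc (r - 2)" using r(1) by auto
  have coneV: "cone v V E \<subseteq> [insert v V]\<^bsup>2\<^esup>"
  proof -
    have "E \<subseteq> [insert v V]\<^bsup>2\<^esup>" using r(3) nsets_mono[of V "insert v V" 2] by blast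
    then show ?thesis using v by (auto simp: cone_def)
  qed
  have inj: "inj_on (insert v) (set_mset F)"
  proof (rule inj_onI)
    fix S T assume h: "S \<in># F" "T \<in># F" "insert v S = insert v T"
    have "v \<notin> S" "v \<notin> T" using h r(4) v by auto
    then show "S = T" using h(3) by (simp add: insert_ident)
  qed
  have Feq: "F = mset_set (set_mset F)" by (rule uniform_mset_set[OF r(9)])
  have "image_mset (insert v) (mset_set (set_mset F)) = mset_set (insert v ` set_mset F)"
    by (rule image_mset_mset_set[OF inj])
  then have img: "image_mset (insert v) F = mset_set (insert v ` set_mset F)" using Feq by simp
  have cnt: "count (image_mset (insert v) F) S \<le> 1" for S
    unfolding img by (simp add: count_mset_set')
  have free: "maximally_K_free (Suc r - 1) (insert v V) (cone v V E) (insert v S)" if S: "S \<in># F" for S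
    unfolding maximally_K_free_def r1
  proof (intro conjI ballI)
    have SV: "S \<subseteq> V" using r(4) S by auto
    have mk: "maximally_K_free (r - 1) V E S" using r(6) S by auto
    show "\<not> induced_contains_K (Suc (r - 1)) (cone v V E) (insert v S)"
      unfolding ind[OF r(3) SV] using mk by (simp add: maximally_K_free_def)
    fix w assume w: "w \<in> insert v V - insert v S"
    then have "insert w S \<subseteq> V" "w \<in> V - S" using SV by auto
    then have "induced_contains_K (Suc (r - 1)) (cone v V E) (insert v (insert w S))"
      unfolding ind[OF r(3) \<open>insert w S \<subseteq> V\<close>] using mk by (simp add: maximally_K_free_def)
    then show "induced_contains_K (Suc (r - 1)) (cone v V E) (insert w (insert v S))"
      by (simp add: insert_commute)
  qed
  have int: "induced_contains_K (Suc r - 2) (cone v V E) (insert v S \<inter> insert v T)"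
    if "S \<in># F" "T \<in># F" "insert v S \<noteq> insert v T" for S T
  proof -
    have "S \<inter> T \<subseteq> V" using r(4) that by auto
    moreover have "insert v S \<inter> insert v T = insert v (S \<inter> T)" by auto
    moreover have "S \<noteq> T" using that by auto
    ultimately show ?thesis unfolding r1 using ind[OF r(3)] r(7) that by simp
  qed
  have max: "contains_K (Suc r) (insert v V) (insert e (cone v V E)) \<or>
      (\<exists>S\<in>#image_mset (insert v) F. induced_contains_K (Suc r - 1) (insert e (cone v V E)) S)"
    if e: "e \<in> [insert v V]\<^bsup>2\<^esup> - cone v V E" for e
  proof -
    have "v \<notin> e"
    proof
      assume "v \<in> e"
      obtain x y where "e = {x, y}" "x \<in> insert v V" "y \<in> insert v V" "x \<noteq> y" using e by (blast elim: nsets2_E)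
      then have "e \<in> (\<lambda>u. {v, u}) ` V" using \<open>v \<in> e\<close> by (auto simp: insert_commute)
      then show False using e by (auto simp: cone_def)
    qed
    then have eV: "e \<in> [V]\<^bsup>2\<^esup> - E" using e by (auto simp: cone_def nsets_def)
    then have D: "insert e E \<subseteq> [V]\<^bsup>2\<^esup>" using r(3) by auto
    from r(8) eV have "contains_K r V (insert e E) \<or> (\<exists>S\<in>#F. induced_contains_K (r - 1) (insert e E) S)" by blast
    then show ?thesis
    proof
      assume "contains_K r V (insert e E)"
      then show ?thesis unfolding cone_insert con[OF D] by blast
    next
      assume "\<exists>S\<in>#F. induced_contains_K (r - 1) (insert e E) S"
      then obtain S where S: "S \<in># F" "induced_contains_K (r - 1) (insert e E) S" by blast
      then have "induced_contains_K (Suc (r - 1)) (cone v V (insert e E)) (insert v S)"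
        using ind[OF D] r(4) by simp
      then show ?thesis unfolding cone_insert r1 using S(1) by auto
    qed
  qed
  show "maximal_rt_system (Suc r) (Suc t) (insert v V) (cone v V E) (image_mset (insert v) F)"
    unfolding maximal_rt_system_def maximal_r_system_def r_system_def simple_graph_def uniform_family_def
  proof (intro conjI ballI allI impI)
    show "\<not> contains_K (Suc r) (insert v V) (cone v V E)" unfolding con[OF r(3)] by (rule r(5))
    show "card S = Suc t" if "S \<in># image_mset (insert v) F" for S
    proof -
      from that obtain S' where S': "S' \<in># F" "S = insert v S'" by auto
      then have "v \<notin> S'" "finite S'" using r(2,4) v finite_subset by auto
      then show ?thesis using S' r(10) by simp
    qed
    show "maximally_K_free (Suc r - 1) (insert v V) (cone v V E) S" if "S \<in># image_mset (insert v) F" for S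
    proof -
      from that obtain S' where "S' \<in># F" "S = insert v S'" by auto
      then show ?thesis using free by simp
    qed
    show "induced_contains_K (Suc r - 2) (cone v V E) (S \<inter> T)"
      if ST: "S \<in># image_mset (insert v) F" "T \<in># image_mset (insert v) F" "S \<noteq> T" for S T
    proof -
      from ST obtain S' T' where "S' \<in># F" "S = insert v S'" "T' \<in># F" "T = insert v T'" by auto
      then show ?thesis using int ST(3) by simp
    qed
    show "count (image_mset (insert v) F) S \<le> 1" for S by (rule cnt)
    show "contains_K (Suc r) (insert v V) (insert e (cone v V E)) \<or>
      (\<exists>S\<in>#image_mset (insert v) F. induced_contains_K (Suc r - 1) (insert e (cone v V E)) S)"
      if "e \<in> [insert v V]\<^bsup>2\<^esup> - cone v V E" for e by (rule max[OF that])
    show "S \<subseteq> insert v V" if "S \<in># image_mset (insert v) F" for S using that r(4) by auto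
  qed (use r(1,2,11) coneV in auto)
  have "card (cone v V E) = card E + card ((\<lambda>u. {v, u}) ` V)"
    unfolding cone_def
  proof (rule card_Un_disjoint)
    show "E \<inter> (\<lambda>u. {v, u}) ` V = {}" using r(3) v by (auto simp: nsets_def)
  qed (use finE r(2) in auto)
  also have "card ((\<lambda>u. {v, u}) ` V) = card V"
    by (rule card_image) (rule inj_onI, auto simp: doubleton_eq_iff)
  finally show "card (cone v V E) = card E + card V" .
qed

lemma maximal_cones:
  fixes V :: "nat set"
  assumes "maximal_rt_system 3 t V E F"
  shows "\<exists>(V' :: nat set) E' F'. maximal_rt_system (3 + n) (t + n) V' E' F' \<and> size F' = size F \<and>
    card V' = card V + n \<and> card E' = card E + n * card V + (n choose 2)"
proof (induction n)
  case 0
  then show ?case using assms by (intro exI[of _ V] exI[of _ E] exI[of _ F]) (auto simp: numeral_2_eq_2)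
next
  case (Suc n)
  then obtain V' :: "nat set" and E' F' where I: "maximal_rt_system (3 + n) (t + n) V' E' F'"
    "size F' = size F" "card V' = card V + n" "card E' = card E + n * card V + (n choose 2)" by blast
  have fin: "finite V'" using maximal_rt_imp_rt[OF I(1)] by (simp add: rt_system_def r_system_def simple_graph_def)
  then obtain v where v: "v \<notin> V'" using ex_new_if_finite[of V'] by auto
  have "card (cone v V' E') = card E + Suc n * card V + (Suc n choose 2)"
    using maximal_cone(2)[OF I(1) v] I(3,4) by (simp add: numeral_2_eq_2)
  moreover have "maximal_rt_system (3 + Suc n) (t + Suc n) (insert v V') (cone v V' E') (image_mset (insert v) F')"
    using maximal_cone(1)[OF I(1) v] by simp
  ultimately show ?case using I(2,3) fin v
    by (intro exI[of _ "insert v V'"] exI[of _ "cone v V' E'"] exI[of _ "image_mset (insert v) F'"]) auto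
qed

text \<open>The system lives on natural numbers, but its completed adjacency is returned as
  \<open>adj'\<close> on the original vertices. A construction can then limit the added edges in its
  own coordinates: \<open>adj'\<close> extends \<open>adj\<close>, is triangle-free and leaves
  members independent. Edges are counted as ordered pairs.\<close>

theorem maximal_system_of_mis:
  fixes adj :: "'a \<Rightarrow> 'a \<Rightarrow> bool"
  assumes tf: "triangle_free adj" and V: "finite V" and F: "F \<subseteq> triangle_free.mis adj V t" and t: "1 \<le> t"
    and int: "\<And>X Y. X \<in> F \<Longrightarrow> Y \<in> F \<Longrightarrow> X \<inter> Y \<noteq> {}"
  obtains V' :: "nat set" and E' F' adj' where "maximal_rt_system 3 t V' E' F'" "size F' = card F" "card V' = card V"
    "\<forall>a b. adj' a b \<longrightarrow> a \<in> V \<and> b \<in> V \<and> adj' b a \<and> a \<noteq> b" "\<forall>a\<in>V. \<forall>b\<in>V. adj a b \<longrightarrow> adj' a b"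
    "\<forall>a b c. adj' a b \<longrightarrow> adj' b c \<longrightarrow> \<not> adj' a c"
    "\<forall>S\<in>F. \<forall>a\<in>S. \<forall>b\<in>S. \<not> adj' a b" "2 * card E' = card {p \<in> V \<times> V. adj' (fst p) (snd p)}"
proof -
  note found = that
  interpret triangle_free adj by (rule tf)
  obtain f :: "'a \<Rightarrow> nat" where f: "inj_on f V" using finite_imp_inj_to_nat_seg[OF V] by blast
  define E where "E = {{f a, f b} | a b. a \<in> V \<and> b \<in> V \<and> adj a b}"
  have feq: "f a = f b \<longleftrightarrow> a = b" if "a \<in> V" "b \<in> V" for a b using f that by (auto simp: inj_on_def)
  have E: "{f a, f b} \<in> E \<longleftrightarrow> adj a b" if "a \<in> V" "b \<in> V" for a b
  proof
    assume "{f a, f b} \<in> E"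
    then obtain c d where cd: "c \<in> V" "d \<in> V" "adj c d" "{f a, f b} = {f c, f d}" by (auto simp: E_def)
    then have "a = c \<and> b = d \<or> a = d \<and> b = c" using feq that by (auto simp: doubleton_eq_iff)
    then show "adj a b" using cd(3) sym by blast
  qed (use that in \<open>auto simp: E_def\<close>)
  have mF: "S \<subseteq> V" "finite S" "card S = t" "\<forall>x\<in>S. \<forall>y\<in>S. \<not> adj x y" "\<forall>x\<in>V - S. \<exists>y\<in>S. adj x y" if "S \<in> F" for S
    using F that by (auto simp: mis_def)
  have finF: "finite F" using F finite_mis[OF V] finite_subset by blast
  define F' where "F' = mset_set (image f ` F)"
  have setF: "set_mset F' = image f ` F" using finF by (simp add: F'_def)
  have injF: "inj_on (image f) F"
  proof (rule inj_onI)
    fix X Y assume "X \<in> F" "Y \<in> F" "f ` X = f ` Y"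
    then show "X = Y" using inj_on_image_eq_iff[OF f mF(1) mF(1), of X Y] by simp
  qed
  have "rt_system 3 t (f ` V) E F'"
    unfolding rt_system_def r_system_def simple_graph_def uniform_family_def
  proof (intro conjI ballI allI impI)
    show "E \<subseteq> [f ` V]\<^bsup>2\<^esup>"
    proof
      fix e assume "e \<in> E"
      then obtain a b where ab: "e = {f a, f b}" "a \<in> V" "b \<in> V" "adj a b" by (auto simp: E_def)
      then have "f a \<noteq> f b" using feq irrefl by auto
      then show "e \<in> [f ` V]\<^bsup>2\<^esup>" using ab by simp
    qed
    show "\<not> contains_K 3 (f ` V) E"
      unfolding contains_K_iff
    proof
      assume "\<exists>K\<subseteq>f ` V. finite K \<and> card K = 3 \<and> clique K E"
      then obtain K where K: "K \<subseteq> f ` V" "card K = 3" "clique K E" by blast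
      then obtain x y z where xyz: "K = {x, y, z}" "x \<noteq> y" "x \<noteq> z" "y \<noteq> z" by (auto simp: card_3_iff)
      then obtain a b c where abc: "x = f a" "y = f b" "z = f c" "a \<in> V" "b \<in> V" "c \<in> V" using K(1) by auto
      then have "adj a b" "adj b c" "adj a c" using K(3) xyz E by (auto simp: clique_def)
      then show False using tri by blast
    qed
    show "maximally_K_free (3 - 1) (f ` V) E S" if "S \<in># F'" for S
      unfolding maximally_K_free_def induced_contains_K_iff
    proof (intro conjI ballI notI)
      from that setF obtain S0 where S0: "S0 \<in> F" "S = f ` S0" by auto
      note m = mF[OF S0(1)]
      {
        assume "\<exists>K\<subseteq>S. finite K \<and> card K = 3 - 1 \<and> clique K E"
        then obtain K where K: "K \<subseteq> S" "card K = 2" "clique K E" by auto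
        then obtain x y where xy: "K = {x, y}" "x \<noteq> y" by (auto simp: card_2_iff)
        then obtain a b where ab: "x = f a" "y = f b" "a \<in> S0" "b \<in> S0" using K(1) S0(2) by auto
        then have "adj a b" using K(3) xy E m(1) by (auto simp: clique_def)
        then show False using m(4) ab by blast
      }
      fix v assume "v \<in> f ` V - S"
      then obtain a where a: "v = f a" "a \<in> V - S0" using S0 by auto
      then obtain b where b: "b \<in> S0" "adj a b" using m(5) by blast
      have bV: "b \<in> V" using b(1) m(1) by auto
      have "{f a, f b} \<in> E" using E[of a b] a(2) bV b(2) by simp
      moreover from this have "{f b, f a} \<in> E" by (simp add: insert_commute)
      moreover have "f a \<noteq> f b" using feq[of a b] a(2) bV b(2) irrefl by auto
      ultimately show "\<exists>K\<subseteq>insert v S. finite K \<and> card K = 3 - 1 \<and> clique K E"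
        using a(1) b(1) S0(2) by (intro exI[of _ "{f a, f b}"]) (auto simp: clique_def)
    qed
    show "induced_contains_K (3 - 2) E (S \<inter> T)" if ST: "S \<in># F'" "T \<in># F'" for S T
    proof -
      obtain S0 T0 where S0: "S0 \<in> F" "S = f ` S0" "T0 \<in> F" "T = f ` T0" using ST setF by auto
      then obtain a where "a \<in> S0" "a \<in> T0" using int by blast
      then show ?thesis unfolding induced_contains_K_iff using S0
        by (intro exI[of _ "{f a}"]) (auto simp: clique_def)
    qed
    show "card S = t" if "S \<in># F'" for S
    proof -
      from that setF obtain S0 where S0: "S0 \<in> F" "S = f ` S0" by auto
      then show ?thesis using mF[OF S0(1)] card_image[OF inj_on_subset[OF f, of S0]] by simp
    qed
    show "count F' S \<le> 1" for S unfolding F'_def by (simp add: count_mset_set')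
    show "S \<subseteq> f ` V" if "S \<in># F'" for S
    proof -
      from that setF obtain S0 where S0: "S0 \<in> F" "S = f ` S0" by auto
      then show ?thesis using mF(1)[of S0] by auto
    qed
  qed (use V t in auto)
  then obtain E' where E': "E \<subseteq> E'" "maximal_rt_system 3 t (f ` V) E' F'" by (rule maximal_extension)
  interpret S: set_system 3 t "f ` V" E' "set_mset F'"
    by (rule rt_system_set_system(1)[OF maximal_rt_imp_rt[OF E'(2)]])
  define adj' where "adj' a b \<longleftrightarrow> a \<in> V \<and> b \<in> V \<and> {f a, f b} \<in> E'" for a b
  have s1: "a \<in> V \<and> b \<in> V \<and> adj' b a \<and> a \<noteq> b" if "adj' a b" for a b
    using that S.edge_in[of "f a" "f b"] by (auto simp: adj'_def insert_commute)
  have s2: "adj' a b" if "a \<in> V" "b \<in> V" "adj a b" for a b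
    using that E'(1) E[of a b] by (auto simp: adj'_def)
  have s3: "\<not> adj' a c" if "adj' a b" "adj' b c" for a b c
  proof
    assume ac: "adj' a c"
    have "f a \<noteq> f b" "f a \<noteq> f c" "f b \<noteq> f c" using S.edge_in that ac unfolding adj'_def by blast+
    then have "card {f a, f b, f c} = 3" by simp
    moreover have "{f a, f b} \<in> E'" "{f b, f c} \<in> E'" "{f a, f c} \<in> E'"
      using that ac by (auto simp: adj'_def)
    then have "clique {f a, f b, f c} E'"
      using insert_commute[of "f a" "f b" "{}"] insert_commute[of "f b" "f c" "{}"]
        insert_commute[of "f a" "f c" "{}"] by (auto simp: clique_def)
    moreover have "{f a, f b, f c} \<subseteq> f ` V" using that by (auto simp: adj'_def)
    ultimately show False using S.no_Kr by blast
  qed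
  have s4: "\<not> adj' a b" if "S \<in> F" "a \<in> S" "b \<in> S" for S a b
  proof
    assume ab: "adj' a b"
    have "f a \<noteq> f b" using S.edge_in ab unfolding adj'_def by blast
    then have "card {f a, f b} = 3 - 1" by simp
    moreover have "clique {f a, f b} E'"
      using ab insert_commute[of "f a" "f b" "{}"] by (auto simp: adj'_def clique_def)
    moreover have "f ` S \<in># F'" "{f a, f b} \<subseteq> f ` S" using that setF by auto
    ultimately show False using S.free by blast
  qed
  have s5: "2 * card E' = card {p \<in> V \<times> V. adj' (fst p) (snd p)}"
  proof -
    have "2 * card E' = (\<Sum>x\<in>f ` V. card {y \<in> f ` V. {x, y} \<in> E'})"
      using sum_nbrs_eq[OF S.finV S.EV] by simp
    also have "\<dots> = (\<Sum>a\<in>V. card {y \<in> f ` V. {f a, y} \<in> E'})" by (simp add: sum.reindex[OF f])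
    also have "\<dots> = (\<Sum>a\<in>V. card {b \<in> V. adj' a b})"
    proof (rule sum.cong[OF refl])
      fix a assume a: "a \<in> V"
      have "{y \<in> f ` V. {f a, y} \<in> E'} = f ` {b \<in> V. adj' a b}" using a by (auto simp: adj'_def)
      moreover have "inj_on f {b \<in> V. adj' a b}" by (rule inj_on_subset[OF f]) auto
      ultimately show "card {y \<in> f ` V. {f a, y} \<in> E'} = card {b \<in> V. adj' a b}" by (simp add: card_image)
    qed
    also have "\<dots> = card (SIGMA a:V. {b \<in> V. adj' a b})" using V by (intro card_SigmaI[symmetric]) auto
    also have "(SIGMA a:V. {b \<in> V. adj' a b}) = {p \<in> V \<times> V. adj' (fst p) (snd p)}" by auto
    finally show ?thesis .
  qed
  have "size F' = card F" unfolding F'_def using card_image[OF injF] by simp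
  moreover have "card (f ` V) = card V" by (rule card_image[OF f])
  ultimately show thesis
    using found[OF E'(2), of adj'] s1 s2 s3 s4 s5 by blast
qed

subsection \<open>Constructions\<close>

lemma obtain_subfamily:
  assumes "s \<le> card A" obtains B where "B \<subseteq> A" "card B = s" "finite B"
  using obtain_subset_with_card_n[OF assms] by metis

text \<open>Vertices are triples (copy, index, side) plus an isolated vertex \<open>(q, 0, 0)\<close>; each copy is
  a complete bipartite graph minus a perfect matching.\<close>

definition kadj :: "nat \<Rightarrow> nat \<Rightarrow> nat \<times> nat \<times> nat \<Rightarrow> nat \<times> nat \<times> nat \<Rightarrow> bool" where
  "kadj q m = (\<lambda>(c, i, j) (c', i', j'). c = c' \<and> c < q \<and> i \<noteq> i' \<and> i < m \<and> i' < m \<and> j \<noteq> j' \<and> j < 2 \<and> j' < 2)"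

definition kverts :: "nat \<Rightarrow> nat \<Rightarrow> (nat \<times> nat \<times> nat) set" where
  "kverts q m = insert (q, 0, 0) ({..<q} \<times> {..<m} \<times> {..<2})"

definition kset :: "nat \<Rightarrow> (nat \<Rightarrow> nat) \<Rightarrow> (nat \<times> nat \<times> nat) set" where
  "kset q \<phi> = insert (q, 0, 0) ((\<lambda>(c, j). (c, \<phi> c, j)) ` ({..<q} \<times> {..<2}))"

lemma kadj_triangle_free: "triangle_free (kadj q m)"
  by unfold_locales (auto simp: kadj_def)

lemma kset_iff: "(c, i, j) \<in> kset q \<phi> \<longleftrightarrow> (c, i, j) = (q, 0, 0) \<or> (c < q \<and> i = \<phi> c \<and> j < 2)"
  by (auto simp: kset_def)

lemma kset_mis:
  assumes "\<phi> \<in> {..<q} \<rightarrow>\<^sub>E {..<m}"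
  shows "kset q \<phi> \<in> triangle_free.mis (kadj q m) (kverts q m) (2 * q + 1)"
proof -
  interpret triangle_free "kadj q m" by (rule kadj_triangle_free)
  have "card ((\<lambda>(c, j). (c, \<phi> c, j)) ` ({..<q} \<times> {..<2::nat})) = card ({..<q} \<times> {..<2::nat})"
    by (rule card_image) (auto intro!: inj_onI)
  then have "card (kset q \<phi>) = 2 * q + 1"
    unfolding kset_def by (subst card_insert_disjoint) auto
  moreover have "kset q \<phi> \<subseteq> kverts q m" using assms by (auto simp: kset_def kverts_def PiE_iff)
  moreover have "\<exists>y\<in>kset q \<phi>. kadj q m x y" if x: "x \<in> kverts q m - kset q \<phi>" for x
  proof -
    obtain c i j where cij: "x = (c, i, j)" by (cases x)
    have "c < q" "i < m" "j < 2" "i \<noteq> \<phi> c" using x unfolding cij by (auto simp: kset_iff kverts_def)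
    moreover have "\<phi> c < m" using assms \<open>c < q\<close> by auto
    moreover have "j \<noteq> 1 - j" using \<open>j < 2\<close> by presburger
    ultimately show ?thesis unfolding cij
      by (intro bexI[of _ "(c, \<phi> c, 1 - j)"]) (auto simp: kadj_def kset_iff)
  qed
  ultimately show ?thesis unfolding mis_def by (auto simp: kadj_def kset_def)
qed

lemma kset_inj: "inj_on (kset q) ({..<q} \<rightarrow>\<^sub>E {..<m})"
proof (rule inj_onI)
  fix \<phi> \<psi> assume h: "\<phi> \<in> {..<q} \<rightarrow>\<^sub>E {..<m}" "\<psi> \<in> {..<q} \<rightarrow>\<^sub>E {..<m}" "kset q \<phi> = kset q \<psi>"
  show "\<phi> = \<psi>"
  proof (rule PiE_ext[OF h(1,2)])
    fix c assume "c \<in> {..<q}"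
    then have "(c, \<phi> c, 0) \<in> kset q \<psi>" using h(3) by (auto simp: kset_iff simp flip: h(3))
    then show "\<phi> c = \<psi> c" using \<open>c \<in> {..<q}\<close> by (auto simp: kset_iff)
  qed
qed

text \<open>Since m \<ge> 3, two vertices on the same side of a copy have a common neighbour on the
  other side, whose index differs from both. Completion therefore adds no edge inside a
  side.\<close>

lemma matching_system:
  assumes \<Phi>: "\<Phi> \<subseteq> {..<q} \<rightarrow>\<^sub>E {..<m}" and m: "3 \<le> m"
  obtains V :: "nat set" and E F adj' where "maximal_rt_system 3 (2 * q + 1) V E F" "size F = card \<Phi>" "card V = 2 * q * m + 1"
    "\<forall>a b. adj' a b \<longrightarrow> a \<in> kverts q m \<and> b \<in> kverts q m \<and> adj' b a \<and> a \<noteq> b"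
    "\<forall>c i j i' j'. adj' (c, i, j) (c, i', j') \<longrightarrow> j \<noteq> j'"
    "\<forall>\<phi>\<in>\<Phi>. \<forall>a\<in>kset q \<phi>. \<forall>b\<in>kset q \<phi>. \<not> adj' a b"
    "2 * card E = card {p \<in> kverts q m \<times> kverts q m. adj' (fst p) (snd p)}"
proof -
  note found = that
  let ?V = "kverts q m" and ?F = "kset q ` \<Phi>"
  have finV: "finite ?V" by (simp add: kverts_def)
  have cV: "card ?V = 2 * q * m + 1"
    unfolding kverts_def by (subst card_insert_disjoint) (auto simp: card_cartesian_product)
  have cF: "card ?F = card \<Phi>" by (rule card_image[OF inj_on_subset[OF kset_inj \<Phi>]])
  have mis: "?F \<subseteq> triangle_free.mis (kadj q m) ?V (2 * q + 1)" using kset_mis \<Phi> by blast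
  have "(q, 0, 0) \<in> X" if "X \<in> ?F" for X using that by (auto simp: kset_def)
  then have int: "X \<inter> Y \<noteq> {}" if "X \<in> ?F" "Y \<in> ?F" for X Y using that by blast
  have one: "1 \<le> 2 * q + 1" by simp
  obtain V :: "nat set" and E F adj' where C: "maximal_rt_system 3 (2 * q + 1) V E F" "size F = card ?F" "card V = card ?V"
    "\<forall>a b. adj' a b \<longrightarrow> a \<in> ?V \<and> b \<in> ?V \<and> adj' b a \<and> a \<noteq> b" "\<forall>a\<in>?V. \<forall>b\<in>?V. kadj q m a b \<longrightarrow> adj' a b"
    "\<forall>a b c. adj' a b \<longrightarrow> adj' b c \<longrightarrow> \<not> adj' a c" "\<forall>S\<in>?F. \<forall>a\<in>S. \<forall>b\<in>S. \<not> adj' a b"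
    "2 * card E = card {p \<in> ?V \<times> ?V. adj' (fst p) (snd p)}"
    by (rule maximal_system_of_mis[OF kadj_triangle_free finV mis one int])
  have jj: "j \<noteq> j'" if h: "adj' (c, i, j) (c, i', j')" for c i j i' j'
  proof
    assume jj: "j = j'"
    have v: "(c, i, j) \<in> ?V" "(c, i', j) \<in> ?V" "i \<noteq> i'" using C(4) h jj by blast+
    then have cc: "c < q" "i < m" "i' < m" "j < 2" by (auto simp: kverts_def)
    have "\<exists>k<m. k \<noteq> i \<and> k \<noteq> i'"
    proof -
      have "card {i, i'} < card {..<m}" using m by (auto simp: card_insert_if)
      then have "\<not> {..<m} \<subseteq> {i, i'}" by (metis card_mono finite.emptyI finite.insertI not_le)
      then show ?thesis by auto
    qed
    then obtain k where k: "k < m" "k \<noteq> i" "k \<noteq> i'" by blast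
    have kv: "(c, k, 1 - j) \<in> ?V" using cc k by (auto simp: kverts_def)
    have "j \<noteq> 1 - j" using cc(4) by presburger
    then have "kadj q m (c, i, j) (c, k, 1 - j)" "kadj q m (c, k, 1 - j) (c, i', j)"
      using cc k by (auto simp: kadj_def)
    then have "adj' (c, i, j) (c, k, 1 - j)" "adj' (c, k, 1 - j) (c, i', j)" using C(5) v kv by blast+
    then show False using C(6) h jj by blast
  qed
  show thesis
  proof (rule found[OF C(1) _ _ C(4) _ _ C(8)])
    show "size F = card \<Phi>" using C(2) cF by simp
    show "card V = 2 * q * m + 1" using C(3) cV by simp
    show "\<forall>c i j i' j'. adj' (c, i, j) (c, i', j') \<longrightarrow> j \<noteq> j'" using jj by blast
    show "\<forall>\<phi>\<in>\<Phi>. \<forall>a\<in>kset q \<phi>. \<forall>b\<in>kset q \<phi>. \<not> adj' a b" using C(7) by blast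
  qed
qed

text \<open>With one copy and all s functions, every matched pair lies in a member together with the
  isolated vertex, so neither can gain an edge and completion adds nothing.\<close>

lemma upper_3_3:
  assumes s: "3 \<le> s"
  shows "\<exists>(V :: nat set) E F. maximal_rt_system 3 3 V E F \<and> size F = s \<and> card V = 2 * s + 1 \<and> card E \<le> s * (s - 1)"
proof -
  let ?\<Phi> = "{..<1::nat} \<rightarrow>\<^sub>E {..<s}"
  obtain V :: "nat set" and E F adj' where C: "maximal_rt_system 3 (2 * 1 + 1) V E F" "size F = card ?\<Phi>" "card V = 2 * 1 * s + 1"
    "\<forall>a b. adj' a b \<longrightarrow> a \<in> kverts 1 s \<and> b \<in> kverts 1 s \<and> adj' b a \<and> a \<noteq> b"
    "\<forall>c i j i' j'. adj' (c, i, j) (c, i', j') \<longrightarrow> j \<noteq> j'"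
    "\<forall>\<phi>\<in>?\<Phi>. \<forall>a\<in>kset 1 \<phi>. \<forall>b\<in>kset 1 \<phi>. \<not> adj' a b"
    "2 * card E = card {p \<in> kverts 1 s \<times> kverts 1 s. adj' (fst p) (snd p)}"
    by (rule matching_system[OF order_refl s])
  have no: "\<not> adj' a b" if "a \<in> {(1, 0, 0), (0, i, 0), (0, i, 1)}" "b \<in> {(1, 0, 0), (0, i, 0), (0, i, 1)}" "i < s" for a b i
  proof -
    have 1: "(\<lambda>c\<in>{..<1}. i) \<in> ?\<Phi>" using that(3) by auto
    have "{(1, 0, 0), (0, i, 0), (0, i, 1)} \<subseteq> kset 1 (\<lambda>c\<in>{..<1}. i)" by (auto simp: kset_iff)
    note sub = subsetD[OF this]
    have "a \<in> kset 1 (\<lambda>c\<in>{..<1}. i)" "b \<in> kset 1 (\<lambda>c\<in>{..<1}. i)" using sub that(1,2) by blast+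
    then show ?thesis using C(6)[rule_format, OF 1] by simp
  qed
  define g where "g = (\<lambda>((i, i'), j). ((0::nat, i::nat, j::nat), (0::nat, i'::nat, 1 - j)))"
  have "{p \<in> kverts 1 s \<times> kverts 1 s. adj' (fst p) (snd p)} \<subseteq> g ` ((({..<s} \<times> {..<s}) - (\<lambda>i. (i, i)) ` {..<s}) \<times> {..<2})"
  proof
    fix p assume "p \<in> {p \<in> kverts 1 s \<times> kverts 1 s. adj' (fst p) (snd p)}"
    then obtain a b where p: "p = (a, b)" "a \<in> kverts 1 s" "b \<in> kverts 1 s" "adj' a b" by (cases p) auto
    have V: "x = (1, 0, 0) \<or> (\<exists>i j. x = (0, i, j) \<and> i < s \<and> j < 2)" if "x \<in> kverts 1 s" for x
      using that by (auto simp: kverts_def)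
    have j2: "j = 0 \<or> j = 1" if "j < 2" for j :: nat using that by auto
    have apex: "\<not> adj' (1, 0, 0) x" if "x \<in> kverts 1 s" for x
    proof -
      from V[OF that] show ?thesis
      proof
        assume "x = (1, 0, 0)" then show ?thesis using no[of x 0 x] s by auto
      next
        assume "\<exists>i j. x = (0, i, j) \<and> i < s \<and> j < 2"
        then obtain i j where "x = (0, i, j)" "i < s" "j < 2" by blast
        then show ?thesis using no[of "(1, 0, 0)" i x] j2[of j] by auto
      qed
    qed
    have na: "a \<noteq> (1, 0, 0)" using apex[OF p(3)] p(4) by auto
    have nb: "b \<noteq> (1, 0, 0)" using apex[OF p(2)] p(4) C(4) by blast
    obtain i j where a: "a = (0, i, j)" "i < s" "j < 2" using V[OF p(2)] na by blast
    obtain i' j' where b: "b = (0, i', j')" "i' < s" "j' < 2" using V[OF p(3)] nb by blast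
    have "j \<noteq> j'" using C(5) p(4) a b by blast
    then have j': "j' = 1 - j" using a b by auto
    have "i \<noteq> i'"
    proof
      assume "i = i'"
      then show False using no[of a i b] p(4) a b j2[of j] j2[of j'] by auto
    qed
    then have "((i, i'), j) \<in> (({..<s} \<times> {..<s}) - (\<lambda>i. (i, i)) ` {..<s}) \<times> {..<2}" using a b by auto
    moreover have "p = g ((i, i'), j)" using p(1) a b j' by (simp add: g_def)
    ultimately show "p \<in> g ` ((({..<s} \<times> {..<s}) - (\<lambda>i. (i, i)) ` {..<s}) \<times> {..<2})" by blast
  qed
  then have "2 * card E \<le> card (g ` ((({..<s} \<times> {..<s}) - (\<lambda>i. (i, i)) ` {..<s}) \<times> {..<2}))"
    unfolding C(7) by (intro card_mono) auto
  also have "\<dots> \<le> card ((({..<s} \<times> {..<s}) - (\<lambda>i. (i, i)) ` {..<s}) \<times> {..<2::nat})" by (rule card_image_le) auto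
  also have "\<dots> = (s * s - s) * 2"
  proof -
    have "card ((\<lambda>i. (i, i)) ` {..<s}) = s" by (subst card_image) (auto intro: inj_onI)
    moreover have "(\<lambda>i. (i, i)) ` {..<s} \<subseteq> {..<s} \<times> {..<s}" by auto
    ultimately show ?thesis by (simp add: card_cartesian_product card_Diff_subset)
  qed
  finally have "card E \<le> s * (s - 1)" by (simp add: diff_mult_distrib2)
  moreover have "card ?\<Phi> = s" by (simp add: card_PiE)
  ultimately show ?thesis using C(1-3) by auto
qed

text \<open>With two copies a function is a pair of indices. Completion can join vertices of
  different copies only if their pair of indices is missing from \<Phi>, which allows 4 * (m^2 - s)
  edges; each copy has at most m^2 edges, and the isolated vertex gains at most 4 * m.\<close>

lemma upper_3_5:
  assumes m: "3 \<le> m" and s: "s \<le> m\<^sup>2"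
  shows "\<exists>(V :: nat set) E F. maximal_rt_system 3 5 V E F \<and> size F = s \<and> card E \<le> 2 * m\<^sup>2 + 4 * (m\<^sup>2 - s) + 4 * m"
proof -
  let ?P = "{..<2::nat} \<rightarrow>\<^sub>E {..<m}"
  have cP: "card ?P = m\<^sup>2" by (simp add: card_PiE)
  have finP: "finite ?P" by (intro finite_PiE) auto
  obtain \<Phi> where \<Phi>: "\<Phi> \<subseteq> ?P" "card \<Phi> = s" "finite \<Phi>" by (rule obtain_subfamily[of s ?P]) (use s cP in auto)
  obtain V :: "nat set" and E F adj' where C: "maximal_rt_system 3 (2 * 2 + 1) V E F" "size F = card \<Phi>" "card V = 2 * 2 * m + 1"
    "\<forall>a b. adj' a b \<longrightarrow> a \<in> kverts 2 m \<and> b \<in> kverts 2 m \<and> adj' b a \<and> a \<noteq> b"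
    "\<forall>c i j i' j'. adj' (c, i, j) (c, i', j') \<longrightarrow> j \<noteq> j'"
    "\<forall>\<phi>\<in>\<Phi>. \<forall>a\<in>kset 2 \<phi>. \<forall>b\<in>kset 2 \<phi>. \<not> adj' a b"
    "2 * card E = card {p \<in> kverts 2 m \<times> kverts 2 m. adj' (fst p) (snd p)}"
    by (rule matching_system[OF \<Phi>(1) m])
  define A where "A = (\<lambda>((c::nat, i::nat), (i'::nat, j::nat)). ((c, i, j), (c, i', 1 - j))) ` (({..<2} \<times> {..<m}) \<times> ({..<m} \<times> {..<2}))"
  define B1 where "B1 = (\<lambda>(\<phi>::nat \<Rightarrow> nat, (j::nat, j'::nat)). ((0::nat, \<phi> 0, j), (1::nat, \<phi> 1, j'))) ` ((?P - \<Phi>) \<times> ({..<2} \<times> {..<2}))"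
  define B2 where "B2 = (\<lambda>(\<phi>::nat \<Rightarrow> nat, (j::nat, j'::nat)). ((1::nat, \<phi> 1, j'), (0::nat, \<phi> 0, j))) ` ((?P - \<Phi>) \<times> ({..<2} \<times> {..<2}))"
  define D1 where "D1 = (\<lambda>v. ((2::nat, 0::nat, 0::nat), v)) ` ({..<2::nat} \<times> {..<m} \<times> {..<2::nat})"
  define D2 where "D2 = (\<lambda>v. (v, (2::nat, 0::nat, 0::nat))) ` ({..<2::nat} \<times> {..<m} \<times> {..<2::nat})"
  have sub: "{p \<in> kverts 2 m \<times> kverts 2 m. adj' (fst p) (snd p)} \<subseteq> A \<union> (B1 \<union> B2) \<union> (D1 \<union> D2)"
  proof
    fix p assume "p \<in> {p \<in> kverts 2 m \<times> kverts 2 m. adj' (fst p) (snd p)}"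
    then obtain a b where p: "p = (a, b)" "a \<in> kverts 2 m" "b \<in> kverts 2 m" "adj' a b" by (cases p) auto
    have ab: "a \<noteq> b" "adj' b a" using C(4) p(4) by blast+
    show "p \<in> A \<union> (B1 \<union> B2) \<union> (D1 \<union> D2)"
    proof (cases "a = (2, 0, 0) \<or> b = (2, 0, 0)")
      case True
      then show ?thesis using p ab(1) by (auto simp: kverts_def D1_def D2_def)
    next
      case False
      obtain c i j where a: "a = (c, i, j)" "c < 2" "i < m" "j < 2" using p(2) False by (cases a) (auto simp: kverts_def)
      obtain c' i' j' where b: "b = (c', i', j')" "c' < 2" "i' < m" "j' < 2" using p(3) False by (cases b) (auto simp: kverts_def)
      have cross: "(\<lambda>c\<in>{..<2}. if c = 0 then x else y) \<in> ?P - \<Phi>"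
        if h: "adj' (0, x, k) (1, y, k')" "x < m" "y < m" "k < 2" "k' < 2" for x y k k'
      proof -
        let ?f = "\<lambda>c\<in>{..<2::nat}. if c = 0 then x else y"
        have "(0, x, k) \<in> kset 2 ?f" "(1, y, k') \<in> kset 2 ?f" using h by (auto simp: kset_iff)
        then have "?f \<notin> \<Phi>" using C(6) h(1) by blast
        then show ?thesis using h by auto
      qed
      consider "c = c'" | "c = 0" "c' = 1" | "c = 1" "c' = 0" using a(2) b(2) by linarith
      then show ?thesis
      proof cases
        case 1
        then have "j \<noteq> j'" using C(5) p(4) a b by blast
        then have "j' = 1 - j" using a b by auto
        then have "p = (\<lambda>((c, i), (i', j)). ((c, i, j), (c, i', 1 - j))) ((c, i), (i', j))" using p(1) a b 1 by simp
        then have "p \<in> A" unfolding A_def using a b by (intro image_eqI[of _ _ "((c, i), (i', j))"]) auto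
        then show ?thesis by blast
      next
        case 2
        then have "(\<lambda>c\<in>{..<2}. if c = 0 then i else i') \<in> ?P - \<Phi>" using cross[of i j i' j'] p(4) a b by simp
        then have "p \<in> B1" unfolding B1_def
          by (intro image_eqI[of _ _ "((\<lambda>c\<in>{..<2}. if c = 0 then i else i'), (j, j'))"]) (use p(1) a b 2 in auto)
        then show ?thesis by blast
      next
        case 3
        then have "(\<lambda>c\<in>{..<2}. if c = 0 then i' else i) \<in> ?P - \<Phi>" using cross[of i' j' i j] ab(2) a b by simp
        then have "p \<in> B2" unfolding B2_def
          by (intro image_eqI[of _ _ "((\<lambda>c\<in>{..<2}. if c = 0 then i' else i), (j', j))"]) (use p(1) a b 3 in auto)
        then show ?thesis by blast
      qed
    qed
  qed
  have fins: "finite A" "finite B1" "finite B2" "finite D1" "finite D2"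
    unfolding A_def B1_def B2_def D1_def D2_def using finP by auto
  have cA: "card A \<le> 4 * m\<^sup>2"
    unfolding A_def by (rule order_trans[OF card_image_le]) (auto simp: card_cartesian_product power2_eq_square)
  have cPP: "card (?P - \<Phi>) = m\<^sup>2 - s" using \<Phi> cP by (simp add: card_Diff_subset)
  have cB: "card B1 \<le> 4 * (m\<^sup>2 - s)" "card B2 \<le> 4 * (m\<^sup>2 - s)"
    unfolding B1_def B2_def
    by (rule order_trans[OF card_image_le]; use finP cPP in \<open>auto simp: card_cartesian_product\<close>)+
  have cD: "card D1 \<le> 4 * m" "card D2 \<le> 4 * m"
    unfolding D1_def D2_def
    by (rule order_trans[OF card_image_le]; auto simp: card_cartesian_product)+
  have "2 * card E \<le> card (A \<union> (B1 \<union> B2) \<union> (D1 \<union> D2))"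
    unfolding C(7) by (rule card_mono[OF _ sub]) (use fins in auto)
  also have "\<dots> \<le> card A + (card B1 + card B2) + (card D1 + card D2)"
    by (intro order_trans[OF card_Un_le] add_mono card_Un_le order_refl)
  also have "\<dots> \<le> 4 * m\<^sup>2 + (4 * (m\<^sup>2 - s) + 4 * (m\<^sup>2 - s)) + (4 * m + 4 * m)"
    by (intro add_mono cA cB cD)
  also have "\<dots> = 2 * (2 * m\<^sup>2 + 4 * (m\<^sup>2 - s) + 4 * m)" by (simp add: mult_2[symmetric])
  finally have "2 * card E \<le> 2 * (2 * m\<^sup>2 + 4 * (m\<^sup>2 - s) + 4 * m)" .
  then have "card E \<le> 2 * m\<^sup>2 + 4 * (m\<^sup>2 - s) + 4 * m" by simp
  then show ?thesis using C(1,2) \<Phi>(2) by auto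
qed

text \<open>Vertices of kind \<open>(0, u, 0)\<close> are the points, \<open>(1, u, v)\<close> the pairs; a pair is joined
  to all points outside it.\<close>

definition padj :: "nat \<Rightarrow> nat \<times> nat \<times> nat \<Rightarrow> nat \<times> nat \<times> nat \<Rightarrow> bool" where
  "padj p = (\<lambda>(c, u, v) (c', u', v'). (c = 0 \<and> c' = 1 \<and> u < p \<and> u \<noteq> u' \<and> u \<noteq> v') \<or>
     (c = 1 \<and> c' = 0 \<and> u' < p \<and> u' \<noteq> u \<and> u' \<noteq> v))"

text \<open>A member consists of two points, their pair and an isolated vertex. Two pairs involve at
  most four of the p \<ge> 5 points, so they have a common neighbour and are never joined. All edges
  thus meet the p + 1 vertices of \<open>D\<close>.\<close>

lemma upper_3_4:
  assumes p: "5 \<le> p" and s: "s \<le> p choose 2"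
  shows "\<exists>(V :: nat set) E F. maximal_rt_system 3 4 V E F \<and> size F = s \<and> card V = p + 1 + s \<and>
    card E \<le> (p + 1) * (p + 1 + s)"
proof -
  define Q where "Q = {(u, v). u < v \<and> v < p}"
  have "card Q = p choose 2"
  proof -
    have "bij_betw (\<lambda>(u, v). {u, v}) Q ([{..<p}]\<^bsup>2\<^esup>)"
    proof (rule bij_betw_imageI)
      show "inj_on (\<lambda>(u, v). {u, v}) Q" by (rule inj_onI) (auto simp: Q_def doubleton_eq_iff)
      show "(\<lambda>(u, v). {u, v}) ` Q = [{..<p}]\<^bsup>2\<^esup>"
      proof
        show "(\<lambda>(u, v). {u, v}) ` Q \<subseteq> [{..<p}]\<^bsup>2\<^esup>" by (auto simp: Q_def)
        show "[{..<p}]\<^bsup>2\<^esup> \<subseteq> (\<lambda>(u, v). {u, v}) ` Q"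
        proof
          fix e assume "e \<in> [{..<p}]\<^bsup>2\<^esup>"
          then obtain x y where e: "e = {x, y}" "x < p" "y < p" "x \<noteq> y" by (auto elim: nsets2_E)
          then have "(x, y) \<in> Q \<or> (y, x) \<in> Q" by (auto simp: Q_def)
          then show "e \<in> (\<lambda>(u, v). {u, v}) ` Q"
          proof
            assume "(x, y) \<in> Q" then show ?thesis using e(1) by (intro image_eqI[of _ _ "(x, y)"]) auto
          next
            assume "(y, x) \<in> Q" then show ?thesis using e(1) by (intro image_eqI[of _ _ "(y, x)"]) auto
          qed
        qed
      qed
    qed
    then show ?thesis by (simp add: bij_betw_same_card)
  qed
  then have sQ: "s \<le> card Q" using s by simp
  obtain I where I: "I \<subseteq> Q" "card I = s" "finite I" by (rule obtain_subfamily[OF sQ])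
  have tf: "triangle_free (padj p)" by unfold_locales (auto simp: padj_def)
  interpret triangle_free "padj p" by (rule tf)
  define D where "D = insert (2::nat, 0::nat, 0::nat) ((\<lambda>u. (0, u, 0)) ` {..<p})"
  define W where "W = (\<lambda>(u, v). (1::nat, u, v)) ` I"
  define S where "S = (\<lambda>(u, v). {(2::nat, 0::nat, 0::nat), (0, u, 0), (0, v, 0), (1, u, v)})"
  have cD: "card D = p + 1" unfolding D_def by (subst card_insert_disjoint) (auto simp: card_image inj_on_def)
  have cW: "card W = s" unfolding W_def using I(2) by (subst card_image) (auto simp: inj_on_def)
  have fins: "finite D" "finite W" using I by (auto simp: D_def W_def)
  have disj: "D \<inter> W = {}" by (auto simp: D_def W_def)
  have cV: "card (D \<union> W) = p + 1 + s" using cD cW fins disj by (simp add: card_Un_disjoint)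
  have Smis: "S ` I \<subseteq> mis (D \<union> W) 4"
  proof
    fix X assume "X \<in> S ` I"
    then obtain u v where uv: "(u, v) \<in> I" "X = S (u, v)" by auto
    have lt: "u < v" "v < p" using uv(1) I(1) by (auto simp: Q_def)
    have "\<exists>y\<in>X. padj p x y" if x: "x \<in> D \<union> W - X" for x
    proof (cases "x \<in> D")
      case True
      then obtain w where w: "x = (0, w, 0)" "w < p" "w \<noteq> u" "w \<noteq> v" using x uv(2) by (auto simp: D_def S_def)
      then show ?thesis unfolding uv(2) S_def by (intro bexI[of _ "(1, u, v)"]) (auto simp: padj_def)
    next
      case False
      then obtain a b where ab: "x = (1, a, b)" "(a, b) \<in> I" using x by (auto simp: W_def)
      have "a < b" using ab(2) I(1) by (auto simp: Q_def)
      have "(a, b) \<noteq> (u, v)" using x ab uv(2) by (auto simp: S_def)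
      then have "(u \<noteq> a \<and> u \<noteq> b) \<or> (v \<noteq> a \<and> v \<noteq> b)" using \<open>a < b\<close> lt(1) by auto
      then show ?thesis
      proof
        assume "u \<noteq> a \<and> u \<noteq> b"
        then show ?thesis unfolding uv(2) S_def ab(1) using lt by (intro bexI[of _ "(0, u, 0)"]) (auto simp: padj_def)
      next
        assume "v \<noteq> a \<and> v \<noteq> b"
        then show ?thesis unfolding uv(2) S_def ab(1) using lt by (intro bexI[of _ "(0, v, 0)"]) (auto simp: padj_def)
      qed
    qed
    moreover have "X \<subseteq> D \<union> W" using uv lt unfolding uv(2) S_def D_def W_def by force
    moreover have "card X = 4" using lt unfolding uv(2) S_def by auto
    moreover have "finite X" unfolding uv(2) S_def by auto
    moreover have "\<not> padj p x y" if "x \<in> X" "y \<in> X" for x y using that unfolding uv(2) S_def by (auto simp: padj_def)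
    ultimately show "X \<in> mis (D \<union> W) 4" unfolding mis_def by blast
  qed
  have Sinj: "inj_on S I"
  proof (rule inj_onI)
    fix x y assume "S x = S y"
    moreover have "(1, x) \<in> S x" by (cases x) (auto simp: S_def)
    ultimately have "(1, x) \<in> S y" by simp
    then show "x = y" by (cases x; cases y) (auto simp: S_def)
  qed
  have S2: "(2, 0, 0) \<in> S y" for y by (cases y) (simp add: S_def)
  then have int: "X \<inter> Y \<noteq> {}" if "X \<in> S ` I" "Y \<in> S ` I" for X Y using that by blast
  have fDW: "finite (D \<union> W)" using fins by simp
  have one: "1 \<le> (4::nat)" by simp
  obtain V :: "nat set" and E F adj' where C: "maximal_rt_system 3 4 V E F" "size F = card (S ` I)" "card V = card (D \<union> W)"
    "\<forall>a b. adj' a b \<longrightarrow> a \<in> D \<union> W \<and> b \<in> D \<union> W \<and> adj' b a \<and> a \<noteq> b"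
    "\<forall>a\<in>D \<union> W. \<forall>b\<in>D \<union> W. padj p a b \<longrightarrow> adj' a b"
    "\<forall>a b c. adj' a b \<longrightarrow> adj' b c \<longrightarrow> \<not> adj' a c"
    "\<forall>S\<in>S ` I. \<forall>a\<in>S. \<forall>b\<in>S. \<not> adj' a b"
    "2 * card E = card {p \<in> (D \<union> W) \<times> (D \<union> W). adj' (fst p) (snd p)}"
    by (rule maximal_system_of_mis[OF tf fDW Smis one int])
  have WW: "\<not> adj' a b" if ab: "a \<in> W" "b \<in> W" for a b
  proof -
    obtain u v u' v' where uv: "a = (1, u, v)" "b = (1, u', v')" using ab by (auto simp: W_def)
    have "card {u, v, u', v'} < card {..<p}" using p by (auto simp: card_insert_if)
    then have "\<not> {..<p} \<subseteq> {u, v, u', v'}" by (metis card_mono finite.emptyI finite.insertI not_le)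
    then obtain w where w: "w < p" "w \<notin> {u, v, u', v'}" by auto
    have "padj p a (0, w, 0)" "padj p (0, w, 0) b" using w uv by (auto simp: padj_def)
    moreover have "(0, w, 0) \<in> D" using w by (auto simp: D_def)
    ultimately have "adj' a (0, w, 0)" "adj' (0, w, 0) b" using C(5) ab by blast+
    then show ?thesis using C(6) by blast
  qed
  have "{p \<in> (D \<union> W) \<times> (D \<union> W). adj' (fst p) (snd p)} \<subseteq> D \<times> (D \<union> W) \<union> (D \<union> W) \<times> D" using WW by auto
  then have "2 * card E \<le> card (D \<times> (D \<union> W) \<union> (D \<union> W) \<times> D)"
    unfolding C(8) using fins by (intro card_mono) auto
  also have "\<dots> \<le> card (D \<times> (D \<union> W)) + card ((D \<union> W) \<times> D)" by (rule card_Un_le)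
  also have "\<dots> = 2 * ((p + 1) * (p + 1 + s))" using cD cV by (simp add: card_cartesian_product)
  finally have "card E \<le> (p + 1) * (p + 1 + s)" by simp
  moreover have "card (S ` I) = s" using Sinj I(2) by (simp add: card_image)
  ultimately show ?thesis using C(1-3) cV by metis
qed

definition cyc_succ :: "nat \<Rightarrow> nat \<Rightarrow> nat" where
  "cyc_succ k i = (if Suc i = k then 0 else Suc i)"

text \<open>A blow-up of the cycle of length \<open>k\<close>; consecutive vertices \<open>(i, a, b)\<close> and
  \<open>(i + 1, b', c)\<close> are non-adjacent exactly when \<open>b = b'\<close>.\<close>

definition cadj :: "nat \<Rightarrow> nat \<times> nat \<times> nat \<Rightarrow> nat \<times> nat \<times> nat \<Rightarrow> bool" where
  "cadj k = (\<lambda>(i, a, b) (j, c, d). i < k \<and> j < k \<and> ((j = cyc_succ k i \<and> b \<noteq> c) \<or> (i = cyc_succ k j \<and> d \<noteq> a)))"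

text \<open>A labelling \<phi> of the cycle selects one vertex over each i, carrying the labels of i
  and of its successor, so that consecutive choices agree and are non-adjacent. The extra vertex
  makes members intersect.\<close>

definition cset :: "nat \<Rightarrow> (nat \<Rightarrow> nat) \<Rightarrow> (nat \<times> nat \<times> nat) set" where
  "cset k \<phi> = insert (k, 0, 0) ((\<lambda>i. (i, \<phi> i, \<phi> (cyc_succ k i))) ` {..<k})"

text \<open>A vertex outside the member of \<phi> has a wrong label on one side and is adjacent to
  the chosen vertex there. A triangle would need three pairwise consecutive indices, impossible for
  k \<ge> 4. There are q^k labellings on about k * q^2 vertices, so even |V|^2 edges are only of
  order s^(4/k).\<close>

lemma upper_cycle:
  assumes k: "4 \<le> k" and s: "s \<le> q ^ k"
  shows "\<exists>(V :: nat set) E F. maximal_rt_system 3 (k + 1) V E F \<and> size F = s \<and> card V = k * q\<^sup>2 + 1"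
proof -
  let ?P = "{..<k} \<rightarrow>\<^sub>E {..<q}"
  have "card ?P = q ^ k" by (simp add: card_PiE)
  then have sP: "s \<le> card ?P" using s by simp
  obtain \<Phi> where \<Phi>: "\<Phi> \<subseteq> ?P" "card \<Phi> = s" "finite \<Phi>" by (rule obtain_subfamily[OF sP])
  have tf: "triangle_free (cadj k)"
  proof
    show "\<not> cadj k x z" if "cadj k x y" "cadj k y z" for x y z
    proof -
      obtain i a b j c d l e f where "x = (i, a, b)" "y = (j, c, d)" "z = (l, e, f)" by (cases x, cases y, cases z)
      then show ?thesis using that k by (auto simp: cadj_def cyc_succ_def split: if_splits)
    qed
  qed (auto simp: cadj_def)
  interpret triangle_free "cadj k" by (rule tf)
  define V where "V = insert (k, 0, 0) ({..<k} \<times> {..<q} \<times> {..<q})"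
  have finV: "finite V" by (simp add: V_def)
  have cV: "card V = k * q\<^sup>2 + 1"
    unfolding V_def by (subst card_insert_disjoint) (auto simp: card_cartesian_product power2_eq_square)
  have succ_less: "cyc_succ k i < k" if "i < k" for i using that by (auto simp: cyc_succ_def)
  have pre: "\<exists>j<k. cyc_succ k j = i" if "i < k" for i
  proof (cases "i = 0")
    case True
    then show ?thesis using k by (intro exI[of _ "k - 1"]) (auto simp: cyc_succ_def)
  next
    case False
    then show ?thesis using that by (intro exI[of _ "i - 1"]) (auto simp: cyc_succ_def)
  qed
  have mem: "(i, \<phi> i, \<phi> (cyc_succ k i)) \<in> cset k \<phi>" if "i < k" for \<phi> i using that by (auto simp: cset_def)
  have mis: "cset k ` \<Phi> \<subseteq> mis V (k + 1)"
  proof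
    fix X assume "X \<in> cset k ` \<Phi>"
    then obtain \<phi> where \<phi>: "\<phi> \<in> ?P" "X = cset k \<phi>" using \<Phi>(1) by auto
    have lt: "\<phi> i < q" if "i < k" for i using \<phi>(1) that by auto
    have "card ((\<lambda>i. (i, \<phi> i, \<phi> (cyc_succ k i))) ` {..<k}) = k" by (subst card_image) (auto simp: inj_on_def)
    then have "card X = k + 1" unfolding \<phi>(2) cset_def by (subst card_insert_disjoint) auto
    moreover have "X \<subseteq> V" unfolding \<phi>(2) cset_def V_def using lt succ_less by auto
    moreover have "finite X" unfolding \<phi>(2) cset_def by simp
    moreover have "\<not> cadj k x y" if "x \<in> X" "y \<in> X" for x y
      using that unfolding \<phi>(2) cset_def by (auto simp: cadj_def)
    moreover have "\<exists>y\<in>X. cadj k x y" if x: "x \<in> V - X" for x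
    proof -
      have "(k, 0, 0) \<in> X" unfolding \<phi>(2) cset_def by simp
      then obtain i a b where xi: "x = (i, a, b)" "i < k" using x by (auto simp: V_def)
      have "a \<noteq> \<phi> i \<or> b \<noteq> \<phi> (cyc_succ k i)" using x xi mem[of i \<phi>] \<phi>(2) by auto
      then show ?thesis
      proof
        assume "b \<noteq> \<phi> (cyc_succ k i)"
        then have "cadj k x (cyc_succ k i, \<phi> (cyc_succ k i), \<phi> (cyc_succ k (cyc_succ k i)))" using xi succ_less by (auto simp: cadj_def)
        then show ?thesis using mem[OF succ_less[OF xi(2)]] \<phi>(2) by blast
      next
        assume a: "a \<noteq> \<phi> i"
        obtain j where j: "j < k" "cyc_succ k j = i" using pre xi(2) by blast
        then have "cadj k x (j, \<phi> j, \<phi> (cyc_succ k j))" using xi a by (auto simp: cadj_def)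
        then show ?thesis using mem[OF j(1)] \<phi>(2) by blast
      qed
    qed
    ultimately show "X \<in> mis V (k + 1)" unfolding mis_def by blast
  qed
  have inj: "inj_on (cset k) \<Phi>"
  proof (rule inj_onI)
    fix \<phi> \<psi> assume h: "\<phi> \<in> \<Phi>" "\<psi> \<in> \<Phi>" "cset k \<phi> = cset k \<psi>"
    show "\<phi> = \<psi>"
    proof (rule PiE_ext)
      show "\<phi> \<in> ?P" "\<psi> \<in> ?P" using h \<Phi> by auto
      fix c assume c: "c \<in> {..<k}"
      then have "(c, \<phi> c, \<phi> (cyc_succ k c)) \<in> cset k \<psi>" using mem[of c \<phi>] h(3) by simp
      then show "\<phi> c = \<psi> c" using c by (auto simp: cset_def)
    qed
  qed
  have x: "(k, 0, 0) \<in> X" if "X \<in> cset k ` \<Phi>" for X using that by (auto simp: cset_def)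
  have int: "X \<inter> Y \<noteq> {}" if "X \<in> cset k ` \<Phi>" "Y \<in> cset k ` \<Phi>" for X Y using x[OF that(1)] x[OF that(2)] by blast
  have one: "1 \<le> k + 1" by simp
  obtain V' :: "nat set" and E F adj' where C: "maximal_rt_system 3 (k + 1) V' E F" "size F = card (cset k ` \<Phi>)" "card V' = card V"
    "\<forall>a b. adj' a b \<longrightarrow> a \<in> V \<and> b \<in> V \<and> adj' b a \<and> a \<noteq> b" "\<forall>a\<in>V. \<forall>b\<in>V. cadj k a b \<longrightarrow> adj' a b"
    "\<forall>a b c. adj' a b \<longrightarrow> adj' b c \<longrightarrow> \<not> adj' a c"
    "\<forall>S\<in>cset k ` \<Phi>. \<forall>a\<in>S. \<forall>b\<in>S. \<not> adj' a b" "2 * card E = card {p \<in> V \<times> V. adj' (fst p) (snd p)}"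
    by (rule maximal_system_of_mis[OF tf finV mis one int])
  have "size F = s" "card V' = k * q\<^sup>2 + 1" using C(2,3) cV \<Phi>(2) card_image[OF inj] by simp_all
  then show ?thesis using C(1) by blast
qed

subsection \<open>The extremal functions\<close>

lemma e_min_maximal_le:
  fixes V :: "nat set"
  assumes "maximal_rt_system r t V E F" shows "e_min_maximal r t (size F) \<le> card E"
  unfolding e_min_maximal_def by (rule cInf_lower) (use assms in auto)

text \<open>The infimum is attained once the set is nonempty, so one system with the required number
  of members is supplied.\<close>

lemma e_min_witness:
  fixes V0 :: "nat set"
  assumes "rt_system r t V0 E0 F0"
  obtains V :: "nat set" and E F where "rt_system r t V E F" "size F = size F0" "card E = e_min r t (size F0)"
proof -
  have "e_min r t (size F0) \<in> {card E | (V :: nat set) E F. rt_system r t V E F \<and> size F = size F0}"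
    unfolding e_min_def by (rule Inf_nat_def1) (use assms in blast)
  then obtain V :: "nat set" and E F where "rt_system r t V E F" "size F = size F0" "card E = e_min r t (size F0)"
    by auto
  then show thesis by (rule that)
qed

lemma e_min_le_e_min_maximal:
  fixes V0 :: "nat set"
  assumes "maximal_rt_system r t V0 E0 F0"
  shows "e_min r t (size F0) \<le> e_min_maximal r t (size F0)"
proof -
  have "e_min_maximal r t (size F0) \<in> {card E | (V :: nat set) E F. maximal_rt_system r t V E F \<and> size F = size F0}"
    unfolding e_min_maximal_def by (rule Inf_nat_def1) (use assms in blast)
  then obtain V :: "nat set" and E F where "maximal_rt_system r t V E F" "size F = size F0"
    "card E = e_min_maximal r t (size F0)" by auto
  moreover from this have "card E \<in> {card E | (V :: nat set) E F. rt_system r t V E F \<and> size F = size F0}"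
    using maximal_rt_imp_rt by blast
  then have "e_min r t (size F0) \<le> card E" unfolding e_min_def by (intro cInf_lower) auto
  ultimately show ?thesis by simp
qed

lemma maximal_join:
  fixes V :: "nat set"
  assumes m: "maximal_rt_system 3 t V E F" and r: "3 \<le> r"
  obtains V' :: "nat set" and E' F' where "maximal_rt_system r (t + (r - 3)) V' E' F'" "size F' = size F"
    "card V' = card V + (r - 3)" "card E' = card E + (r - 3) * card V + ((r - 3) choose 2)"
proof -
  have "3 + (r - 3) = r" using r by simp
  then show thesis using maximal_cones[OF m, of "r - 3"] that by auto
qed

lemma card_edges_le:
  assumes "rt_system r t V E F" shows "card E \<le> (card V)\<^sup>2"
proof -
  interpret set_system r t V E "set_mset F" by (rule rt_system_set_system[OF assms])
  have "card E \<le> card ([V]\<^bsup>2\<^esup>)" using EV finV by (intro card_mono finite_imp_finite_nsets)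
  also have "\<dots> \<le> (card V)\<^sup>2"
    by (cases "2 \<le> card V") (simp_all add: binomial_le_pow binomial_eq_0)
  finally show ?thesis .
qed

lemma cycle_system:
  assumes r: "3 \<le> r" and t: "r + 2 \<le> t" and s: "s \<le> q ^ (t - r + 2)"
  obtains V :: "nat set" and E F where "maximal_rt_system r t V E F" "size F = s"
    "card V = (t - r + 2) * q\<^sup>2 + 1 + (r - 3)"
proof -
  have k: "4 \<le> t - r + 2" using t by simp
  obtain V :: "nat set" and E F where V: "maximal_rt_system 3 (t - r + 2 + 1) V E F" "size F = s"
    "card V = (t - r + 2) * q\<^sup>2 + 1" using upper_cycle[OF k s] by auto
  have tt: "t - r + 2 + 1 + (r - 3) = t" using r t by simp
  obtain V' :: "nat set" and E' F' where V': "maximal_rt_system r (t - r + 2 + 1 + (r - 3)) V' E' F'" "size F' = size F"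
    "card V' = card V + (r - 3)" "card E' = card E + (r - 3) * card V + ((r - 3) choose 2)"
    by (rule maximal_join[OF V(1) r])
  show thesis
  proof (rule that[of V' E' F'])
    show "maximal_rt_system r t V' E' F'" using V'(1) unfolding tt .
  qed (use V'(2,3) V(2,3) in simp_all)
qed

text \<open>The wasteful choice q = s + 1 works for every s, so the comparison of the two minima
  holds without exception.\<close>

lemma maximal_system_exists:
  assumes r: "3 \<le> r" and t: "r + 2 \<le> t"
  shows "\<exists>(V :: nat set) E F. maximal_rt_system r t V E F \<and> size F = s"
proof -
  have "s \<le> Suc s ^ (t - r + 2)" using self_le_power[of "Suc s" "t - r + 2"] by simp
  then show ?thesis using cycle_system[OF r t, of s "Suc s"] by blast
qed

text \<open>Once s > C the hypothesis forces e s \<ge> 1, so e s + 1 \<le> 2 * e s and k-th roots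
  can be taken.\<close>

lemma root_bigo:
  fixes e :: "nat \<Rightarrow> nat"
  assumes h: "\<forall>\<^sub>F s in sequentially. s ^ j \<le> C * (e s + 1) ^ k" and jk: "0 < j" "0 < k"
  shows "(\<lambda>s. real s powr (real j / real k)) \<in> O(\<lambda>s. real (e s))"
proof (rule bigoI)
  show "\<forall>\<^sub>F s in sequentially. norm (real s powr (real j / real k)) \<le> (real C powr (1 / real k) * 2) * norm (real (e s))"
    using h eventually_gt_at_top[of C]
  proof eventually_elim
    fix s assume h: "s ^ j \<le> C * (e s + 1) ^ k" and s: "C < s"
    have "1 \<le> e s"
    proof (rule ccontr)
      assume "\<not> ?thesis"
      then have "e s = 0" by simp
      then have "s ^ j \<le> C" using h by simp
      moreover have "s \<le> s ^ j" using s jk by (intro self_le_power) auto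
      ultimately show False using s by simp
    qed
    then have "(e s + 1) ^ k \<le> (2 * e s) ^ k" by (intro power_mono) auto
    then have "s ^ j \<le> C * (2 * e s) ^ k" using h by (meson mult_le_mono2 order_trans)
    then have "real s ^ j \<le> real C * (2 * real (e s)) ^ k"
      by (metis of_nat_le_iff of_nat_mult of_nat_numeral of_nat_power)
    then have "(real s ^ j) powr (1 / real k) \<le> (real C * (2 * real (e s)) ^ k) powr (1 / real k)"
      by (intro powr_mono2) auto
    also have "\<dots> = real C powr (1 / real k) * ((2 * real (e s)) ^ k) powr (1 / real k)" by (simp add: powr_mult)
    also have "((2 * real (e s)) ^ k) powr (1 / real k) = 2 * real (e s)"
    proof -
      have root: "(y ^ k) powr (1 / real k) = y" if "0 < y" for y :: real
        using jk that by (simp add: powr_powr flip: powr_realpow)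
      show ?thesis by (rule root) (use \<open>1 \<le> e s\<close> in simp)
    qed
    also have "(real s ^ j) powr (1 / real k) = real s powr (real j / real k)"
      using s by (simp add: powr_powr flip: powr_realpow)
    finally show "norm (real s powr (real j / real k)) \<le> (real C powr (1 / real k) * 2) * norm (real (e s))" by simp
  qed
qed

lemma e_min_r_r:
  assumes r: "3 \<le> r"
  shows "\<forall>\<^sub>F s in sequentially.
       int (e_min r r s) = (int s)\<^sup>2 + (2 * int r - 7) * int s + int ((r - 2) choose 2) \<and>
       int (e_min_maximal r r s) = (int s)\<^sup>2 + (2 * int r - 7) * int s + int ((r - 2) choose 2)"
proof -
  obtain s0 where s0: "\<forall>(V :: nat set) E F. set_system r r V E F \<longrightarrow> s0 \<le> card F \<longrightarrow>
    (int (card F))\<^sup>2 + (2 * int r - 7) * int (card F) + int ((r - 2) choose 2) \<le> int (card E)"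
    using lower_bound_r_r[OF r] ..
  show ?thesis using eventually_ge_at_top[of "max 3 s0"]
  proof eventually_elim
    fix s assume "max 3 s0 \<le> s"
    then have s: "3 \<le> s" "s0 \<le> s" by auto
    define X where "X = (int s)\<^sup>2 + (2 * int r - 7) * int s + int ((r - 2) choose 2)"
    obtain V :: "nat set" and E F where V: "maximal_rt_system 3 3 V E F" "size F = s" "card V = 2 * s + 1" "card E \<le> s * (s - 1)"
      using upper_3_3[OF s(1)] by auto
    obtain V' :: "nat set" and E' F' where V': "maximal_rt_system r (3 + (r - 3)) V' E' F'" "size F' = size F"
      "card V' = card V + (r - 3)" "card E' = card E + (r - 3) * card V + ((r - 3) choose 2)"
      by (rule maximal_join[OF V(1) r])
    have rr: "3 + (r - 3) = r" using r by simp
    have m: "maximal_rt_system r r V' E' F'" using V'(1) rr by simp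
    have sz: "size F' = s" using V' V by simp
    have up: "int (e_min_maximal r r s) \<le> X"
    proof -
      have "e_min_maximal r r s \<le> card E'" using e_min_maximal_le[OF m] sz by simp
      also have "\<dots> \<le> s * (s - 1) + (r - 3) * (2 * s + 1) + ((r - 3) choose 2)" using V'(4) V(3,4) by simp
      finally have "int (e_min_maximal r r s) \<le> int (s * (s - 1) + (r - 3) * (2 * s + 1) + ((r - 3) choose 2))"
        by (simp only: of_nat_le_iff)
      also have "\<dots> = X"
      proof -
        \<comment> \<open>Substituting for \<open>r\<close> and \<open>s\<close> removes the
          truncated subtractions.\<close>
        obtain n where n: "r = n + 3" using r by (metis add.commute le_Suc_ex)
        obtain m where m: "s = Suc m" using s(1) by (cases s) auto
        show ?thesis unfolding X_def n m
          by (simp add: numeral_2_eq_2 power2_eq_square algebra_simps)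
      qed
      finally show ?thesis .
    qed
    have mid: "e_min r r s \<le> e_min_maximal r r s" using e_min_le_e_min_maximal[OF m] sz by simp
    obtain V1 :: "nat set" and E1 F1 where W: "rt_system r r V1 E1 F1" "size F1 = size F'" "card E1 = e_min r r (size F')"
      by (rule e_min_witness[OF maximal_rt_imp_rt[OF m]])
    have "set_system r r V1 E1 (set_mset F1)" "card (set_mset F1) = s"
      using rt_system_set_system[OF W(1)] W(2) sz by auto
    then have "X \<le> int (card E1)" using s0 s(2) unfolding X_def by blast
    then have "X \<le> int (e_min r r s)" using W(3) sz by simp
    then show "int (e_min r r s) = (int s)\<^sup>2 + (2 * int r - 7) * int s + int ((r - 2) choose 2) \<and>
       int (e_min_maximal r r s) = (int s)\<^sup>2 + (2 * int r - 7) * int s + int ((r - 2) choose 2)"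
      using up mid unfolding X_def by linarith
  qed
qed

lemma nat_ceiling_bounds:
  fixes x :: real assumes "1 \<le> x"
  shows "x \<le> real (nat \<lceil>x\<rceil>)" "real (nat \<lceil>x\<rceil>) \<le> x + 1" "real (nat \<lceil>x\<rceil>) \<le> 2 * x"
  using assms by linarith+

lemma e_min_r_Suc_r:
  assumes r: "3 \<le> r"
  shows "(\<lambda>s. real (e_min r (r + 1) s)) \<in> \<Theta>(\<lambda>s. real s powr (3 / 2)) \<and>
       (\<lambda>s. real (e_min_maximal r (r + 1) s)) \<in> \<Theta>(\<lambda>s. real s powr (3 / 2))"
proof -
  define n where "n = r - 3"
  define K where "K = real (110 + 11 * n + (n choose 2))"
  have ex: "\<exists>(V :: nat set) E F. maximal_rt_system r (r + 1) V E F \<and> size F = s \<and> real (card E) \<le> K * real s powr (3 / 2)"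
    if s: "1 \<le> s" for s
  proof -
    define x where "x = sqrt (real s)"
    define q where "q = nat \<lceil>x\<rceil>"
    \<comment> \<open>Ensures p \<ge> 5 and \<open>p choose 2\<close> \<ge> q^2 \<ge> s, while p
      stays of order sqrt s.\<close>
    define p where "p = 2 * q + 5"
    have x1: "1 \<le> x" using s by (simp add: x_def)
    have xx: "x * x = real s" by (simp add: x_def)
    note q = nat_ceiling_bounds[OF x1, folded q_def]
    have "real s \<le> real q * real q" using q(1) x1 xx mult_mono[of x "real q" x "real q"] by simp
    then have "s \<le> q * q" by (metis of_nat_le_iff of_nat_mult)
    also have "\<dots> \<le> p choose 2"
    proof -
      have "2 * (q * q) \<le> p * (p - 1)" by (simp add: p_def algebra_simps)
      then show ?thesis unfolding choose_two by linarith
    qed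
    finally have sp: "s \<le> p choose 2" .
    have p5: "5 \<le> p" by (simp add: p_def)
    obtain V :: "nat set" and E F where V: "maximal_rt_system 3 4 V E F" "size F = s" "card V = p + 1 + s"
      "card E \<le> (p + 1) * (p + 1 + s)" using upper_3_4[OF p5 sp] by auto
    obtain V' :: "nat set" and E' F' where V': "maximal_rt_system r (4 + (r - 3)) V' E' F'" "size F' = size F"
      "card V' = card V + (r - 3)" "card E' = card E + (r - 3) * card V + ((r - 3) choose 2)"
      by (rule maximal_join[OF V(1) r])
    have rr: "4 + (r - 3) = r + 1" using r by simp
    have "card E' \<le> (p + 1) * (p + 1 + s) + n * (p + 1 + s) + (n choose 2)" using V' V by (simp add: n_def)
    then have "real (card E') \<le> real ((p + 1) * (p + 1 + s) + n * (p + 1 + s) + (n choose 2))" by (simp only: of_nat_le_iff)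
    also have "\<dots> = real (p + 1) * real (p + 1 + s) + real n * real (p + 1 + s) + real (n choose 2)" by (simp only: of_nat_add of_nat_mult)
    also have "\<dots> \<le> (10 * x) * (11 * real s) + real n * (11 * (x * real s)) + real (n choose 2) * (x * real s)"
    proof (intro add_mono)
      have p1: "real (p + 1) \<le> 10 * x" using q(3) x1 by (simp add: p_def)
      have xs: "x \<le> real s" using x1 xx mult_left_mono[of 1 x x] by simp
      have p2: "real (p + 1 + s) \<le> 11 * real s" using p1 xs by simp
      have s1: "real s \<le> x * real s" using mult_right_mono[OF x1, of "real s"] by simp
      show "real (p + 1) * real (p + 1 + s) \<le> (10 * x) * (11 * real s)" using p1 p2 x1 by (intro mult_mono) auto
      have "real (p + 1 + s) \<le> 11 * (x * real s)" using p2 s1 by linarith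
      then show "real n * real (p + 1 + s) \<le> real n * (11 * (x * real s))" by (rule mult_left_mono) simp
      have "1 \<le> x * real s" using x1 s mult_mono[of 1 x 1 "real s"] by simp
      then show "real (n choose 2) \<le> real (n choose 2) * (x * real s)" by (metis mult_left_mono mult.right_neutral of_nat_0_le_iff)
    qed
    also have "\<dots> = K * (x * real s)" by (simp add: K_def algebra_simps)
    also have "x * real s = real s powr (3 / 2)"
    proof -
      have "real s powr (3 / 2) = real s powr (1 / 2) * real s powr 1"
        using powr_add[of "real s" "1 / 2" 1] by simp
      then show ?thesis using s by (simp add: x_def powr_half_sqrt)
    qed
    finally have "real (card E') \<le> K * real s powr (3 / 2)" .
    moreover have "maximal_rt_system r (r + 1) V' E' F'" using V'(1) unfolding rr .
    moreover have "size F' = s" using V'(2) V(2) by simp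
    ultimately show ?thesis by blast
  qed
  have le: "e_min r (r + 1) s \<le> e_min_maximal r (r + 1) s" if "1 \<le> s" for s
    using ex[OF that] e_min_le_e_min_maximal by blast
  have upM: "(\<lambda>s. real (e_min_maximal r (r + 1) s)) \<in> O(\<lambda>s. real s powr (3 / 2))"
  proof (rule bigoI)
    show "\<forall>\<^sub>F s in sequentially. norm (real (e_min_maximal r (r + 1) s)) \<le> K * norm (real s powr (3 / 2))"
      using eventually_ge_at_top[of 1]
    proof eventually_elim
      fix s :: nat assume s: "1 \<le> s"
      obtain V :: "nat set" and E F where V: "maximal_rt_system r (r + 1) V E F" "size F = s"
        "real (card E) \<le> K * real s powr (3 / 2)" using ex[OF s] by blast
      have "real (e_min_maximal r (r + 1) s) \<le> real (card E)" using e_min_maximal_le[OF V(1)] V(2) by simp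
      then show "norm (real (e_min_maximal r (r + 1) s)) \<le> K * norm (real s powr (3 / 2))" using V(3) by simp
    qed
  qed
  have evle: "\<forall>\<^sub>F s in sequentially. norm (real (e_min r (r + 1) s)) \<le> 1 * norm (real (e_min_maximal r (r + 1) s))"
    using eventually_ge_at_top[of 1] by eventually_elim (use le in auto)
  then have bigle: "(\<lambda>s. real (e_min r (r + 1) s)) \<in> O(\<lambda>s. real (e_min_maximal r (r + 1) s))" by (rule bigoI)
  obtain C where C: "\<forall>(V :: nat set) E F. set_system r (r + 1) V E F \<longrightarrow> card F ^ 3 \<le> C * (card E + 1)\<^sup>2"
    using lower_bound_r_Suc_r[OF r] ..
  have "\<forall>\<^sub>F s in sequentially. s ^ 3 \<le> C * (e_min r (r + 1) s + 1) ^ 2"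
    using eventually_ge_at_top[of 1]
  proof eventually_elim
    fix s :: nat assume s: "1 \<le> s"
    obtain V :: "nat set" and E F where V: "maximal_rt_system r (r + 1) V E F" "size F = s" using ex[OF s] by blast
    obtain V1 :: "nat set" and E1 F1 where W: "rt_system r (r + 1) V1 E1 F1" "size F1 = size F" "card E1 = e_min r (r + 1) (size F)"
      by (rule e_min_witness[OF maximal_rt_imp_rt[OF V(1)]])
    show "s ^ 3 \<le> C * (e_min r (r + 1) s + 1) ^ 2"
      using C rt_system_set_system[OF W(1)] W V(2) by metis
  qed
  from root_bigo[OF this] have lo: "(\<lambda>s. real s powr (3 / 2)) \<in> O(\<lambda>s. real (e_min r (r + 1) s))" by simp
  have loM: "(\<lambda>s. real s powr (3 / 2)) \<in> O(\<lambda>s. real (e_min_maximal r (r + 1) s))"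
    by (rule landau_o.big_trans[OF lo bigle])
  have up: "(\<lambda>s. real (e_min r (r + 1) s)) \<in> O(\<lambda>s. real s powr (3 / 2))"
    by (rule landau_o.big_trans[OF bigle upM])
  show ?thesis using up upM lo loM by (auto simp: bigtheta_def bigomega_iff_bigo)
qed

lemma e_min_r_t:
  assumes r: "3 \<le> r" and t: "r + 2 \<le> t"
  shows "(\<lambda>s. real s powr (1 / (real t - real r + 2))) \<in> O(\<lambda>s. real (e_min r t s)) \<and>
       (\<forall>s. e_min r t s \<le> e_min_maximal r t s) \<and>
       (\<lambda>s. real (e_min_maximal r t s)) \<in> O(\<lambda>s. real s powr (4 / (real t - real r + 2)))"
proof (intro conjI allI)
  define k where "k = t - r + 2"
  have k: "4 \<le> k" "real t - real r + 2 = real k" "t - (r - 2) = k" using r t by (auto simp: k_def of_nat_diff)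
  note ex = maximal_system_exists[OF r t]
  show "e_min r t s \<le> e_min_maximal r t s" for s using ex[of s] e_min_le_e_min_maximal by blast
  have "\<forall>\<^sub>F s in sequentially. s ^ 1 \<le> (2 ^ t * (t + 2) ^ k) * (e_min r t s + 1) ^ k"
    using eventually_ge_at_top[of 2]
  proof eventually_elim
    fix s :: nat assume s: "2 \<le> s"
    obtain V :: "nat set" and E F where V: "maximal_rt_system r t V E F" "size F = s" using ex[of s] by blast
    obtain V1 :: "nat set" and E1 F1 where W: "rt_system r t V1 E1 F1" "size F1 = size F" "card E1 = e_min r t (size F)"
      by (rule e_min_witness[OF maximal_rt_imp_rt[OF V(1)]])
    interpret set_system r t V1 E1 "set_mset F1" by (rule rt_system_set_system[OF W(1)])
    have c: "card (set_mset F1) = s" using rt_system_set_system[OF W(1)] W(2) V(2) by simp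
    have "s \<le> 2 ^ t * (2 * card E1 + t) ^ k" using card_F_le_edges c s t k(3) by simp
    also have "\<dots> \<le> 2 ^ t * ((t + 2) * (card E1 + 1)) ^ k" by (intro mult_le_mono2 power_mono) auto
    also have "\<dots> = (2 ^ t * (t + 2) ^ k) * (e_min r t s + 1) ^ k" using W(3) V(2) by (simp only: power_mult_distrib mult.assoc)
    finally show "s ^ 1 \<le> (2 ^ t * (t + 2) ^ k) * (e_min r t s + 1) ^ k" by simp
  qed
  from root_bigo[OF this] k show "(\<lambda>s. real s powr (1 / (real t - real r + 2))) \<in> O(\<lambda>s. real (e_min r t s))" by simp
  define K where "K = real (k + 1 + (r - 3))"
  have "(\<lambda>s. real (e_min_maximal r t s)) \<in> O(\<lambda>s. real s powr (4 / real k))"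
  proof (rule bigoI)
    show "\<forall>\<^sub>F s in sequentially. norm (real (e_min_maximal r t s)) \<le> (K\<^sup>2 * 16) * norm (real s powr (4 / real k))"
      using eventually_ge_at_top[of 1]
    proof eventually_elim
      fix s :: nat assume s: "1 \<le> s"
      define x where "x = real s powr (1 / real k)"
      define q where "q = nat \<lceil>x\<rceil>"
      have x1: "1 \<le> x" unfolding x_def using s by (intro ge_one_powr_ge_zero) auto
      note q = nat_ceiling_bounds[OF x1, folded q_def]
      have q1: "1 \<le> q" using q(1) x1 by linarith
      have "real s = x ^ k" using s k(1) by (simp add: x_def powr_powr flip: powr_realpow)
      also have "\<dots> \<le> real q ^ k" using q(1) x1 by (intro power_mono) auto
      finally have sq: "s \<le> q ^ k" by (metis of_nat_le_iff of_nat_power)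
      obtain V :: "nat set" and E F where V: "maximal_rt_system r t V E F" "size F = s"
        "card V = k * q\<^sup>2 + 1 + (r - 3)" using cycle_system[OF r t sq[unfolded k_def]] unfolding k_def by blast
      have "card V \<le> (k + 1 + (r - 3)) * q\<^sup>2"
      proof -
        have "1 \<le> q\<^sup>2" using q1 by simp
        then have "(r - 3) * 1 \<le> (r - 3) * q\<^sup>2" by (rule mult_le_mono2)
        then show ?thesis using V(3) \<open>1 \<le> q\<^sup>2\<close> by (simp add: algebra_simps)
      qed
      then have cV: "real (card V) \<le> K * (real q)\<^sup>2" unfolding K_def by (metis of_nat_le_iff of_nat_mult of_nat_power)
      have "real (e_min_maximal r t s) \<le> real (card E)" using e_min_maximal_le[OF V(1)] V(2) by simp
      also have "\<dots> \<le> (real (card V))\<^sup>2" using card_edges_le[OF maximal_rt_imp_rt[OF V(1)]] by (metis of_nat_le_iff of_nat_power)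
      also have "\<dots> \<le> (K * (real q)\<^sup>2)\<^sup>2" using cV by (intro power_mono) auto
      also have "\<dots> \<le> (K * (2 * x)\<^sup>2)\<^sup>2"
        using q(3) by (intro power_mono mult_left_mono) (auto simp: K_def)
      also have "\<dots> = (K\<^sup>2 * 16) * x ^ 4" by (simp add: power2_eq_square power4_eq_xxxx)
      also have "x ^ 4 = real s powr (4 / real k)"
        using s by (simp add: x_def powr_powr flip: powr_realpow)
      finally show "norm (real (e_min_maximal r t s)) \<le> (K\<^sup>2 * 16) * norm (real s powr (4 / real k))" by simp
    qed
  qed
  then show "(\<lambda>s. real (e_min_maximal r t s)) \<in> O(\<lambda>s. real s powr (4 / (real t - real r + 2)))" using k(2) by simp
qed

lemma e_min_3_t_lower:
  assumes t: "5 \<le> t"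
  shows "(\<lambda>s. real s powr (2 / (real t - 3))) \<in> O(\<lambda>s. real (e_min 3 t s))"
proof -
  have t': "3 + 2 \<le> t" using t by simp
  obtain C where C: "\<forall>(V :: nat set) E F. set_system 3 t V E F \<longrightarrow> (card F)\<^sup>2 \<le> C * (2 * card E + 1) ^ (t - 3)"
    using lower_bound_3_t[OF t] ..
  have "\<forall>\<^sub>F s in sequentially. s ^ 2 \<le> (C * 2 ^ (t - 3)) * (e_min 3 t s + 1) ^ (t - 3)"
  proof (rule always_eventually, rule allI)
    fix s :: nat
    obtain V :: "nat set" and E F where V: "maximal_rt_system 3 t V E F" "size F = s"
      using maximal_system_exists[OF order_refl t', of s] by blast
    obtain V1 :: "nat set" and E1 F1 where W: "rt_system 3 t V1 E1 F1" "size F1 = size F" "card E1 = e_min 3 t (size F)"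
      by (rule e_min_witness[OF maximal_rt_imp_rt[OF V(1)]])
    have "card (set_mset F1) = s" using rt_system_set_system[OF W(1)] W(2) V(2) by simp
    then have "s\<^sup>2 \<le> C * (2 * card E1 + 1) ^ (t - 3)" using C rt_system_set_system(1)[OF W(1)] by blast
    also have "\<dots> \<le> C * (2 * (card E1 + 1)) ^ (t - 3)" by (intro mult_le_mono2 power_mono) auto
    also have "\<dots> = (C * 2 ^ (t - 3)) * (e_min 3 t s + 1) ^ (t - 3)"
      using W(3) V(2) by (simp only: power_mult_distrib mult.assoc)
    finally show "s\<^sup>2 \<le> (C * 2 ^ (t - 3)) * (e_min 3 t s + 1) ^ (t - 3)" .
  qed
  from root_bigo[OF this] t show ?thesis by (simp add: of_nat_diff)
qed

lemma powr_smallo_real: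
  assumes "p < 1" shows "(\<lambda>s. real s powr p) \<in> o(\<lambda>s. real s)"
proof -
  have "(\<lambda>s. real s powr p) \<in> o(\<lambda>s. real s powr 1)"
    using assms by (subst powr_smallo_iff) (auto intro: filterlim_real_sequentially)
  then show ?thesis by simp
qed

lemma e_min_3_5:
  "\<exists>f g :: nat \<Rightarrow> real. f \<in> o(\<lambda>s. real s) \<and> g \<in> o(\<lambda>s. real s) \<and>
       (\<forall>s. 2 / 3 * real s + f s \<le> real (e_min 3 5 s) \<and>
            e_min 3 5 s \<le> e_min_maximal 3 5 s \<and>
            real (e_min_maximal 3 5 s) \<le> 2 * real s + g s)"
proof -
  have le: "e_min 3 5 s \<le> e_min_maximal 3 5 s" for s using e_min_r_t[of 3 5] by simp
  obtain K where K: "\<forall>(V :: nat set) E F. set_system 3 5 V E F \<longrightarrow>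
    2 / 3 * real (card F) \<le> real (card E) + 61 * real (card F) powr (3 / 4) + K"
    using lower_bound_3_5 ..
  \<comment> \<open>For s \<ge> 9 the rounded square root is at least 3, as \<open>upper_3_5\<close>
    requires; \<open>L\<close> absorbs the smaller s.\<close>
  define L where "L = (\<Sum>s<9. real (e_min_maximal 3 5 s))"
  define f where "f s = - (61 * real s powr (3 / 4) + K)" for s :: nat
  define g where "g s = 16 * real s powr (1 / 2) + (10 + L)" for s :: nat
  have const: "(\<lambda>s. c) \<in> o(\<lambda>s. real s)" for c :: real
    by (rule smalloI_tendsto) (auto intro!: tendsto_divide_0 filterlim_at_top_imp_at_infinity filterlim_real_sequentially
      eventually_mono[OF eventually_gt_at_top[of 0]])
  have fo: "f \<in> o(\<lambda>s. real s)"
  proof -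
    have "(\<lambda>s. 61 * real s powr (3 / 4) + K) \<in> o(\<lambda>s. real s)"
      by (intro sum_in_smallo const) (simp add: powr_smallo_real)
    then show ?thesis unfolding f_def by (simp only: landau_o.small.uminus_in_iff)
  qed
  have go: "g \<in> o(\<lambda>s. real s)"
    unfolding g_def by (intro sum_in_smallo const) (simp add: powr_smallo_real)
  have lower: "2 / 3 * real s + f s \<le> real (e_min 3 5 s)" for s
  proof -
    obtain V :: "nat set" and E F where V: "maximal_rt_system 3 5 V E F" "size F = s"
      using maximal_system_exists[of 3 5 s] by auto
    obtain V1 :: "nat set" and E1 F1 where W: "rt_system 3 5 V1 E1 F1" "size F1 = size F" "card E1 = e_min 3 5 (size F)"
      by (rule e_min_witness[OF maximal_rt_imp_rt[OF V(1)]])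
    have "card (set_mset F1) = s" using rt_system_set_system[OF W(1)] W(2) V(2) by simp
    then have "2 / 3 * real s \<le> real (card E1) + 61 * real s powr (3 / 4) + K"
      using K rt_system_set_system(1)[OF W(1)] by blast
    then show ?thesis using W(3) V(2) by (simp add: f_def)
  qed
  have upper: "real (e_min_maximal 3 5 s) \<le> 2 * real s + g s" for s
  proof (cases "s < 9")
    case True
    then have "real (e_min_maximal 3 5 s) \<le> L"
      unfolding L_def by (intro member_le_sum) auto
    then show ?thesis by (simp add: g_def add_increasing)
  next
    case False
    define x where "x = sqrt (real s)"
    define m where "m = nat \<lceil>x\<rceil>"
    have x3: "3 \<le> x" unfolding x_def using False by (intro real_le_rsqrt) auto
    have xx: "x * x = real s" by (simp add: x_def)
    have m: "x \<le> real m" "real m \<le> x + 1" using nat_ceiling_bounds[of x] x3 by (auto simp: m_def)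
    have m3: "3 \<le> m" using m(1) x3 by linarith
    have "real s \<le> (real m)\<^sup>2" using m(1) x3 xx mult_mono[of x "real m" x "real m"] by (simp add: power2_eq_square)
    then have sm: "s \<le> m\<^sup>2" by (metis of_nat_le_iff of_nat_power)
    obtain V :: "nat set" and E F where V: "maximal_rt_system 3 5 V E F" "size F = s"
      "card E \<le> 2 * m\<^sup>2 + 4 * (m\<^sup>2 - s) + 4 * m" using upper_3_5[OF m3 sm] by auto
    have "real (e_min_maximal 3 5 s) \<le> real (card E)" using e_min_maximal_le[OF V(1)] V(2) by simp
    also have "\<dots> \<le> real (2 * m\<^sup>2 + 4 * (m\<^sup>2 - s) + 4 * m)" using V(3) by (simp only: of_nat_le_iff)
    also have "\<dots> = 2 * (real m)\<^sup>2 + 4 * ((real m)\<^sup>2 - real s) + 4 * real m" using sm by (simp add: of_nat_diff)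
    also have "\<dots> \<le> 2 * (x + 1)\<^sup>2 + 4 * ((x + 1)\<^sup>2 - real s) + 4 * (x + 1)"
      using m x3 by (intro add_mono mult_left_mono diff_mono power_mono) auto
    also have "\<dots> = 2 * real s + 16 * x + 10" using xx by (simp add: power2_eq_square algebra_simps)
    also have "\<dots> \<le> 2 * real s + g s"
    proof -
      have "0 \<le> L" unfolding L_def by (intro sum_nonneg) auto
      then show ?thesis by (simp add: g_def x_def powr_half_sqrt)
    qed
    finally show ?thesis .
  qed
  show ?thesis using fo go lower upper le by blast
qed

theorem theorem14:
  shows
   "(\<forall>r\<ge>3. \<forall>\<^sub>F s in sequentially.
       int (e_min r r s) = (int s)\<^sup>2 + (2 * int r - 7) * int s + int ((r - 2) choose 2) \<and>
       int (e_min_maximal r r s) = (int s)\<^sup>2 + (2 * int r - 7) * int s + int ((r - 2) choose 2))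
    \<and>
    (\<forall>r\<ge>3.
       (\<lambda>s. real (e_min r (r + 1) s)) \<in> \<Theta>(\<lambda>s. real s powr (3 / 2)) \<and>
       (\<lambda>s. real (e_min_maximal r (r + 1) s)) \<in> \<Theta>(\<lambda>s. real s powr (3 / 2)))
    \<and>
    (\<forall>r\<ge>3. \<forall>t\<ge>r + 2.
       (\<lambda>s. real s powr (1 / (real t - real r + 2))) \<in> O(\<lambda>s. real (e_min r t s)) \<and>
       (\<forall>s. e_min r t s \<le> e_min_maximal r t s) \<and>
       (\<lambda>s. real (e_min_maximal r t s)) \<in> O(\<lambda>s. real s powr (4 / (real t - real r + 2))))
    \<and>
    (\<forall>t\<ge>5.
       (\<lambda>s. real s powr (2 / (real t - 3))) \<in> O(\<lambda>s. real (e_min 3 t s)) \<and>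
       (\<forall>s. e_min 3 t s \<le> e_min_maximal 3 t s) \<and>
       (\<lambda>s. real (e_min_maximal 3 t s)) \<in> O(\<lambda>s. real s powr (4 / (real t - 1))))
    \<and>
    (\<exists>f g :: nat \<Rightarrow> real. f \<in> o(\<lambda>s. real s) \<and> g \<in> o(\<lambda>s. real s) \<and>
       (\<forall>s. 2 / 3 * real s + f s \<le> real (e_min 3 5 s) \<and>
            e_min 3 5 s \<le> e_min_maximal 3 5 s \<and>
            real (e_min_maximal 3 5 s) \<le> 2 * real s + g s))"
proof (intro conjI allI impI)
  fix t :: nat assume t: "5 \<le> t"
  have t': "3 + 2 \<le> t" using t by simp
  \<comment> \<open>At r = 3 the general upper exponent is already the one required here.\<close>
  have e: "real t - real 3 + 2 = real t - 1" by simp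
  note p = e_min_r_t[OF order_refl t', unfolded e]
  show "(\<lambda>s. real s powr (2 / (real t - 3))) \<in> O(\<lambda>s. real (e_min 3 t s))" by (rule e_min_3_t_lower[OF t])
  show "e_min 3 t s \<le> e_min_maximal 3 t s" for s using p by blast
  show "(\<lambda>s. real (e_min_maximal 3 t s)) \<in> O(\<lambda>s. real s powr (4 / (real t - 1)))" using p by blast
qed (use e_min_r_r e_min_r_Suc_r e_min_r_t e_min_3_5 in auto)

end
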